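(* Let $R$ be the homogeneous coordinate ring of a $0$-dimensional scheme $\mathbb{X}\subseteq\mathbb{P}^n$ as in the context, and let $\epsilon:\Omega^1_{R/K}\to\mathfrak{m}$ be the Euler form on $\Omega^1_{R/K}$. Then: (a) $T\Omega^1_{R/K}\subseteq\mathrm{Ker}(\epsilon)$. (b) $\mathrm{Ann}_R(dx_0)=\{0\}$ and $\mathrm{Ker}(\epsilon)\cap R\,dx_0=\{0\}$. (c) For $i\ge 2r_{\mathbb{X}}+1$, we have $\dim_K(\mathrm{Ker}(\epsilon)_i)=\dim_K(\Omega^1_{S/K})$.
   Context: Let $K$ be a perfect field, $n\ge 1$, $P=K[X_0,\dots,X_n]$ with the standard grading, and $\mathbb{X}\subseteq\mathbb{P}^n$ a $0$-dimensional subscheme over $K$ with saturated homogeneous vanishing ideal $I_{\mathbb{X}}$. Put $R=P/I_{\mathbb{X}}$, let $x_i$ be the image of $X_i$ in $R$, and let $\mathfrak{m}=\langle x_0,\dots,x_n\rangle\subseteq R$. Assume no point of the support of $\mathbb{X}$ lies on the hyperplane $X_0=0$; then $x_0$ is a non-zerodivisor of $R$. Let $S=R/\langle x_0-1\rangle$ be the affine coordinate ring of $\mathbb{X}$. Let $\mathrm{HF}_{\mathbb{X}}(i)=\dim_K R_i$, $\deg(\mathbb{X})=\dim_K S$ its value for $i\gg0$, and $r_{\mathbb{X}}$ the least integer with $\mathrm{HF}_{\mathbb{X}}(i)=\deg(\mathbb{X})$ for all $i\ge r_{\mathbb{X}}$. $\Omega^1_{R/K}$ is the module of Kähler differentials,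 graded with $\deg(dx_i)=1$. The Euler form is the surjective $R$-linear map $\epsilon:\Omega^1_{R/K}\to\mathfrak{m}$ with $\epsilon(dx_i)=x_i$ for $i=0,\dots,n$ (it is induced by the Euler derivation $\delta(f)=i\cdot f$ for $f\in R_i$, i.e. $\delta=\epsilon\circ d$). The torsion submodule is $T\Omega^1_{R/K}=\{w\in\Omega^1_{R/K}\mid rw=0\text{ for some homogeneous non-zerodivisor }r\in R\}$. *)

theory Defs
  imports
    "HOL-Algebra.Algebraic_Closure_Type"
    "HOL-Algebra.QuotRing"
    "HOL-Library.Poly_Mapping"
    "Jordan_Normal_Form.Missing_VectorSpace"
begin

text \<open>Characteristic \<open>0\<close>, or characteristic \<open>p > 0\<close> and \<open>K = K\<^sup>p\<close>.\<close>

definition perfect_field :: "'k::field itself \<Rightarrow> bool"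
  where "perfect_field _ \<longleftrightarrow> CHAR('k) = 0 \<or> surj (\<lambda>x::'k. x ^ CHAR('k))"


section \<open>Modules over a commutative ring\<close>

text \<open>Only the additive group and \<open>smult\<close> of a module record are used; its ring multiplication and
  unit are irrelevant.\<close>

definition ring_module :: "'a ring \<Rightarrow> ('a, 'a) module"
  where "ring_module A =
    \<lparr>carrier = carrier A, monoid.mult = monoid.mult A, one = \<one>\<^bsub>A\<^esub>, zero = \<zero>\<^bsub>A\<^esub>, add = ring.add A,
     module.smult = monoid.mult A\<rparr>"

definition restrict_scalars :: "('k \<Rightarrow> 'a) \<Rightarrow> ('a, 'b) module \<Rightarrow> ('k, 'b) module"
  where "restrict_scalars \<phi> M =
    \<lparr>carrier = carrier M, monoid.mult = monoid.mult M, one = \<one>\<^bsub>M\<^esub>, zero = \<zero>\<^bsub>M\<^esub>, add = ring.add M,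
     module.smult = (\<lambda>c. module.smult M (\<phi> c))\<rparr>"

definition free_module :: "'a ring \<Rightarrow> 'x set \<Rightarrow> ('a, 'x \<Rightarrow> 'a) module"
  where "free_module A B =
    \<lparr>carrier = {f. f \<in> B \<rightarrow> carrier A \<and> (\<forall>x. x \<notin> B \<longrightarrow> f x = \<zero>\<^bsub>A\<^esub>) \<and> finite {x. f x \<noteq> \<zero>\<^bsub>A\<^esub>}},
     monoid.mult = (\<lambda>f g x. \<zero>\<^bsub>A\<^esub>), one = (\<lambda>x. \<zero>\<^bsub>A\<^esub>),
     zero = (\<lambda>x. \<zero>\<^bsub>A\<^esub>), add = (\<lambda>f g x. f x \<oplus>\<^bsub>A\<^esub> g x),
     module.smult = (\<lambda>a f x. a \<otimes>\<^bsub>A\<^esub> f x)\<rparr>"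

definition free_gen :: "'a ring \<Rightarrow> 'x \<Rightarrow> ('x \<Rightarrow> 'a)"
  where "free_gen A b = (\<lambda>x. if x = b then \<one>\<^bsub>A\<^esub> else \<zero>\<^bsub>A\<^esub>)"

text \<open>Carrier, zero and addition as in \<^const>\<open>FactRing\<close>.\<close>

definition quot_module :: "('a, 'b) module \<Rightarrow> 'b set \<Rightarrow> ('a, 'b set) module"
  where "quot_module M N =
    \<lparr>carrier = a_rcosets\<^bsub>M\<^esub> N, monoid.mult = (\<lambda>U V. N), one = N, zero = N, add = set_add M,
     module.smult = (\<lambda>a U. \<Union>u\<in>U. N +>\<^bsub>M\<^esub> (a \<odot>\<^bsub>M\<^esub> u))\<rparr>"


section \<open>Kaehler differentials\<close>

text \<open>
  For a \<open>K\<close>-algebra \<open>A\<close> with structure map \<open>\<phi> : K \<rightarrow> A\<close>, the module of Kaehler differentials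
  is the free \<open>A\<close>-module on symbols \<open>da\<close> (\<open>a \<in> A\<close>) modulo \<open>d(a + b) = da + db\<close>,
  \<open>d(ab) = a db + b da\<close> and \<open>d(\<phi> c) = 0\<close>.
\<close>

definition kaehler_rels :: "('k \<Rightarrow> 'a) \<Rightarrow> 'a ring \<Rightarrow> ('a \<Rightarrow> 'a) set"
  where "kaehler_rels \<phi> A = (let F = free_module A (carrier A); \<delta> = free_gen A in
      {\<delta> (a \<oplus>\<^bsub>A\<^esub> b) \<ominus>\<^bsub>F\<^esub> (\<delta> a \<oplus>\<^bsub>F\<^esub> \<delta> b) | a b. a \<in> carrier A \<and> b \<in> carrier A}
    \<union> {\<delta> (a \<otimes>\<^bsub>A\<^esub> b) \<ominus>\<^bsub>F\<^esub> (a \<odot>\<^bsub>F\<^esub> \<delta> b \<oplus>\<^bsub>F\<^esub> b \<odot>\<^bsub>F\<^esub> \<delta> a) | a b. a \<in> carrier A \<and> b \<in> carrier A}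
    \<union> Set.range (\<lambda>c. \<delta> (\<phi> c)))"

definition kaehler_sub :: "('k \<Rightarrow> 'a) \<Rightarrow> 'a ring \<Rightarrow> ('a \<Rightarrow> 'a) set"
  where "kaehler_sub \<phi> A =
    LinearCombinations.module.span A (free_module A (carrier A)) (kaehler_rels \<phi> A)"

definition kaehler :: "('k \<Rightarrow> 'a) \<Rightarrow> 'a ring \<Rightarrow> ('a, ('a \<Rightarrow> 'a) set) module"
  where "kaehler \<phi> A = quot_module (free_module A (carrier A)) (kaehler_sub \<phi> A)"

definition kaehler_d :: "('k \<Rightarrow> 'a) \<Rightarrow> 'a ring \<Rightarrow> 'a \<Rightarrow> ('a \<Rightarrow> 'a) set"
  where "kaehler_d \<phi> A a = kaehler_sub \<phi> A +>\<^bsub>free_module A (carrier A)\<^esub> free_gen A a"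


section \<open>Homogeneous ideals and closed subschemes of projective space\<close>

text \<open>
  Polynomials in variables indexed by \<open>nat\<close>; the polynomial ring \<open>K[X\<^sub>0,\<dots>,X\<^sub>n]\<close> consists of those
  involving only variables with index at most \<open>n\<close>.
\<close>

type_synonym 'k mpol = "(nat \<Rightarrow>\<^sub>0 nat) \<Rightarrow>\<^sub>0 'k"

definition poly_ring :: "nat \<Rightarrow> 'k::field mpol ring"
  where "poly_ring n = ring_of_type_algebra\<lparr>carrier := {p. \<forall>m\<in>Poly_Mapping.keys p. Poly_Mapping.keys m \<subseteq> {..n}}\<rparr>"

definition const :: "'k::field \<Rightarrow> 'k mpol"
  where "const c = Poly_Mapping.single 0 c"

definition var :: "nat \<Rightarrow> 'k::field mpol"
  where "var j = Poly_Mapping.single (Poly_Mapping.single j 1) 1"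

definition mon_deg :: "(nat \<Rightarrow>\<^sub>0 nat) \<Rightarrow> nat"
  where "mon_deg m = (\<Sum>j\<in>Poly_Mapping.keys m. Poly_Mapping.lookup m j)"

lift_definition hom_comp :: "nat \<Rightarrow> 'k::field mpol \<Rightarrow> 'k mpol"
  is "\<lambda>d p m. p m when mon_deg m = d"
  by (rule finite_subset) auto

definition homog_polys :: "nat \<Rightarrow> nat \<Rightarrow> 'k::field mpol set"
  where "homog_polys n d = {p \<in> carrier (poly_ring n). \<forall>m\<in>Poly_Mapping.keys p. mon_deg m = d}"

definition homogeneous_ideal :: "nat \<Rightarrow> 'k::field mpol set \<Rightarrow> bool"
  where "homogeneous_ideal n I \<longleftrightarrow> ideal I (poly_ring n) \<and> (\<forall>f\<in>I. \<forall>d. hom_comp d f \<in> I)"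

text \<open>
  The saturation \<open>I : \<mm>\<^sup>\<infinity>\<close> consists of the \<open>f\<close> such that every \<open>X\<^sub>j\<close> has a power carrying \<open>f\<close> into \<open>I\<close>.
\<close>

definition saturated :: "nat \<Rightarrow> 'k::field mpol set \<Rightarrow> bool"
  where "saturated n I \<longleftrightarrow>
    (\<forall>f\<in>carrier (poly_ring n). (\<forall>j\<le>n. \<exists>N. var j ^ N * f \<in> I) \<longrightarrow> f \<in> I)"

definition irrelevant_ideal :: "nat \<Rightarrow> 'k::field mpol set"
  where "irrelevant_ideal n = Idl\<^bsub>poly_ring n\<^esub> (var ` {..n})"

text \<open>
  The underlying set of the closed subscheme \<open>Proj (P / I)\<close>: its points are the relevant homogeneous
  prime ideals containing \<open>I\<close>. A point \<open>\<pp>\<close> lies on the hyperplane \<open>X\<^sub>0 = 0\<close> iff \<open>X\<^sub>0 \<in> \<pp>\<close>.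
\<close>

definition proj_support :: "nat \<Rightarrow> 'k::field mpol set \<Rightarrow> 'k mpol set set"
  where "proj_support n I =
    {p. primeideal p (poly_ring n) \<and> homogeneous_ideal n p \<and> \<not> irrelevant_ideal n \<subseteq> p \<and> I \<subseteq> p}"

text \<open>Dimension \<open>0\<close>: there is a point, and there are no proper specialisations between points.\<close>

definition zero_dimensional :: "nat \<Rightarrow> 'k::field mpol set \<Rightarrow> bool"
  where "zero_dimensional n I \<longleftrightarrow> proj_support n I \<noteq> {} \<and>
    (\<forall>p\<in>proj_support n I. \<forall>q\<in>proj_support n I. p \<subseteq> q \<longrightarrow> p = q)"


section \<open>The homogeneous and the affine coordinate ring\<close>

definition coord_ring :: "nat \<Rightarrow> 'k::field mpol set \<Rightarrow> 'k mpol set ring"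
  where "coord_ring n I = poly_ring n Quot I"

definition coord_class :: "nat \<Rightarrow> 'k::field mpol set \<Rightarrow> 'k mpol \<Rightarrow> 'k mpol set"
  where "coord_class n I f = I +>\<^bsub>poly_ring n\<^esub> f"

abbreviation coord_const :: "nat \<Rightarrow> 'k::field mpol set \<Rightarrow> 'k \<Rightarrow> 'k mpol set"
  where "coord_const n I c \<equiv> coord_class n I (const c)"

abbreviation coord_var :: "nat \<Rightarrow> 'k::field mpol set \<Rightarrow> nat \<Rightarrow> 'k mpol set"
  where "coord_var n I j \<equiv> coord_class n I (var j)"

definition coord_piece :: "nat \<Rightarrow> 'k::field mpol set \<Rightarrow> nat \<Rightarrow> 'k mpol set set"
  where "coord_piece n I d = coord_class n I ` homog_polys n d"

definition coord_max :: "nat \<Rightarrow> 'k::field mpol set \<Rightarrow> 'k mpol set set"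
  where "coord_max n I = Idl\<^bsub>coord_ring n I\<^esub> (coord_var n I ` {..n})"

definition affine_ideal :: "nat \<Rightarrow> 'k::field mpol set \<Rightarrow> 'k mpol set set"
  where "affine_ideal n I =
    Idl\<^bsub>coord_ring n I\<^esub> {coord_var n I 0 \<ominus>\<^bsub>coord_ring n I\<^esub> \<one>\<^bsub>coord_ring n I\<^esub>}"

definition affine_ring :: "nat \<Rightarrow> 'k::field mpol set \<Rightarrow> 'k mpol set set ring"
  where "affine_ring n I = coord_ring n I Quot affine_ideal n I"

definition affine_const :: "nat \<Rightarrow> 'k::field mpol set \<Rightarrow> 'k \<Rightarrow> 'k mpol set set"
  where "affine_const n I c = affine_ideal n I +>\<^bsub>coord_ring n I\<^esub> coord_const n I c"

definition subspace_dim :: "('k::field \<Rightarrow> 'a) \<Rightarrow> ('a, 'b) module \<Rightarrow> 'b set \<Rightarrow> nat"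
  where "subspace_dim \<phi> M W =
    vectorspace.dim (ring_of_type_algebra :: 'k ring) ((restrict_scalars \<phi> M)\<lparr>carrier := W\<rparr>)"

definition hilbert_fun :: "nat \<Rightarrow> 'k::field mpol set \<Rightarrow> nat \<Rightarrow> nat"
  where "hilbert_fun n I d =
    subspace_dim (coord_const n I) (ring_module (coord_ring n I)) (coord_piece n I d)"

definition scheme_deg :: "nat \<Rightarrow> 'k::field mpol set \<Rightarrow> nat"
  where "scheme_deg n I =
    subspace_dim (affine_const n I) (ring_module (affine_ring n I)) (carrier (affine_ring n I))"

text \<open>
  The Hilbert function vanishes in negative degrees, whereas the degree of a nonempty scheme is
  positive, so the least integer with the required property is a natural number.
\<close>

definition regularity_index :: "nat \<Rightarrow> 'k::field mpol set \<Rightarrow> nat"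
  where "regularity_index n I = (LEAST r. \<forall>i\<ge>r. hilbert_fun n I i = scheme_deg n I)"


section \<open>Differentials of the coordinate rings and the Euler form\<close>

definition Omega_coord :: "nat \<Rightarrow> 'k::field mpol set \<Rightarrow>
    ('k mpol set, ('k mpol set \<Rightarrow> 'k mpol set) set) module"
  where "Omega_coord n I = kaehler (coord_const n I) (coord_ring n I)"

definition d_coord :: "nat \<Rightarrow> 'k::field mpol set \<Rightarrow> 'k mpol set \<Rightarrow> ('k mpol set \<Rightarrow> 'k mpol set) set"
  where "d_coord n I = kaehler_d (coord_const n I) (coord_ring n I)"

definition Omega_affine :: "nat \<Rightarrow> 'k::field mpol set \<Rightarrow>
    ('k mpol set set, ('k mpol set set \<Rightarrow> 'k mpol set set) set) module"
  where "Omega_affine n I = kaehler (affine_const n I) (affine_ring n I)"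

text \<open>
  The generators \<open>dx\<^sub>j\<close> have degree \<open>1\<close>, so the homogeneous elements of degree \<open>i\<close> are the
  combinations of the \<open>dx\<^sub>j\<close> with coefficients in \<open>R\<^bsub>i-1\<^esub>\<close>.
\<close>

fun Omega_piece :: "nat \<Rightarrow> 'k::field mpol set \<Rightarrow> nat \<Rightarrow> ('k mpol set \<Rightarrow> 'k mpol set) set set"
  where
    "Omega_piece n I 0 = {\<zero>\<^bsub>Omega_coord n I\<^esub>}"
  | "Omega_piece n I (Suc i) =
      {\<Oplus>\<^bsub>Omega_coord n I\<^esub> j\<in>{..n}. r j \<odot>\<^bsub>Omega_coord n I\<^esub> d_coord n I (coord_var n I j) | r.
        r \<in> {..n} \<rightarrow> coord_piece n I i}"

text \<open>The unique \<open>R\<close>-linear map from the differentials to \<open>\<mm>\<close> with \<open>dx\<^sub>j \<mapsto> x\<^sub>j\<close>.\<close>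

definition euler_form :: "nat \<Rightarrow> 'k::field mpol set \<Rightarrow>
    ('k mpol set \<Rightarrow> 'k mpol set) set \<Rightarrow> 'k mpol set"
  where "euler_form n I = (THE \<epsilon>.
    \<epsilon> \<in> extensional (carrier (Omega_coord n I)) \<and>
    \<epsilon> \<in> module_hom (coord_ring n I) (Omega_coord n I)
         ((ring_module (coord_ring n I))\<lparr>carrier := coord_max n I\<rparr>) \<and>
    (\<forall>j\<le>n. \<epsilon> (d_coord n I (coord_var n I j)) = coord_var n I j))"

definition euler_ker :: "nat \<Rightarrow> 'k::field mpol set \<Rightarrow> ('k mpol set \<Rightarrow> 'k mpol set) set set"
  where "euler_ker n I =
    {w \<in> carrier (Omega_coord n I). euler_form n I w = \<zero>\<^bsub>coord_ring n I\<^esub>}"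

definition non_zero_divisor :: "'a ring \<Rightarrow> 'a \<Rightarrow> bool"
  where "non_zero_divisor A r \<longleftrightarrow>
    r \<in> carrier A \<and> (\<forall>s\<in>carrier A. r \<otimes>\<^bsub>A\<^esub> s = \<zero>\<^bsub>A\<^esub> \<longrightarrow> s = \<zero>\<^bsub>A\<^esub>)"

definition Omega_torsion :: "nat \<Rightarrow> 'k::field mpol set \<Rightarrow> ('k mpol set \<Rightarrow> 'k mpol set) set set"
  where "Omega_torsion n I = {w \<in> carrier (Omega_coord n I).
    \<exists>d. \<exists>r\<in>coord_piece n I d. non_zero_divisor (coord_ring n I) r \<and>
      r \<odot>\<^bsub>Omega_coord n I\<^esub> w = \<zero>\<^bsub>Omega_coord n I\<^esub>}"

definition annihilator :: "'a ring \<Rightarrow> ('a, 'b) module \<Rightarrow> 'b \<Rightarrow> 'a set"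
  where "annihilator A M w = {r \<in> carrier A. r \<odot>\<^bsub>M\<^esub> w = \<zero>\<^bsub>M\<^esub>}"

definition cyclic_submodule :: "'a ring \<Rightarrow> ('a, 'b) module \<Rightarrow> 'b \<Rightarrow> 'b set"
  where "cyclic_submodule A M w = {r \<odot>\<^bsub>M\<^esub> w | r. r \<in> carrier A}"

end

theory Submission
  imports Defs
begin

text \<open>
  For \<open>R = P/I\<close> the \<open>R\<close>-module of differentials is \<open>P\<^sup>n\<^sup>+\<^sup>1\<close> modulo
  \<open>I P\<^sup>n\<^sup>+\<^sup>1 + {grad f | f \<in> I}\<close>, and likewise for \<open>S\<close> with the dehomogenised ideal.
  Applying the Euler form to a relation \<open>r w = 0\<close> gives (a) and (b), because \<open>x\<^sub>0\<close> is a
  non-zerodivisor.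

  For (c), \<open>\<Sum>g\<^sub>j dx\<^sub>j \<mapsto> \<Sum>g\<^sub>j dy\<^sub>j\<close> maps the degree \<open>i\<close> part of the kernel of the Euler form
  to the differentials of \<open>S\<close>. Surjectivity uses that multiplication by \<open>x\<^sub>0\<close> is onto from degree
  \<open>r\<close> on: it makes the coefficients homogeneous and lets the coefficient of \<open>dx\<^sub>0\<close> correct the Euler
  form. If the image of \<open>w\<close> vanishes, homogenising the relation shows \<open>x\<^sub>0\<^sup>k w = 0\<close> for some \<open>k\<close>.
  Since \<open>I\<close> is generated in degrees at most \<open>r + 1\<close>, the relations of degree above \<open>2 r + 1\<close> are
  \<open>x\<^sub>0\<close> times relations, so \<open>x\<^sub>0\<close> is injective on the differentials in degrees at least
  \<open>2 r + 1\<close> and \<open>w = 0\<close>.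

  That \<open>x\<^sub>0\<close> is a non-zerodivisor and eventually surjective follows from \<open>X\<^sub>j\<^sup>N \<in> I + (X\<^sub>0)\<close>: a
  homogeneous ideal containing \<open>I + (X\<^sub>0)\<close> and maximal among those avoiding all powers of \<open>X\<^sub>j\<close> would be
  a point of the scheme on the hyperplane \<open>X\<^sub>0 = 0\<close>.
\<close>

text \<open>The bound \<open>2 r + 1\<close> is the sum of two thresholds. A relation of degree
  \<open>N\<close> is a gradient of an element of \<open>I\<close> of degree \<open>N + 1\<close>,
  modulo \<open>I\<close>. Such an element is a sum of products \<open>a g\<close> with
  \<open>g\<close> in \<open>I\<close> of degree \<open>r + 1\<close>, and \<open>X0\<close> can be
  split off from \<open>a\<close> modulo \<open>I\<close> once \<open>a\<close> has degree at least
  \<open>r + 1\<close>; both are available when \<open>N + 1\<close> exceeds \<open>2 r + 1\<close>.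
  The derivatives of \<open>a\<close> do not interfere, because they come with the factor
  \<open>g\<close>. The obstacle is the definition of the differentials by one symbol for each ring
  element. It gives generators for free, but to decide when a combination of the \<open>dx_j\<close>
  is zero needs the presentation by gradients. This is proved once for all quotients of
  \<open>P\<close>. As \<open>R\<close> and \<open>S\<close> are both such quotients, a differential
  of either ring is a vector of polynomials, and the comparison of the two modules becomes a
  comparison of congruences modulo \<open>I\<close> and modulo the ideal of \<open>S\<close> in
  \<open>P\<close>.\<close>

lemma poly_ring_simps [simp]:
  "p \<oplus>\<^bsub>poly_ring n\<^esub> q = p + q" "p \<otimes>\<^bsub>poly_ring n\<^esub> q = p * q"
  "\<zero>\<^bsub>poly_ring n\<^esub> = 0" "\<one>\<^bsub>poly_ring n\<^esub> = 1"
  by (simp_all add: poly_ring_def ring_of_type_algebra_def)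

lemma carrier_poly_ring:
  "p \<in> carrier (poly_ring n) \<longleftrightarrow> (\<forall>m\<in>Poly_Mapping.keys p. Poly_Mapping.keys m \<subseteq> {..n})"
  by (simp add: poly_ring_def)

lemma keys_add_nat:
  "Poly_Mapping.keys (a + b :: nat \<Rightarrow>\<^sub>0 nat) = Poly_Mapping.keys a \<union> Poly_Mapping.keys b"
  by (auto simp: in_keys_iff lookup_add)

lemma poly_ring_closed [simp, intro]:
  "0 \<in> carrier (poly_ring n)" "1 \<in> carrier (poly_ring n)" "const c \<in> carrier (poly_ring n)"
  "j \<le> n \<Longrightarrow> var j \<in> carrier (poly_ring n)"
  "p \<in> carrier (poly_ring n) \<Longrightarrow> q \<in> carrier (poly_ring n) \<Longrightarrow> p + q \<in> carrier (poly_ring n)"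
  "p \<in> carrier (poly_ring n) \<Longrightarrow> q \<in> carrier (poly_ring n) \<Longrightarrow> p * q \<in> carrier (poly_ring n)"
  "p \<in> carrier (poly_ring n) \<Longrightarrow> - p \<in> carrier (poly_ring n)"
  "p \<in> carrier (poly_ring n) \<Longrightarrow> q \<in> carrier (poly_ring n) \<Longrightarrow> p - q \<in> carrier (poly_ring n)"
proof -
  show "0 \<in> carrier (poly_ring n)" "1 \<in> carrier (poly_ring n)" "const c \<in> carrier (poly_ring n)"
    "j \<le> n \<Longrightarrow> var j \<in> carrier (poly_ring n)"
    by (auto simp: carrier_poly_ring const_def var_def split: if_splits)
  show *: "p + q \<in> carrier (poly_ring n)"
    if "p \<in> carrier (poly_ring n)" "q \<in> carrier (poly_ring n)" for p q :: "'k::field mpol"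
    using that Poly_Mapping.keys_add[of p q] by (auto simp: carrier_poly_ring)
  show "p * q \<in> carrier (poly_ring n)"
    if "p \<in> carrier (poly_ring n)" "q \<in> carrier (poly_ring n)"
    using that keys_mult[of p q] by (fastforce simp: carrier_poly_ring keys_add_nat)
  show m: "- p \<in> carrier (poly_ring n)" if "p \<in> carrier (poly_ring n)" for p :: "'k::field mpol"
    using that by (auto simp: carrier_poly_ring in_keys_iff)
  show "p - q \<in> carrier (poly_ring n)"
    if "p \<in> carrier (poly_ring n)" "q \<in> carrier (poly_ring n)"
    using *[OF that(1) m[OF that(2)]] by simp
qed

lemma poly_ring_sum_closed [intro]:
  "(\<And>i. i \<in> A \<Longrightarrow> f i \<in> carrier (poly_ring n)) \<Longrightarrow> sum f A \<in> carrier (poly_ring n)"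
  by (induction A rule: infinite_finite_induct) auto

lemma poly_ring_power_closed [simp, intro]:
  "p \<in> carrier (poly_ring n) \<Longrightarrow> p ^ k \<in> carrier (poly_ring n)"
  by (induction k) auto

lemma cring_poly_ring: "cring (poly_ring n)"
proof (rule cringI)
  show "abelian_group (poly_ring n)"
    by (rule abelian_groupI) (auto simp: algebra_simps intro!: bexI[where x = "- _"])
  show "comm_monoid (poly_ring n)"
    by (rule comm_monoidI) (auto simp: algebra_simps)
qed (auto simp: algebra_simps)

interpretation P: cring "poly_ring n" for n
  by (rule cring_poly_ring)

lemma poly_ring_a_inv [simp]:
  "p \<in> carrier (poly_ring n) \<Longrightarrow> \<ominus>\<^bsub>poly_ring n\<^esub> p = - p"
  by (rule P.minus_equality) auto

section \<open>Monomials\<close>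

lemma sum_monomials:
  fixes p :: "'a \<Rightarrow>\<^sub>0 'b::comm_monoid_add"
  shows "p = (\<Sum>m\<in>Poly_Mapping.keys p. Poly_Mapping.single m (Poly_Mapping.lookup p m))"
proof (rule poly_mapping_eqI)
  fix k
  show "Poly_Mapping.lookup p k =
    Poly_Mapping.lookup (\<Sum>m\<in>Poly_Mapping.keys p. Poly_Mapping.single m (Poly_Mapping.lookup p m)) k"
    by (simp add: lookup_sum lookup_single when_def in_keys_iff)
qed

text \<open>The coefficient in \<open>single\<close> is arbitrary but the monomial occurs in
  \<open>p\<close>, so conditions on the support of \<open>p\<close>, such as a bound on the
  variables or a fixed degree, are available there.\<close>

lemma monomials_induct [case_names zero single add]:
  fixes p :: "'a \<Rightarrow>\<^sub>0 'b::comm_monoid_add"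
  assumes "Q 0"
    and "\<And>m c. m \<in> Poly_Mapping.keys p \<Longrightarrow> Q (Poly_Mapping.single m c)"
    and "\<And>p q. Q p \<Longrightarrow> Q q \<Longrightarrow> Q (p + q)"
  shows "Q p"
proof -
  have "Q (\<Sum>m\<in>A. Poly_Mapping.single m (Poly_Mapping.lookup p m))"
    if "finite A" "A \<subseteq> Poly_Mapping.keys p" for A
    using that by (induction A rule: finite_induct) (auto intro: assms)
  then show ?thesis
    by (subst sum_monomials) simp
qed

lemma mon_deg_superset:
  assumes "finite A" "Poly_Mapping.keys m \<subseteq> A"
  shows "mon_deg m = (\<Sum>j\<in>A. Poly_Mapping.lookup m j)"
  unfolding mon_deg_def using assms by (intro sum.mono_neutral_left) (auto simp: in_keys_iff)

lemma mon_deg_add: "mon_deg (a + b) = mon_deg a + mon_deg b"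
  using mon_deg_superset[of "Poly_Mapping.keys a \<union> Poly_Mapping.keys b" a]
    mon_deg_superset[of "Poly_Mapping.keys a \<union> Poly_Mapping.keys b" b]
    mon_deg_superset[of "Poly_Mapping.keys a \<union> Poly_Mapping.keys b" "a + b"]
  by (simp add: keys_add_nat lookup_add sum.distrib)

lemma mon_deg_0 [simp]: "mon_deg 0 = 0"
  by (simp add: mon_deg_def)

lemma mon_deg_single [simp]: "mon_deg (Poly_Mapping.single j k) = k"
  by (cases "k = 0") (auto simp: mon_deg_def)

lemma mon_deg_eq_0: "mon_deg m = 0 \<longleftrightarrow> m = 0"
  by (auto simp: mon_deg_def in_keys_iff poly_mapping_eq_iff fun_eq_iff) 

text \<open>Subtraction of exponents is truncated, so removing a factor \<open>X_j\<close> can be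
  undone only if \<open>X_j\<close> occurs in \<open>m\<close>.\<close>

lemma minus_single_add:
  fixes m :: "nat \<Rightarrow>\<^sub>0 nat"
  assumes "Poly_Mapping.lookup m j \<noteq> 0"
  shows "Poly_Mapping.single j 1 + (m - Poly_Mapping.single j 1) = m"
  using assms by (intro poly_mapping_eqI) (auto simp: lookup_add lookup_minus lookup_single when_def)

lemma keys_minus_subset: "Poly_Mapping.keys (a - b :: nat \<Rightarrow>\<^sub>0 nat) \<subseteq> Poly_Mapping.keys a"
  by (auto simp: in_keys_iff lookup_minus)

lemma mon_deg_minus_single:
  "Poly_Mapping.lookup m j \<noteq> 0 \<Longrightarrow> mon_deg m = Suc (mon_deg (m - Poly_Mapping.single j 1))"
  using mon_deg_add[of "Poly_Mapping.single j 1" "m - Poly_Mapping.single j 1"] minus_single_add[of m j]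
  by simp

lemma single_sum: "Poly_Mapping.single m (sum f A) = (\<Sum>i\<in>A. Poly_Mapping.single m (f i))"
  by (induction A rule: infinite_finite_induct) (auto simp: single_add)

lemma single_homog:
  "Poly_Mapping.keys m \<subseteq> {..n} \<Longrightarrow> mon_deg m = d \<Longrightarrow> Poly_Mapping.single m c \<in> homog_polys n d"
  by (auto simp: homog_polys_def carrier_poly_ring)

lemma var_times_single:
  assumes "Poly_Mapping.lookup m j \<noteq> 0"
  shows "var j * Poly_Mapping.single (m - Poly_Mapping.single j 1) c = Poly_Mapping.single m c"
  using minus_single_add[OF assms] by (simp add: var_def mult_single)

text \<open>Constants and variables generate the ring; a monomial is reached by splitting off one
  variable at a time. The rule suits statements about derivations, which are determined by their
  values on generators.\<close>

lemma poly_ring_induct [consumes 1, case_names const var add mult]: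
  assumes "p \<in> carrier (poly_ring n)"
    and const: "\<And>c. Q (const c)"
    and var: "\<And>j. j \<le> n \<Longrightarrow> Q (var j)"
    and add: "\<And>p q. p \<in> carrier (poly_ring n) \<Longrightarrow> q \<in> carrier (poly_ring n) \<Longrightarrow> Q p \<Longrightarrow> Q q \<Longrightarrow> Q (p + q)"
    and mult: "\<And>p q. p \<in> carrier (poly_ring n) \<Longrightarrow> q \<in> carrier (poly_ring n) \<Longrightarrow> Q p \<Longrightarrow> Q q \<Longrightarrow> Q (p * q)"
  shows "Q (p :: 'k::field mpol)"
proof -
  define Q' where "Q' p \<longleftrightarrow> p \<in> carrier (poly_ring n) \<and> Q p" for p
  have mono: "Q' (Poly_Mapping.single m c)" if "Poly_Mapping.keys m \<subseteq> {..n}" for m and c :: 'k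
    using that
  proof (induction "mon_deg m" arbitrary: m)
    case 0
    then have "m = 0"
      by (simp add: mon_deg_eq_0)
    then show ?case
      using const[of c] poly_ring_closed(3)[of c n] by (simp add: Q'_def const_def)
  next
    case (Suc d)
    then obtain j where j: "Poly_Mapping.lookup m j \<noteq> 0"
      by (metis mon_deg_eq_0 nat.distinct(1) poly_mapping_eqI lookup_zero)
    let ?m = "m - Poly_Mapping.single j 1"
    have sub: "Poly_Mapping.keys ?m \<subseteq> {..n}"
      using Suc.prems keys_minus_subset by (rule order_trans[rotated])
    have "mon_deg m = Suc (mon_deg ?m)"
      by (rule mon_deg_minus_single[OF j])
    then have "Q' (Poly_Mapping.single ?m c)"
      using Suc sub by simp
    moreover have "j \<le> n"
      using j Suc.prems by (metis atMost_iff in_keys_iff subsetD)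
    ultimately have "Q' (var j * Poly_Mapping.single ?m c)"
      using var[of j] by (auto simp: Q'_def intro: mult)
    then show ?case
      by (simp only: var_times_single[OF j])
  qed
  have "Q' p"
  proof (induction p rule: monomials_induct)
    case zero
    then show ?case
      using const[of 0] by (simp add: Q'_def const_def)
  next
    case (single m c)
    then show ?case
      using assms(1) by (intro mono) (auto simp: carrier_poly_ring)
  next
    case (add p q)
    then show ?case
      by (auto simp: Q'_def intro: assms(4))
  qed
  then show ?thesis
    by (simp add: Q'_def)
qed

section \<open>Partial derivatives\<close>

text \<open>Truncated subtraction gives a wrong exponent where \<open>X_j\<close> does not occur,
  but there the coefficient is \<open>0\<close>, which saves a case distinction.\<close>

definition pdiff :: "nat \<Rightarrow> 'k::field mpol \<Rightarrow> 'k mpol"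
  where "pdiff j p = (\<Sum>m\<in>Poly_Mapping.keys p.
    Poly_Mapping.single (m - Poly_Mapping.single j 1) (of_nat (Poly_Mapping.lookup m j) * Poly_Mapping.lookup p m))"

lemma pdiff_superset:
  assumes "finite A" "Poly_Mapping.keys p \<subseteq> A"
  shows "pdiff j p = (\<Sum>m\<in>A.
    Poly_Mapping.single (m - Poly_Mapping.single j 1) (of_nat (Poly_Mapping.lookup m j) * Poly_Mapping.lookup p m))"
  unfolding pdiff_def using assms by (intro sum.mono_neutral_left) (auto simp: in_keys_iff)

lemma pdiff_0 [simp]: "pdiff j 0 = 0"
  by (simp add: pdiff_def)

lemma pdiff_single: "pdiff j (Poly_Mapping.single m c) =
    Poly_Mapping.single (m - Poly_Mapping.single j 1) (of_nat (Poly_Mapping.lookup m j) * c)"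
  by (subst pdiff_superset[where A = "{m}"]) auto

lemma pdiff_add: "pdiff j (p + q) = pdiff j p + pdiff j q"
proof -
  let ?A = "Poly_Mapping.keys p \<union> Poly_Mapping.keys q"
  have "Poly_Mapping.keys (p + q) \<subseteq> ?A"
    by (rule Poly_Mapping.keys_add)
  then show ?thesis
    using pdiff_superset[of ?A p j] pdiff_superset[of ?A q j] pdiff_superset[of ?A "p + q" j]
    by (simp add: lookup_add algebra_simps single_add sum.distrib)
qed

lemma pdiff_uminus: "pdiff j (- p) = - pdiff j p"
  using pdiff_add[of j p "- p"] by (simp add: eq_neg_iff_add_eq_0 add.commute)

lemma pdiff_minus: "pdiff j (p - q) = pdiff j p - pdiff j q"
  using pdiff_add[of j p "- q"] by (simp add: pdiff_uminus)

lemma pdiff_sum: "pdiff j (sum f A) = (\<Sum>i\<in>A. pdiff j (f i))"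
  by (induction A rule: infinite_finite_induct) (auto simp: pdiff_add)

lemma pdiff_mult: "pdiff j (p * q) = p * pdiff j q + q * pdiff j p"
proof (induction p rule: monomials_induct)
  case (single a c)
  show ?case
  proof (induction q rule: monomials_induct)
    case (single b d)
    let ?e = "Poly_Mapping.single j (1::nat)"
    \<comment> \<open>The exponents agree only if \<open>X_j\<close> occurs in the factor being
      differentiated; otherwise that summand has coefficient \<open>0\<close>.\<close>
    have 1: "a + (b - ?e) = a + b - ?e" if "Poly_Mapping.lookup b j \<noteq> 0"
      using that by (intro poly_mapping_eqI) (auto simp: lookup_add lookup_minus lookup_single when_def)
    have 2: "b + (a - ?e) = a + b - ?e" if "Poly_Mapping.lookup a j \<noteq> 0"
      using that by (intro poly_mapping_eqI) (auto simp: lookup_add lookup_minus lookup_single when_def)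
    show ?case
      using 1 2
      by (cases "Poly_Mapping.lookup a j = 0"; cases "Poly_Mapping.lookup b j = 0")
        (simp_all add: mult_single pdiff_single lookup_add algebra_simps single_add)
  qed (simp_all add: pdiff_add algebra_simps)
qed (simp_all add: pdiff_add algebra_simps)

lemma pdiff_const [simp]: "pdiff j (const c) = 0"
  by (simp add: const_def pdiff_single)

lemma pdiff_1 [simp]: "pdiff j 1 = 0"
  using pdiff_const[of j 1] by (simp add: const_def)

lemma pdiff_var: "pdiff j (var i) = (if i = j then 1 else 0)"
  by (simp add: var_def pdiff_single lookup_single when_def)

lemma pdiff_closed [simp, intro]:
  "p \<in> carrier (poly_ring n) \<Longrightarrow> pdiff j p \<in> carrier (poly_ring n)"
  by (induction p rule: poly_ring_induct) (auto simp: pdiff_add pdiff_mult pdiff_var)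

section \<open>Homogeneous components\<close>

lemma lookup_hom_comp:
  "Poly_Mapping.lookup (hom_comp d p) m = (Poly_Mapping.lookup p m when mon_deg m = d)"
  by (simp add: hom_comp.rep_eq)

lemma keys_hom_comp: "Poly_Mapping.keys (hom_comp d p) = {m \<in> Poly_Mapping.keys p. mon_deg m = d}"
  by (auto simp: in_keys_iff lookup_hom_comp when_def split: if_splits)

lemma hom_comp_add: "hom_comp d (p + q) = hom_comp d p + hom_comp d q"
  by (rule poly_mapping_eqI) (simp add: lookup_hom_comp lookup_add when_def)

lemma hom_comp_0 [simp]: "hom_comp d 0 = 0"
  by (rule poly_mapping_eqI) (simp add: lookup_hom_comp)

lemma hom_comp_minus: "hom_comp d (p - q) = hom_comp d p - hom_comp d q"
  by (rule poly_mapping_eqI) (simp add: lookup_hom_comp lookup_minus when_def)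

lemma hom_comp_sum: "hom_comp d (sum f A) = (\<Sum>i\<in>A. hom_comp d (f i))"
  by (induction A rule: infinite_finite_induct) (auto simp: hom_comp_add)

lemma hom_comp_homog:
  assumes "p \<in> homog_polys n e"
  shows "hom_comp d p = (if d = e then p else 0)"
proof (rule poly_mapping_eqI)
  fix m
  show "Poly_Mapping.lookup (hom_comp d p) m = Poly_Mapping.lookup (if d = e then p else 0) m"
    using assms by (cases "m \<in> Poly_Mapping.keys p")
      (auto simp: lookup_hom_comp homog_polys_def in_keys_iff when_def)
qed

lemma homog_closed: "p \<in> homog_polys n d \<Longrightarrow> p \<in> carrier (poly_ring n)"
  by (simp add: homog_polys_def)

lemma hom_comp_in_homog [intro]: "p \<in> carrier (poly_ring n) \<Longrightarrow> hom_comp d p \<in> homog_polys n d"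
  by (auto simp: homog_polys_def carrier_poly_ring keys_hom_comp)

lemma homog_zero [simp, intro]: "0 \<in> homog_polys n d"
  by (simp add: homog_polys_def)

lemma homog_add [intro]: "p \<in> homog_polys n d \<Longrightarrow> q \<in> homog_polys n d \<Longrightarrow> p + q \<in> homog_polys n d"
  using Poly_Mapping.keys_add[of p q] by (auto simp: homog_polys_def)

lemma homog_sum [intro]: "(\<And>i. i \<in> A \<Longrightarrow> f i \<in> homog_polys n d) \<Longrightarrow> sum f A \<in> homog_polys n d"
  by (induction A rule: infinite_finite_induct) auto

lemma homog_uminus [intro]: "p \<in> homog_polys n d \<Longrightarrow> - p \<in> homog_polys n d"
  by (auto simp: homog_polys_def in_keys_iff)

lemma homog_minus [intro]: "p \<in> homog_polys n d \<Longrightarrow> q \<in> homog_polys n d \<Longrightarrow> p - q \<in> homog_polys n d"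
  using homog_add[of p n d "- q"] by auto

lemma homog_mult [intro]:
  "p \<in> homog_polys n d \<Longrightarrow> q \<in> homog_polys n e \<Longrightarrow> p * q \<in> homog_polys n (d + e)"
  using keys_mult[of p q] by (fastforce simp: homog_polys_def mon_deg_add)

lemma homog_var [simp, intro]: "j \<le> n \<Longrightarrow> var j \<in> homog_polys n 1"
  by (auto simp: homog_polys_def var_def carrier_poly_ring)

lemma homog_const [simp, intro]: "const c \<in> homog_polys n 0"
  by (auto simp: homog_polys_def const_def carrier_poly_ring split: if_splits)

lemma homog_var_power [simp, intro]: "j \<le> n \<Longrightarrow> var j ^ k \<in> homog_polys n k"
proof (induction k)
  case 0
  then show ?case
    using homog_const[of 1 n] by (simp add: const_def)
next
  case (Suc k)
  then show ?case
    using homog_mult[OF homog_var, of j n "var j ^ k" k] by simp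
qed

lemma homog_const_mult [intro]: "p \<in> homog_polys n d \<Longrightarrow> const c * p \<in> homog_polys n d"
  using homog_mult[OF homog_const, of p n d c] by simp

lemma const_of_nat: "const (of_nat d) = of_nat d"
  by (simp add: const_def)

lemma homog_induct [consumes 1, case_names zero single add]:
  assumes "p \<in> homog_polys n d"
    and "Q 0"
    and "\<And>m c. Poly_Mapping.keys m \<subseteq> {..n} \<Longrightarrow> mon_deg m = d \<Longrightarrow> Q (Poly_Mapping.single m c)"
    and "\<And>p q. Q p \<Longrightarrow> Q q \<Longrightarrow> Q (p + q)"
  shows "Q p"
proof (rule monomials_induct)
  show "Q (Poly_Mapping.single m c)" if "m \<in> Poly_Mapping.keys p" for m c
    using that assms(1) by (intro assms(3)) (auto simp: homog_polys_def carrier_poly_ring)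
qed (fact assms)+

lemma sum_hom_comp:
  assumes "\<forall>m\<in>Poly_Mapping.keys p. mon_deg m \<le> N"
  shows "(\<Sum>d\<le>N. hom_comp d p) = p"
proof (rule poly_mapping_eqI)
  fix m
  show "Poly_Mapping.lookup (\<Sum>d\<le>N. hom_comp d p) m = Poly_Mapping.lookup p m"
    using assms by (cases "m \<in> Poly_Mapping.keys p")
      (auto simp: lookup_sum lookup_hom_comp in_keys_iff when_def)
qed

lemma deg_bound: "\<exists>N. \<forall>m\<in>Poly_Mapping.keys p. mon_deg m \<le> N"
  using finite_nat_set_iff_bounded_le[of "mon_deg ` Poly_Mapping.keys p"] by auto

lemma homog_pdiff [intro]:
  "p \<in> homog_polys n (Suc d) \<Longrightarrow> pdiff j p \<in> homog_polys n d"
proof (induction p rule: homog_induct)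
  case (single m c)
  show ?case
  proof (cases "Poly_Mapping.lookup m j = 0")
    case False
    have "Poly_Mapping.keys (m - Poly_Mapping.single j 1) \<subseteq> {..n}"
      using single(1) keys_minus_subset by (rule order_trans[rotated])
    moreover have "mon_deg (m - Poly_Mapping.single j 1) = d"
      using single(2) mon_deg_minus_single[OF False] by simp
    ultimately show ?thesis
      unfolding pdiff_single by (rule single_homog)
  qed (simp add: pdiff_single)
qed (auto simp: pdiff_add)

lemma pdiff_homog_0: "p \<in> homog_polys n 0 \<Longrightarrow> pdiff j p = 0"
  by (induction p rule: homog_induct) (auto simp: pdiff_add pdiff_single mon_deg_eq_0)

text \<open>Differentiating a monomial by \<open>X_j\<close> and multiplying by \<open>X_j\<close>
  again multiplies it by its exponent at \<open>j\<close>, and the exponents add up to the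
  degree.\<close>

lemma euler_identity:
  "p \<in> homog_polys n d \<Longrightarrow> (\<Sum>j\<le>n. var j * pdiff j p) = of_nat d * p"
proof (induction p rule: homog_induct)
  case (single m c)
  have "var j * pdiff j (Poly_Mapping.single m c) =
      Poly_Mapping.single m (of_nat (Poly_Mapping.lookup m j) * c)" for j
    using var_times_single[of m j] by (cases "Poly_Mapping.lookup m j = 0") (auto simp: pdiff_single)
  moreover have "(\<Sum>j\<le>n. Poly_Mapping.single m (of_nat (Poly_Mapping.lookup m j) * c))
      = Poly_Mapping.single m (of_nat (\<Sum>j\<le>n. Poly_Mapping.lookup m j) * c)"
    by (simp only: single_sum[symmetric] sum_distrib_right[symmetric] of_nat_sum)
  ultimately show ?case
    using single mon_deg_superset[of "{..n}" m] mult_single[of 0 "of_nat d" m c]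
    by (simp flip: of_nat_sum)
qed (simp_all add: pdiff_add algebra_simps sum.distrib)

text \<open>A monomial of positive degree is assigned as a whole to one variable occurring in it;
  which one does not matter.\<close>

lemma homog_decompose:
  assumes "p \<in> homog_polys n (Suc d)"
  shows "\<exists>q. (\<forall>j. q j \<in> homog_polys n d) \<and> p = (\<Sum>j\<le>n. var j * q j)"
  using assms
proof (induction p rule: homog_induct)
  case zero
  show ?case
    by (rule exI[of _ "\<lambda>_. 0"]) auto
next
  case (single m c)
  then obtain j where j: "Poly_Mapping.lookup m j \<noteq> 0"
    by (metis mon_deg_eq_0 nat.distinct(1) poly_mapping_eqI lookup_zero)
  let ?m = "m - Poly_Mapping.single j 1"
  have *: "Poly_Mapping.single ?m c \<in> homog_polys n d"
  proof (rule single_homog)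
    show "Poly_Mapping.keys ?m \<subseteq> {..n}"
      using single(1) keys_minus_subset by (rule order_trans[rotated])
    show "mon_deg ?m = d"
      using single(2) mon_deg_minus_single[OF j] by simp
  qed
  have "j \<le> n"
    using j single by (metis atMost_iff in_keys_iff subsetD)
  let ?q = "\<lambda>i. if i = j then Poly_Mapping.single ?m c else 0"
  have "(\<Sum>i\<le>n. var i * ?q i) = (\<Sum>i\<le>n. if i = j then var j * Poly_Mapping.single ?m c else 0)"
    by (intro sum.cong) auto
  also have "\<dots> = Poly_Mapping.single m c"
    using \<open>j \<le> n\<close> var_times_single[OF j] by simp
  finally show ?case
    using * by (intro exI[of _ ?q]) auto
next
  case (add p q)
  then obtain a b where "\<forall>j. a j \<in> homog_polys n d" "p = (\<Sum>j\<le>n. var j * a j)"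
    "\<forall>j. b j \<in> homog_polys n d" "q = (\<Sum>j\<le>n. var j * b j)"
    by blast
  then show ?case
    by (intro exI[of _ "\<lambda>j. a j + b j"]) (auto simp: algebra_simps sum.distrib)
qed

section \<open>Free and quotient modules\<close>

lemma free_module_simps [simp]:
  "f \<oplus>\<^bsub>free_module A B\<^esub> g = (\<lambda>x. f x \<oplus>\<^bsub>A\<^esub> g x)"
  "a \<odot>\<^bsub>free_module A B\<^esub> f = (\<lambda>x. a \<otimes>\<^bsub>A\<^esub> f x)"
  "\<zero>\<^bsub>free_module A B\<^esub> = (\<lambda>x. \<zero>\<^bsub>A\<^esub>)"
  by (simp_all add: free_module_def)

lemma carrier_free_module:
  "f \<in> carrier (free_module A B) \<longleftrightarrow>
    f \<in> B \<rightarrow> carrier A \<and> (\<forall>x. x \<notin> B \<longrightarrow> f x = \<zero>\<^bsub>A\<^esub>) \<and> finite {x. f x \<noteq> \<zero>\<^bsub>A\<^esub>}"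
  by (simp add: free_module_def)

context
  fixes R :: "'a ring" (structure)
  assumes R: "cring R"
begin

interpretation cring R
  by (rule R)

lemma free_module_coeff:
  "f \<in> carrier (free_module R B) \<Longrightarrow> f x \<in> carrier R"
  by (cases "x \<in> B") (auto simp: carrier_free_module)

lemma free_module_is_module: "Module.module R (free_module R B)"
proof (rule module_criteria)
  let ?F = "free_module R B"
  show "cring R"
    by (rule is_cring)
  show "\<zero>\<^bsub>?F\<^esub> \<in> carrier ?F"
    by (simp add: carrier_free_module)
  have add: "f \<oplus>\<^bsub>?F\<^esub> g \<in> carrier ?F" if "f \<in> carrier ?F" "g \<in> carrier ?F" for f g
  proof -
    have "{x. f x \<oplus> g x \<noteq> \<zero>} \<subseteq> {x. f x \<noteq> \<zero>} \<union> {x. g x \<noteq> \<zero>}"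
      by auto
    moreover have "finite ({x. f x \<noteq> \<zero>} \<union> {x. g x \<noteq> \<zero>})"
      using that by (simp add: carrier_free_module)
    ultimately have "finite {x. f x \<oplus> g x \<noteq> \<zero>}"
      by (rule finite_subset)
    then show ?thesis
      using that by (simp add: carrier_free_module Pi_iff)
  qed
  then show "\<forall>f g. f \<in> carrier ?F \<and> g \<in> carrier ?F \<longrightarrow> f \<oplus>\<^bsub>?F\<^esub> g \<in> carrier ?F"
    by blast
  have smult: "a \<odot>\<^bsub>?F\<^esub> f \<in> carrier ?F" if "a \<in> carrier R" "f \<in> carrier ?F" for a f
  proof -
    have "{x. a \<otimes> f x \<noteq> \<zero>} \<subseteq> {x. f x \<noteq> \<zero>}"
      using that by auto
    moreover have "finite {x. f x \<noteq> \<zero>}"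
      using that by (simp add: carrier_free_module)
    ultimately have "finite {x. a \<otimes> f x \<noteq> \<zero>}"
      by (rule finite_subset)
    then show ?thesis
      using that by (simp add: carrier_free_module Pi_iff)
  qed
  then show "\<forall>a f. a \<in> carrier R \<and> f \<in> carrier ?F \<longrightarrow> a \<odot>\<^bsub>?F\<^esub> f \<in> carrier ?F"
    by blast
  show "\<forall>f\<in>carrier ?F. \<exists>g\<in>carrier ?F. f \<oplus>\<^bsub>?F\<^esub> g = \<zero>\<^bsub>?F\<^esub>"
  proof
    fix f assume f: "f \<in> carrier ?F"
    have "f \<oplus>\<^bsub>?F\<^esub> ((\<ominus> \<one>) \<odot>\<^bsub>?F\<^esub> f) = \<zero>\<^bsub>?F\<^esub>"
      using free_module_coeff[OF f] by (auto simp: l_minus r_neg)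
    moreover have "(\<ominus> \<one>) \<odot>\<^bsub>?F\<^esub> f \<in> carrier ?F"
      using f by (intro smult) auto
    ultimately show "\<exists>g\<in>carrier ?F. f \<oplus>\<^bsub>?F\<^esub> g = \<zero>\<^bsub>?F\<^esub>"
      by blast
  qed
qed (auto simp: free_module_coeff fun_eq_iff a_ac m_ac l_distr r_distr)

lemma free_gen_closed: "b \<in> B \<Longrightarrow> free_gen R b \<in> carrier (free_module R B)"
proof -
  assume "b \<in> B"
  moreover have "{x. (if x = b then \<one> else \<zero>) \<noteq> \<zero>} \<subseteq> {b}"
    by auto
  ultimately show ?thesis
    by (auto simp: carrier_free_module free_gen_def intro: finite_subset)
qed

end

text \<open>The module axioms are equations and the existence of negatives, so they pass to any
  record \<open>Q\<close> onto which \<open>\<kappa>\<close> maps compatibly with the operations.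
  Intended for the map from a module to its cosets.\<close>

lemma module_image:
  assumes "Module.module A M" and carr: "carrier Q = \<kappa> ` carrier M" and zero: "\<zero>\<^bsub>Q\<^esub> = \<kappa> \<zero>\<^bsub>M\<^esub>"
    and add: "\<And>x y. x \<in> carrier M \<Longrightarrow> y \<in> carrier M \<Longrightarrow> \<kappa> x \<oplus>\<^bsub>Q\<^esub> \<kappa> y = \<kappa> (x \<oplus>\<^bsub>M\<^esub> y)"
    and smult: "\<And>a x. a \<in> carrier A \<Longrightarrow> x \<in> carrier M \<Longrightarrow> a \<odot>\<^bsub>Q\<^esub> \<kappa> x = \<kappa> (a \<odot>\<^bsub>M\<^esub> x)"
  shows "Module.module A Q"
proof -
  interpret M: Module.module A M
    by fact
  show ?thesis
  proof (rule module_criteria)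
    show "cring A"
      by (rule M.is_cring)
    show "\<forall>v\<in>carrier Q. \<exists>w\<in>carrier Q. v \<oplus>\<^bsub>Q\<^esub> w = \<zero>\<^bsub>Q\<^esub>"
    proof
      fix v assume "v \<in> carrier Q"
      then obtain x where "x \<in> carrier M" "v = \<kappa> x"
        by (auto simp: carr)
      then show "\<exists>w\<in>carrier Q. v \<oplus>\<^bsub>Q\<^esub> w = \<zero>\<^bsub>Q\<^esub>"
        by (intro bexI[of _ "\<kappa> (\<ominus>\<^bsub>M\<^esub> x)"]) (auto simp: carr add zero M.M.r_neg)
    qed
  qed (auto simp: carr zero add smult M.M.a_ac M.smult_assoc1 M.smult_l_distr M.smult_r_distr)
qed

text \<open>Negatives are multiples by \<open>\<ominus> \<one>\<close>. As a subgroup,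
  \<open>N\<close> has the coset calculus of HOL-Algebra at its disposal.\<close>

lemma (in Module.module) submodule_abelian_subgroup:
  assumes "LinearCombinations.submodule R N M"
  shows "abelian_subgroup N M"
proof -
  interpret N: LinearCombinations.submodule R N M
    by fact
  have "\<ominus>\<^bsub>M\<^esub> x \<in> N" if "x \<in> N" for x
  proof -
    have "(\<ominus> \<one>) \<odot>\<^bsub>M\<^esub> x \<in> N"
      using that by (intro N.smult_closed) auto
    then show ?thesis
      using that N.subset by (simp add: subsetD smult_l_minus)
  qed
  then have "additive_subgroup N M"
    using N.subset
    by (intro additive_subgroup.intro subgroup.intro) (auto simp: a_inv_def[symmetric])
  then show ?thesis
    by (intro abelian_subgroupI3 M.abelian_group_axioms)
qed

context
  fixes A :: "'a ring" and M :: "('a, 'b) module" and N :: "'b set"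
  assumes mod: "Module.module A M" and sub: "LinearCombinations.submodule A N M"
begin

interpretation M: Module.module A M
  by (rule mod)

interpretation N: abelian_subgroup N M
  by (rule M.submodule_abelian_subgroup[OF sub])

lemma quot_module_carrier: "carrier (quot_module M N) = (\<lambda>x. N +>\<^bsub>M\<^esub> x) ` carrier M"
  by (auto simp: quot_module_def A_RCOSETS_def')

lemma quot_module_zero: "\<zero>\<^bsub>quot_module M N\<^esub> = N +>\<^bsub>M\<^esub> \<zero>\<^bsub>M\<^esub>"
  using N.a_subset by (simp add: quot_module_def)

lemma quot_module_add:
  "x \<in> carrier M \<Longrightarrow> y \<in> carrier M \<Longrightarrow>
    (N +>\<^bsub>M\<^esub> x) \<oplus>\<^bsub>quot_module M N\<^esub> (N +>\<^bsub>M\<^esub> y) = N +>\<^bsub>M\<^esub> (x \<oplus>\<^bsub>M\<^esub> y)"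
  by (simp add: quot_module_def N.a_rcos_sum)

lemma quot_module_coset_eq:
  assumes "x \<in> carrier M" "y \<in> carrier M"
  shows "N +>\<^bsub>M\<^esub> x = N +>\<^bsub>M\<^esub> y \<longleftrightarrow> x \<ominus>\<^bsub>M\<^esub> y \<in> N"
proof
  assume "N +>\<^bsub>M\<^esub> x = N +>\<^bsub>M\<^esub> y"
  then have "x \<in> N +>\<^bsub>M\<^esub> y"
    using N.a_rcos_self[OF assms(1)] by simp
  then show "x \<ominus>\<^bsub>M\<^esub> y \<in> N"
    using assms N.a_rcos_module[of y x] by (simp add: a_minus_def)
next
  assume "x \<ominus>\<^bsub>M\<^esub> y \<in> N"
  then have "x \<in> N +>\<^bsub>M\<^esub> y"
    using assms N.a_rcos_module[of y x] by (simp add: a_minus_def)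
  then show "N +>\<^bsub>M\<^esub> x = N +>\<^bsub>M\<^esub> y"
    using assms M.M.a_repr_independence N.a_subgroup by metis
qed

text \<open>The union defining the scalar multiple ranges over all representatives of the coset;
  they all yield the same coset because \<open>a\<close> maps differences in \<open>N\<close> into
  \<open>N\<close>.\<close>

lemma quot_module_smult:
  assumes "a \<in> carrier A" "x \<in> carrier M"
  shows "a \<odot>\<^bsub>quot_module M N\<^esub> (N +>\<^bsub>M\<^esub> x) = N +>\<^bsub>M\<^esub> (a \<odot>\<^bsub>M\<^esub> x)"
proof -
  interpret S: LinearCombinations.submodule A N M
    by (rule sub)
  have "N +>\<^bsub>M\<^esub> (a \<odot>\<^bsub>M\<^esub> u) = N +>\<^bsub>M\<^esub> (a \<odot>\<^bsub>M\<^esub> x)" if "u \<in> N +>\<^bsub>M\<^esub> x" for u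
  proof -
    have u: "u \<in> carrier M"
      using that assms N.a_elemrcos_carrier by blast
    then have "u \<ominus>\<^bsub>M\<^esub> x \<in> N"
      using that assms N.a_rcos_module[of x u] by (simp add: a_minus_def)
    then have "a \<odot>\<^bsub>M\<^esub> (u \<ominus>\<^bsub>M\<^esub> x) \<in> N"
      using assms by (intro S.smult_closed)
    then have "a \<odot>\<^bsub>M\<^esub> u \<ominus>\<^bsub>M\<^esub> a \<odot>\<^bsub>M\<^esub> x \<in> N"
      using assms u by (simp add: a_minus_def M.smult_r_distr M.smult_r_minus)
    then show ?thesis
      using assms u by (subst quot_module_coset_eq) auto
  qed
  moreover have "N +>\<^bsub>M\<^esub> x \<noteq> {}"
    using assms N.a_rcos_self by blast
  ultimately have "(\<Union>u\<in>N +>\<^bsub>M\<^esub> x. N +>\<^bsub>M\<^esub> (a \<odot>\<^bsub>M\<^esub> u)) = N +>\<^bsub>M\<^esub> (a \<odot>\<^bsub>M\<^esub> x)"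
    by (intro SUP_eq_const)
  then show ?thesis
    by (simp add: quot_module_def)
qed

lemma quot_module_is_module: "Module.module A (quot_module M N)"
  by (rule module_image[where \<kappa> = "\<lambda>x. N +>\<^bsub>M\<^esub> x", OF mod])
    (simp_all add: quot_module_carrier quot_module_zero quot_module_add quot_module_smult)

end

section \<open>Differentials of a quotient of a polynomial ring\<close>

text \<open>Instantiated with \<open>R\<close> and with \<open>S\<close>. With \<open>P\<close> as
  common source, the same vector of polynomials can stand for a differential of either ring.\<close>

locale poly_quotient = cring A for A :: "'a ring" (structure) +
  fixes n :: nat and \<pi> :: "'k::field mpol \<Rightarrow> 'a"
  assumes hom: "\<pi> \<in> ring_hom (poly_ring n) A"
    and surj: "\<pi> ` carrier (poly_ring n) = carrier A"
begin

abbreviation "P \<equiv> carrier (poly_ring n) :: 'k mpol set"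
abbreviation "F \<equiv> free_module A (carrier A)"
abbreviation "\<delta> \<equiv> free_gen A"
abbreviation "\<phi> \<equiv> \<lambda>c. \<pi> (const c)"
abbreviation "N \<equiv> kaehler_sub \<phi> A"
abbreviation "\<Omega> \<equiv> kaehler \<phi> A"
abbreviation "d \<equiv> kaehler_d \<phi> A"

definition "J = {p \<in> P. \<pi> p = \<zero>}"

lemma pi_closed [simp, intro]: "p \<in> P \<Longrightarrow> \<pi> p \<in> carrier A"
  using surj by blast

lemma pi_add [simp]: "p \<in> P \<Longrightarrow> q \<in> P \<Longrightarrow> \<pi> (p + q) = \<pi> p \<oplus> \<pi> q"
  using ring_hom_add[OF hom, of p q] by simp

lemma pi_mult [simp]: "p \<in> P \<Longrightarrow> q \<in> P \<Longrightarrow> \<pi> (p * q) = \<pi> p \<otimes> \<pi> q"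
  using ring_hom_mult[OF hom, of p q] by simp

lemma pi_1 [simp]: "\<pi> 1 = \<one>"
  using ring_hom_one[OF hom] by simp

lemma pi_0 [simp]: "\<pi> 0 = \<zero>"
proof -
  have "\<pi> 0 \<oplus> \<pi> 0 = \<pi> 0"
    using pi_add[of 0 0] by simp
  then show ?thesis
    using pi_closed[of 0] add.r_cancel_one[of "\<pi> 0" "\<pi> 0"] by simp
qed

lemma pi_uminus [simp]:
  assumes "p \<in> P"
  shows "\<pi> (- p) = \<ominus> \<pi> p"
proof (rule minus_equality[symmetric])
  show "\<pi> (- p) \<oplus> \<pi> p = \<zero>"
    using assms pi_add[of "- p" p] by (simp del: pi_add)
qed (use assms in auto)

lemma pi_minus [simp]:
  assumes "p \<in> P" "q \<in> P"
  shows "\<pi> (p - q) = \<pi> p \<ominus> \<pi> q"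
proof -
  have "\<pi> (p + - q) = \<pi> p \<oplus> \<pi> (- q)"
    using assms by (intro pi_add poly_ring_closed)
  then show ?thesis
    unfolding a_minus_def using pi_uminus[OF assms(2)] by simp
qed

lemma pi_eq_iff:
  assumes "p \<in> P" "q \<in> P"
  shows "\<pi> p = \<pi> q \<longleftrightarrow> p - q \<in> J"
  unfolding J_def using assms by simp

lemma J_0: "0 \<in> J"
  unfolding J_def by simp

lemma J_P: "p \<in> J \<Longrightarrow> p \<in> P"
  unfolding J_def by simp

lemma J_add: "p \<in> J \<Longrightarrow> q \<in> J \<Longrightarrow> p + q \<in> J"
  unfolding J_def by simp

lemma J_mult: "p \<in> P \<Longrightarrow> q \<in> J \<Longrightarrow> p * q \<in> J"
  unfolding J_def by simp

lemma J_mult': "p \<in> P \<Longrightarrow> q \<in> J \<Longrightarrow> q * p \<in> J"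
  unfolding J_def by simp

lemma J_minus: "p \<in> J \<Longrightarrow> q \<in> J \<Longrightarrow> p - q \<in> J"
  unfolding J_def by simp

lemma J_sum: "(\<And>i. i \<in> S \<Longrightarrow> f i \<in> J) \<Longrightarrow> sum f S \<in> J"
  by (induction S rule: infinite_finite_induct) (simp_all add: J_0 J_add)

section \<open>The differentials as cosets of the free module\<close>

lemma F_module: "Module.module A F"
  by (rule free_module_is_module[OF is_cring])

interpretation F: Module.module A F
  by (rule F_module)

lemma gen_closed [simp, intro]: "a \<in> carrier A \<Longrightarrow> \<delta> a \<in> carrier F"
  by (rule free_gen_closed[OF is_cring])

lemma rels_closed: "kaehler_rels \<phi> A \<subseteq> carrier F"
proof
  fix f assume "f \<in> kaehler_rels \<phi> A"
  then consider
    a b where "a \<in> carrier A" "b \<in> carrier A" "f = \<delta> (a \<oplus> b) \<ominus>\<^bsub>F\<^esub> (\<delta> a \<oplus>\<^bsub>F\<^esub> \<delta> b)"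
    | a b where "a \<in> carrier A" "b \<in> carrier A"
      "f = \<delta> (a \<otimes> b) \<ominus>\<^bsub>F\<^esub> (a \<odot>\<^bsub>F\<^esub> \<delta> b \<oplus>\<^bsub>F\<^esub> b \<odot>\<^bsub>F\<^esub> \<delta> a)"
    | c where "f = \<delta> (\<phi> c)"
    unfolding kaehler_rels_def Let_def by blast
  then show "f \<in> carrier F"
  proof cases
    case 1
    then show ?thesis
      by (simp only:) (intro F.M.minus_closed F.M.add.m_closed gen_closed add.m_closed)
  next
    case 2
    then show ?thesis
      by (simp only:) (intro F.M.minus_closed F.M.add.m_closed gen_closed F.smult_closed m_closed)
  next
    case 3
    show ?thesis
      unfolding 3 by (intro gen_closed pi_closed poly_ring_closed)
  qed
qed

lemma N_submodule: "LinearCombinations.submodule A N F"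
  unfolding kaehler_sub_def by (rule F.span_is_submodule[OF rels_closed])

lemma rels_in_N: "kaehler_rels \<phi> A \<subseteq> N"
  unfolding kaehler_sub_def by (rule F.in_own_span[OF rels_closed])

definition "cls f = N +>\<^bsub>F\<^esub> f"

lemma Omega_module: "Module.module A \<Omega>"
  unfolding kaehler_def by (rule quot_module_is_module[OF F_module N_submodule])

sublocale Omega: Module.module A \<Omega>
  by (rule Omega_module)

lemma Omega_carrier: "carrier \<Omega> = cls ` carrier F"
  unfolding kaehler_def cls_def by (rule quot_module_carrier[OF F_module N_submodule])

lemma cls_closed [simp, intro]: "f \<in> carrier F \<Longrightarrow> cls f \<in> carrier \<Omega>"
  by (simp add: Omega_carrier)

lemma cls_add: "f \<in> carrier F \<Longrightarrow> g \<in> carrier F \<Longrightarrow> cls (f \<oplus>\<^bsub>F\<^esub> g) = cls f \<oplus>\<^bsub>\<Omega>\<^esub> cls g"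
  unfolding kaehler_def cls_def by (rule quot_module_add[OF F_module N_submodule, symmetric])

lemma cls_smult: "a \<in> carrier A \<Longrightarrow> f \<in> carrier F \<Longrightarrow> cls (a \<odot>\<^bsub>F\<^esub> f) = a \<odot>\<^bsub>\<Omega>\<^esub> cls f"
  unfolding kaehler_def cls_def by (rule quot_module_smult[OF F_module N_submodule, symmetric])

lemma cls_zero: "cls \<zero>\<^bsub>F\<^esub> = \<zero>\<^bsub>\<Omega>\<^esub>"
  unfolding kaehler_def cls_def by (rule quot_module_zero[OF F_module N_submodule, symmetric])

lemma cls_eq_iff: "f \<in> carrier F \<Longrightarrow> g \<in> carrier F \<Longrightarrow> cls f = cls g \<longleftrightarrow> f \<ominus>\<^bsub>F\<^esub> g \<in> N"
  unfolding cls_def by (rule quot_module_coset_eq[OF F_module N_submodule])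

lemma cls_eq_zero_iff:
  assumes "f \<in> carrier F"
  shows "cls f = \<zero>\<^bsub>\<Omega>\<^esub> \<longleftrightarrow> f \<in> N"
proof -
  have "\<ominus>\<^bsub>F\<^esub> \<zero>\<^bsub>F\<^esub> = \<zero>\<^bsub>F\<^esub>"
    using F.M.l_zero F.M.zero_closed by (intro F.M.minus_equality)
  then have "f \<ominus>\<^bsub>F\<^esub> \<zero>\<^bsub>F\<^esub> = f"
    unfolding a_minus_def using F.M.r_zero[OF assms] by simp
  then show ?thesis
    using cls_eq_iff[OF assms F.M.zero_closed] by (simp only: cls_zero)
qed

lemma d_cls: "d a = cls (\<delta> a)"
  by (simp add: kaehler_d_def cls_def)

lemma d_closed [simp, intro]: "a \<in> carrier A \<Longrightarrow> d a \<in> carrier \<Omega>"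
  by (simp add: d_cls)

lemma d_add:
  assumes "a \<in> carrier A" "b \<in> carrier A"
  shows "d (a \<oplus> b) = d a \<oplus>\<^bsub>\<Omega>\<^esub> d b"
proof -
  have "\<delta> (a \<oplus> b) \<ominus>\<^bsub>F\<^esub> (\<delta> a \<oplus>\<^bsub>F\<^esub> \<delta> b) \<in> N"
    using rels_in_N assms unfolding kaehler_rels_def Let_def by blast
  then have "cls (\<delta> (a \<oplus> b)) = cls (\<delta> a \<oplus>\<^bsub>F\<^esub> \<delta> b)"
    using assms by (subst cls_eq_iff) (auto simp del: free_module_simps)
  then show ?thesis
    using assms by (simp add: d_cls cls_add del: free_module_simps)
qed

lemma d_mult:
  assumes "a \<in> carrier A" "b \<in> carrier A"
  shows "d (a \<otimes> b) = a \<odot>\<^bsub>\<Omega>\<^esub> d b \<oplus>\<^bsub>\<Omega>\<^esub> b \<odot>\<^bsub>\<Omega>\<^esub> d a"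
proof -
  have "\<delta> (a \<otimes> b) \<ominus>\<^bsub>F\<^esub> (a \<odot>\<^bsub>F\<^esub> \<delta> b \<oplus>\<^bsub>F\<^esub> b \<odot>\<^bsub>F\<^esub> \<delta> a) \<in> N"
    using rels_in_N assms unfolding kaehler_rels_def Let_def by blast
  then have "cls (\<delta> (a \<otimes> b)) = cls (a \<odot>\<^bsub>F\<^esub> \<delta> b \<oplus>\<^bsub>F\<^esub> b \<odot>\<^bsub>F\<^esub> \<delta> a)"
    using assms by (subst cls_eq_iff) (auto simp del: free_module_simps)
  then show ?thesis
    using assms by (simp add: d_cls cls_add cls_smult del: free_module_simps)
qed

lemma d_const: "d (\<phi> c) = \<zero>\<^bsub>\<Omega>\<^esub>"
proof -
  have "\<delta> (\<phi> c) \<in> N"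
    using rels_in_N unfolding kaehler_rels_def Let_def by blast
  then show ?thesis
    by (simp add: d_cls cls_eq_zero_iff)
qed

lemma d_zero: "d \<zero> = \<zero>\<^bsub>\<Omega>\<^esub>"
  using d_const[of 0] by (simp add: const_def)

text \<open>Functions in the free module have finite support, so a differential is a finite sum of
  terms \<open>a db\<close>; the induction removes one point of the support at a time.\<close>

lemma Omega_induct [consumes 1, case_names zero gen add]:
  assumes "w \<in> carrier \<Omega>"
    and zero: "Q \<zero>\<^bsub>\<Omega>\<^esub>"
    and gen: "\<And>a b. a \<in> carrier A \<Longrightarrow> b \<in> carrier A \<Longrightarrow> Q (a \<odot>\<^bsub>\<Omega>\<^esub> d b)"
    and add: "\<And>v w. v \<in> carrier \<Omega> \<Longrightarrow> w \<in> carrier \<Omega> \<Longrightarrow> Q v \<Longrightarrow> Q w \<Longrightarrow> Q (v \<oplus>\<^bsub>\<Omega>\<^esub> w)"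
  shows "Q w"
proof -
  have "Q (cls f)" if "finite S" "f \<in> carrier F" "{x. f x \<noteq> \<zero>} \<subseteq> S" for S f
    using that
  proof (induction S arbitrary: f rule: finite_induct)
    case empty
    then have "f = \<zero>\<^bsub>F\<^esub>"
      by auto
    then show ?case
      using zero cls_zero by simp
  next
    case (insert b S)
    show ?case
    proof (cases "b \<in> carrier A")
      case False
      then have "f b = \<zero>"
        using insert.prems by (simp add: carrier_free_module)
      then have "{x. f x \<noteq> \<zero>} \<subseteq> S"
        using insert.prems(2) by blast
      then show ?thesis
        by (rule insert.IH[OF insert.prems(1)])
    next
      case True
      let ?g = "f(b := \<zero>)"
      have fb: "f b \<in> carrier A"
        by (rule free_module_coeff[OF is_cring insert.prems(1)])
      have g: "?g \<in> carrier F"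
      proof -
        have "{x. ?g x \<noteq> \<zero>} \<subseteq> {x. f x \<noteq> \<zero>}"
          by auto
        moreover have "finite {x. f x \<noteq> \<zero>}"
          using insert.prems(1) by (simp add: carrier_free_module)
        ultimately have "finite {x. ?g x \<noteq> \<zero>}"
          by (rule finite_subset)
        then show ?thesis
          using insert.prems(1) by (simp add: carrier_free_module Pi_iff)
      qed
      have "f x = ?g x \<oplus> f b \<otimes> \<delta> b x" for x
        using fb free_module_coeff[OF is_cring insert.prems(1), of x] by (auto simp: free_gen_def)
      then have "f = ?g \<oplus>\<^bsub>F\<^esub> f b \<odot>\<^bsub>F\<^esub> \<delta> b"
        by (simp add: fun_eq_iff)
      then have "cls f = cls (?g \<oplus>\<^bsub>F\<^esub> f b \<odot>\<^bsub>F\<^esub> \<delta> b)"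
        by (rule arg_cong)
      also have "\<dots> = cls ?g \<oplus>\<^bsub>\<Omega>\<^esub> cls (f b \<odot>\<^bsub>F\<^esub> \<delta> b)"
        using g fb True by (intro cls_add F.smult_closed) auto
      also have "cls (f b \<odot>\<^bsub>F\<^esub> \<delta> b) = f b \<odot>\<^bsub>\<Omega>\<^esub> d b"
        unfolding d_cls using fb True by (intro cls_smult) auto
      finally have eq: "cls f = cls ?g \<oplus>\<^bsub>\<Omega>\<^esub> f b \<odot>\<^bsub>\<Omega>\<^esub> d b" .
      have "Q (cls ?g)"
        using insert.prems(2) by (intro insert.IH[OF g]) auto
      then show ?thesis
        unfolding eq using g fb True by (intro add gen) auto
    qed
  qed
  moreover obtain f where "f \<in> carrier F" "w = cls f"
    using assms(1) by (auto simp: Omega_carrier)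
  ultimately show ?thesis
    by (auto simp: carrier_free_module)
qed


section \<open>The presentation of the differentials by vectors of polynomials\<close>

definition "Pvec = {g. \<forall>j\<le>n. g j \<in> P}"

text \<open>The relation module. A single gradient suffices in place of a
  \<open>P\<close>-combination of gradients of elements of \<open>J\<close>, because these are
  closed under addition and, up to vectors over \<open>J\<close>, under multiplication by
  \<open>P\<close>. Vectors are functions on all naturals of which only the entries up to
  \<open>n\<close> count.\<close>

definition "U = {g \<in> Pvec. \<exists>f\<in>J. \<forall>j\<le>n. g j - pdiff j f \<in> J}"

definition "\<theta> g = (\<Oplus>\<^bsub>\<Omega>\<^esub> j\<in>{..n}. \<pi> (g j) \<odot>\<^bsub>\<Omega>\<^esub> d (\<pi> (var j)))"

lemma PvecD: "g \<in> Pvec \<Longrightarrow> j \<le> n \<Longrightarrow> g j \<in> P"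
  by (simp add: Pvec_def)

lemma Pvec_add: "g \<in> Pvec \<Longrightarrow> h \<in> Pvec \<Longrightarrow> (\<lambda>j. g j + h j) \<in> Pvec"
  by (simp add: Pvec_def)

lemma Pvec_minus: "g \<in> Pvec \<Longrightarrow> h \<in> Pvec \<Longrightarrow> (\<lambda>j. g j - h j) \<in> Pvec"
  by (simp add: Pvec_def)

lemma Pvec_smult: "p \<in> P \<Longrightarrow> g \<in> Pvec \<Longrightarrow> (\<lambda>j. p * g j) \<in> Pvec"
  by (simp add: Pvec_def)

lemma Pvec_pdiff: "p \<in> P \<Longrightarrow> (\<lambda>j. pdiff j p) \<in> Pvec"
  by (simp add: Pvec_def)

lemma dvar_closed: "j \<le> n \<Longrightarrow> d (\<pi> (var j)) \<in> carrier \<Omega>"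
  by (intro d_closed pi_closed poly_ring_closed)

lemma theta_term_closed:
  "g \<in> Pvec \<Longrightarrow> (\<lambda>j. \<pi> (g j) \<odot>\<^bsub>\<Omega>\<^esub> d (\<pi> (var j))) \<in> {..n} \<rightarrow> carrier \<Omega>"
  using dvar_closed PvecD by (auto intro!: Omega.smult_closed pi_closed)

lemma theta_closed: "g \<in> Pvec \<Longrightarrow> \<theta> g \<in> carrier \<Omega>"
  unfolding \<theta>_def by (intro Omega.M.finsum_closed theta_term_closed)

lemma theta_add:
  assumes "g \<in> Pvec" "h \<in> Pvec"
  shows "\<theta> (\<lambda>j. g j + h j) = \<theta> g \<oplus>\<^bsub>\<Omega>\<^esub> \<theta> h"
proof -
  have "\<theta> (\<lambda>j. g j + h j) = (\<Oplus>\<^bsub>\<Omega>\<^esub> j\<in>{..n}.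
      \<pi> (g j) \<odot>\<^bsub>\<Omega>\<^esub> d (\<pi> (var j)) \<oplus>\<^bsub>\<Omega>\<^esub> \<pi> (h j) \<odot>\<^bsub>\<Omega>\<^esub> d (\<pi> (var j)))"
    unfolding \<theta>_def
  proof (rule Omega.M.finsum_cong')
    show "(\<lambda>j. \<pi> (g j) \<odot>\<^bsub>\<Omega>\<^esub> d (\<pi> (var j)) \<oplus>\<^bsub>\<Omega>\<^esub> \<pi> (h j) \<odot>\<^bsub>\<Omega>\<^esub> d (\<pi> (var j)))
        \<in> {..n} \<rightarrow> carrier \<Omega>"
      using theta_term_closed[OF assms(1)] theta_term_closed[OF assms(2)] by (simp add: Pi_iff)
  next
    fix j assume "j \<in> {..n}"
    then show "\<pi> (g j + h j) \<odot>\<^bsub>\<Omega>\<^esub> d (\<pi> (var j)) =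
        \<pi> (g j) \<odot>\<^bsub>\<Omega>\<^esub> d (\<pi> (var j)) \<oplus>\<^bsub>\<Omega>\<^esub> \<pi> (h j) \<odot>\<^bsub>\<Omega>\<^esub> d (\<pi> (var j))"
      using assms by (simp add: PvecD Omega.smult_l_distr dvar_closed)
  qed simp
  also have "\<dots> = \<theta> g \<oplus>\<^bsub>\<Omega>\<^esub> \<theta> h"
    unfolding \<theta>_def using assms by (intro Omega.M.finsum_addf theta_term_closed)
  finally show ?thesis .
qed

lemma theta_smult:
  assumes "p \<in> P" "g \<in> Pvec"
  shows "\<theta> (\<lambda>j. p * g j) = \<pi> p \<odot>\<^bsub>\<Omega>\<^esub> \<theta> g"
proof -
  have "\<pi> p \<odot>\<^bsub>\<Omega>\<^esub> \<theta> g = (\<Oplus>\<^bsub>\<Omega>\<^esub> j\<in>{..n}. \<pi> p \<odot>\<^bsub>\<Omega>\<^esub> (\<pi> (g j) \<odot>\<^bsub>\<Omega>\<^esub> d (\<pi> (var j))))"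
    unfolding \<theta>_def using assms by (intro Omega.finsum_smult_ldistr theta_term_closed pi_closed) simp
  also have "\<dots> = \<theta> (\<lambda>j. p * g j)"
    unfolding \<theta>_def
  proof (rule Omega.M.finsum_cong')
    show "(\<lambda>j. \<pi> (p * g j) \<odot>\<^bsub>\<Omega>\<^esub> d (\<pi> (var j))) \<in> {..n} \<rightarrow> carrier \<Omega>"
      using theta_term_closed[OF Pvec_smult[OF assms]] .
  next
    fix j assume "j \<in> {..n}"
    then show "\<pi> p \<odot>\<^bsub>\<Omega>\<^esub> (\<pi> (g j) \<odot>\<^bsub>\<Omega>\<^esub> d (\<pi> (var j))) = \<pi> (p * g j) \<odot>\<^bsub>\<Omega>\<^esub> d (\<pi> (var j))"
      using assms by (simp add: PvecD Omega.smult_assoc1 dvar_closed)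
  qed simp
  finally show ?thesis ..
qed

lemma theta_cong:
  assumes "g \<in> Pvec" "h \<in> Pvec" "\<And>j. j \<le> n \<Longrightarrow> g j - h j \<in> J"
  shows "\<theta> g = \<theta> h"
  unfolding \<theta>_def
proof (rule Omega.M.finsum_cong'[OF refl theta_term_closed[OF assms(2)]])
  fix j assume "j \<in> {..n}"
  then have "\<pi> (g j) = \<pi> (h j)"
    using assms by (subst pi_eq_iff) (simp_all add: PvecD)
  then show "\<pi> (g j) \<odot>\<^bsub>\<Omega>\<^esub> d (\<pi> (var j)) = \<pi> (h j) \<odot>\<^bsub>\<Omega>\<^esub> d (\<pi> (var j))"
    by simp
qed

lemma theta_zero: "\<theta> (\<lambda>j. 0) = \<zero>\<^bsub>\<Omega>\<^esub>"
  using theta_smult[of 0 "\<lambda>j. 0"] theta_closed[of "\<lambda>j. 0"] by (simp add: Pvec_def)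

lemma theta_delta:
  assumes "i \<le> n" "p \<in> P"
  shows "\<theta> (\<lambda>j. if j = i then p else 0) = \<pi> p \<odot>\<^bsub>\<Omega>\<^esub> d (\<pi> (var i))"
proof -
  have g: "(\<lambda>j. if j = i then p else 0) \<in> Pvec"
    using assms by (simp add: Pvec_def)
  have eq: "{..n} = insert i ({..n} - {i})"
    using assms by auto
  have "\<theta> (\<lambda>j. if j = i then p else 0) = \<pi> p \<odot>\<^bsub>\<Omega>\<^esub> d (\<pi> (var i)) \<oplus>\<^bsub>\<Omega>\<^esub>
     (\<Oplus>\<^bsub>\<Omega>\<^esub> j\<in>{..n} - {i}. \<pi> (if j = i then p else 0) \<odot>\<^bsub>\<Omega>\<^esub> d (\<pi> (var j)))"
    unfolding \<theta>_def using theta_term_closed[OF g] assms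
    by (subst eq, subst Omega.M.finsum_insert) (auto simp: dvar_closed)
  also have "(\<Oplus>\<^bsub>\<Omega>\<^esub> j\<in>{..n} - {i}. \<pi> (if j = i then p else 0) \<odot>\<^bsub>\<Omega>\<^esub> d (\<pi> (var j))) = \<zero>\<^bsub>\<Omega>\<^esub>"
    using dvar_closed by (intro Omega.M.add.finprod_one_eqI) auto
  finally show ?thesis
    using assms by (simp add: dvar_closed)
qed

text \<open>Both sides are additive, satisfy the Leibniz rule, vanish on constants and agree on the
  variables.\<close>

lemma d_poly: "p \<in> P \<Longrightarrow> d (\<pi> p) = \<theta> (\<lambda>j. pdiff j p)"
proof (induction p rule: poly_ring_induct)
  case (const c)
  then show ?case
    by (simp add: d_const theta_zero)
next
  case (var j)
  then have "\<theta> (\<lambda>i. pdiff i (var j)) = \<theta> (\<lambda>i. if i = j then 1 else 0)"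
    by (intro arg_cong[where f = \<theta>]) (auto simp: pdiff_var)
  then show ?case
    using theta_delta[of j 1] var by (simp add: dvar_closed)
next
  case (add p q)
  then show ?case
    by (simp add: d_add pdiff_add theta_add Pvec_pdiff)
next
  case (mult p q)
  then show ?case
    by (simp add: d_mult pdiff_mult theta_add theta_smult Pvec_pdiff Pvec_smult)
qed

lemma theta_surj: "w \<in> carrier \<Omega> \<Longrightarrow> \<exists>g\<in>Pvec. w = \<theta> g"
proof (induction w rule: Omega_induct)
  case zero
  show ?case
    using theta_zero by (intro bexI[of _ "\<lambda>j. 0"]) (auto simp: Pvec_def)
next
  case (gen a b)
  then obtain p q where pq: "p \<in> P" "a = \<pi> p" "q \<in> P" "b = \<pi> q"
    using surj by blast
  then show ?case
    by (intro bexI[of _ "\<lambda>j. p * pdiff j q"]) (simp_all add: theta_smult Pvec_smult Pvec_pdiff d_poly)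
next
  case (add v w)
  then obtain g h where "g \<in> Pvec" "v = \<theta> g" "h \<in> Pvec" "w = \<theta> h"
    by blast
  then show ?case
    by (intro bexI[of _ "\<lambda>j. g j + h j"]) (simp_all add: theta_add Pvec_add)
qed

lemma U_Pvec: "g \<in> U \<Longrightarrow> g \<in> Pvec"
  unfolding U_def by simp

lemma UE:
  assumes "g \<in> U"
  obtains f where "f \<in> J" "f \<in> P" "\<And>j. j \<le> n \<Longrightarrow> g j - pdiff j f \<in> J"
  using assms J_P unfolding U_def by blast

lemma UI: "f \<in> J \<Longrightarrow> g \<in> Pvec \<Longrightarrow> (\<And>j. j \<le> n \<Longrightarrow> g j - pdiff j f \<in> J) \<Longrightarrow> g \<in> U"
  unfolding U_def by blast

text \<open>Up to coefficients that vanish in \<open>A\<close>, the vector is the gradient of some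
  \<open>f\<close> in \<open>J\<close>, and that gradient represents
  \<open>d (\<pi> f) = d \<zero>\<close>.\<close>

lemma theta_U:
  assumes "g \<in> U"
  shows "\<theta> g = \<zero>\<^bsub>\<Omega>\<^esub>"
proof -
  obtain f where f: "f \<in> J" "f \<in> P" "\<And>j. j \<le> n \<Longrightarrow> g j - pdiff j f \<in> J"
    using UE[OF assms] by metis
  have "\<theta> g = \<theta> (\<lambda>j. pdiff j f)"
    by (rule theta_cong[OF U_Pvec[OF assms] Pvec_pdiff[OF f(2)] f(3)])
  also have "\<dots> = d (\<pi> f)"
    by (rule d_poly[OF f(2), symmetric])
  also have "\<pi> f = \<zero>"
    using f(1) by (simp add: J_def)
  finally show ?thesis
    by (simp only: d_zero)
qed

lemma J_U:
  assumes "\<And>j. j \<le> n \<Longrightarrow> g j \<in> J"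
  shows "g \<in> U"
proof (rule UI[OF J_0])
  show "g \<in> Pvec"
    unfolding Pvec_def using J_P[OF assms] by blast
  show "g j - pdiff j 0 \<in> J" if "j \<le> n" for j
    using assms[OF that] by simp
qed

lemma pdiff_J_U:
  assumes "f \<in> J"
  shows "(\<lambda>j. pdiff j f) \<in> U"
  using UI[OF assms Pvec_pdiff[OF J_P[OF assms]]] J_0 by simp

lemma U_add:
  assumes "g \<in> U" "h \<in> U"
  shows "(\<lambda>j. g j + h j) \<in> U"
proof -
  obtain f f' where f: "f \<in> J" "\<And>j. j \<le> n \<Longrightarrow> g j - pdiff j f \<in> J"
    "f' \<in> J" "\<And>j. j \<le> n \<Longrightarrow> h j - pdiff j f' \<in> J"
    using UE[OF assms(1)] UE[OF assms(2)] by metis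
  show ?thesis
  proof (rule UI)
    show "f + f' \<in> J"
      using f by (intro J_add)
    show "g j + h j - pdiff j (f + f') \<in> J" if "j \<le> n" for j
    proof -
      have "(g j - pdiff j f) + (h j - pdiff j f') \<in> J"
        by (rule J_add[OF f(2)[OF that] f(4)[OF that]])
      then show ?thesis
        by (simp add: pdiff_add algebra_simps)
    qed
  qed (use assms in \<open>simp add: U_Pvec Pvec_add\<close>)
qed

text \<open>\<open>p\<close> times the gradient of \<open>f\<close> is the gradient of
  \<open>p * f\<close> minus \<open>f\<close> times the gradient of \<open>p\<close>, and the last
  vector has entries in \<open>J\<close>.\<close>

lemma U_smult:
  assumes "p \<in> P" "g \<in> U"
  shows "(\<lambda>j. p * g j) \<in> U"
proof -
  obtain f where f: "f \<in> J" "\<And>j. j \<le> n \<Longrightarrow> g j - pdiff j f \<in> J"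
    using UE[OF assms(2)] by metis
  show ?thesis
  proof (rule UI)
    show "p * f \<in> J"
      using f assms by (intro J_mult)
    show "p * g j - pdiff j (p * f) \<in> J" if "j \<le> n" for j
    proof -
      have "p * (g j - pdiff j f) - pdiff j p * f \<in> J"
        by (rule J_minus[OF J_mult[OF assms(1) f(2)[OF that]] J_mult[OF pdiff_closed[OF assms(1)] f(1)]])
      then show ?thesis
        by (simp add: pdiff_mult algebra_simps)
    qed
  qed (use assms in \<open>simp add: U_Pvec Pvec_smult\<close>)
qed

lemma U_minus:
  assumes "g \<in> U" "h \<in> U"
  shows "(\<lambda>j. g j - h j) \<in> U"
  using U_add[OF assms(1) U_smult[of "- 1", OF _ assms(2)]] by simp

text \<open>
  An element \<open>f\<close> of the free module on the symbols \<open>da\<close> is sent to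
  \<open>\<Sum>\<^sub>a f(a) grad a\<close>, computed with chosen polynomial representatives of \<open>a\<close> and \<open>f(a)\<close>. Modulo
  \<open>U\<close> this does not depend on the choices and kills the defining relations, which yields the
  injectivity of the presentation.
\<close>

definition "lift a = (if a = \<zero> then 0 else inv_into P \<pi> a)"

lemma lift: "a \<in> carrier A \<Longrightarrow> lift a \<in> P" "a \<in> carrier A \<Longrightarrow> \<pi> (lift a) = a"
  using surj inv_into_into[of a \<pi> P] f_inv_into_f[of a \<pi> P] by (auto simp: lift_def)

lemma lift_zero [simp]: "lift \<zero> = 0"
  by (simp add: lift_def)

definition "gradsum f j = (\<Sum>a | f a \<noteq> \<zero>. lift (f a) * pdiff j (lift a))"

text \<open>Congruence modulo \<open>U\<close> in place of equality frees the computation from the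
  arbitrary lifts: any convenient vector may be used for \<open>f\<close>.\<close>

definition "represents f g \<longleftrightarrow> (\<lambda>j. gradsum f j - g j) \<in> U"

text \<open>Enlarging the index set is harmless because \<open>lift\<close> sends
  \<open>\<zero>\<close> to \<open>0\<close>, a value fixed for this purpose. Two functions can then
  be summed over a common support.\<close>

lemma gradsum_superset:
  assumes "finite S" "{a. f a \<noteq> \<zero>} \<subseteq> S"
  shows "gradsum f j = (\<Sum>a\<in>S. lift (f a) * pdiff j (lift a))"
  unfolding gradsum_def using assms by (intro sum.mono_neutral_left) auto

lemma represents_add:
  assumes "f \<in> carrier F" "f' \<in> carrier F" "represents f g" "represents f' g'"
  shows "represents (f \<oplus>\<^bsub>F\<^esub> f') (\<lambda>j. g j + g' j)"
proof -
  let ?S = "{a. f a \<noteq> \<zero>} \<union> {a. f' a \<noteq> \<zero>}"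
  have fin: "finite ?S"
    using assms by (simp add: carrier_free_module)
  have sub: "?S \<subseteq> carrier A"
    using assms by (auto simp: carrier_free_module)
  have supp: "{a. (f \<oplus>\<^bsub>F\<^esub> f') a \<noteq> \<zero>} \<subseteq> ?S"
    by auto
  \<comment> \<open>\<open>lift\<close> is not additive, but each coefficient is off only by an
    element of \<open>J\<close>.\<close>
  have "gradsum (f \<oplus>\<^bsub>F\<^esub> f') j - (gradsum f j + gradsum f' j) \<in> J" for j
  proof -
    have "gradsum (f \<oplus>\<^bsub>F\<^esub> f') j - (gradsum f j + gradsum f' j) =
      (\<Sum>a\<in>?S. (lift (f a \<oplus> f' a) - (lift (f a) + lift (f' a))) * pdiff j (lift a))"
      using gradsum_superset[OF fin supp, of j] gradsum_superset[OF fin, of f j]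
        gradsum_superset[OF fin, of f' j]
      by (simp add: sum_subtractf sum.distrib algebra_simps)
    also have "\<dots> \<in> J"
    proof (rule J_sum)
      fix a assume "a \<in> ?S"
      then have a: "a \<in> carrier A" "f a \<in> carrier A" "f' a \<in> carrier A"
        using sub free_module_coeff[OF is_cring assms(1)] free_module_coeff[OF is_cring assms(2)]
        by blast+
      then have "lift (f a \<oplus> f' a) - (lift (f a) + lift (f' a)) \<in> J"
        by (simp add: pi_eq_iff[symmetric] lift)
      then show "(lift (f a \<oplus> f' a) - (lift (f a) + lift (f' a))) * pdiff j (lift a) \<in> J"
        using a by (intro J_mult') (simp_all add: lift)
    qed
    finally show ?thesis .
  qed
  then have "(\<lambda>j. (gradsum (f \<oplus>\<^bsub>F\<^esub> f') j - (gradsum f j + gradsum f' j)) +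
      ((gradsum f j - g j) + (gradsum f' j - g' j))) \<in> U"
    by (rule U_add[OF J_U U_add[OF assms(3,4)[unfolded represents_def]]])
  then show ?thesis
    unfolding represents_def by (simp add: algebra_simps)
qed

lemma represents_smult:
  assumes "p \<in> P" "f \<in> carrier F" "represents f g"
  shows "represents (\<pi> p \<odot>\<^bsub>F\<^esub> f) (\<lambda>j. p * g j)"
proof -
  let ?S = "{a. f a \<noteq> \<zero>}"
  have fin: "finite ?S"
    using assms by (simp add: carrier_free_module)
  have sub: "?S \<subseteq> carrier A"
    using assms by (auto simp: carrier_free_module)
  have supp: "{a. (\<pi> p \<odot>\<^bsub>F\<^esub> f) a \<noteq> \<zero>} \<subseteq> ?S"
    using assms by auto
  have "gradsum (\<pi> p \<odot>\<^bsub>F\<^esub> f) j - p * gradsum f j \<in> J" for j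
  proof -
    have "gradsum (\<pi> p \<odot>\<^bsub>F\<^esub> f) j - p * gradsum f j =
      (\<Sum>a\<in>?S. (lift (\<pi> p \<otimes> f a) - p * lift (f a)) * pdiff j (lift a))"
      using gradsum_superset[OF fin supp, of j] gradsum_superset[OF fin, of f j]
      by (simp add: sum_subtractf sum_distrib_left algebra_simps)
    also have "\<dots> \<in> J"
    proof (rule J_sum)
      fix a assume "a \<in> ?S"
      then have a: "a \<in> carrier A" "f a \<in> carrier A"
        using sub free_module_coeff[OF is_cring assms(2)] by blast+
      then have "lift (\<pi> p \<otimes> f a) - p * lift (f a) \<in> J"
        using assms by (simp add: pi_eq_iff[symmetric] lift)
      then show "(lift (\<pi> p \<otimes> f a) - p * lift (f a)) * pdiff j (lift a) \<in> J"
        using a by (intro J_mult') (simp_all add: lift)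
    qed
    finally show ?thesis .
  qed
  then have "(\<lambda>j. (gradsum (\<pi> p \<odot>\<^bsub>F\<^esub> f) j - p * gradsum f j) + p * (gradsum f j - g j)) \<in> U"
    by (rule U_add[OF J_U U_smult[OF assms(1) assms(3)[unfolded represents_def]]])
  then show ?thesis
    unfolding represents_def by (simp add: algebra_simps)
qed

text \<open>Two choices enter: \<open>lift \<one>\<close> differs from \<open>1\<close>, and
  \<open>lift (\<pi> p)\<close> from \<open>p\<close>, by elements of \<open>J\<close>. The first
  error gives a vector over \<open>J\<close>, the second the gradient of an element of
  \<open>J\<close>, which is why gradients have to be in \<open>U\<close>.\<close>

lemma represents_gen:
  assumes "p \<in> P"
  shows "represents (\<delta> (\<pi> p)) (\<lambda>j. pdiff j p)"
proof -
  have l: "lift (\<pi> p) - p \<in> J"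
    using assms by (simp add: pi_eq_iff[symmetric] lift)
  have eq: "gradsum (\<delta> (\<pi> p)) j = lift \<one> * pdiff j (lift (\<pi> p))" for j
    by (subst gradsum_superset[of "{\<pi> p}"]) (auto simp: free_gen_def)
  have "lift \<one> - 1 \<in> J"
    by (simp add: pi_eq_iff[symmetric] lift)
  then have "(\<lambda>j. (lift \<one> - 1) * pdiff j (lift (\<pi> p)) + pdiff j (lift (\<pi> p) - p)) \<in> U"
    using assms by (intro U_add J_U pdiff_J_U l J_mult') (simp_all add: lift)
  then show ?thesis
    unfolding represents_def eq by (simp add: pdiff_minus algebra_simps)
qed

lemma represents_minus:
  assumes "f \<in> carrier F" "f' \<in> carrier F" "represents f g" "represents f' g'"
  shows "represents (f \<ominus>\<^bsub>F\<^esub> f') (\<lambda>j. g j - g' j)"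
proof -
  have "\<ominus>\<^bsub>F\<^esub> f' = \<pi> (- 1) \<odot>\<^bsub>F\<^esub> f'"
    using assms F.smult_l_minus[of \<one> f'] by (simp del: free_module_simps)
  then have "f \<ominus>\<^bsub>F\<^esub> f' = f \<oplus>\<^bsub>F\<^esub> \<pi> (- 1) \<odot>\<^bsub>F\<^esub> f'"
    by (simp only: a_minus_def)
  moreover have "represents (f \<oplus>\<^bsub>F\<^esub> \<pi> (- 1) \<odot>\<^bsub>F\<^esub> f') (\<lambda>j. g j + (- 1) * g' j)"
    using assms by (intro represents_add represents_smult F.smult_closed) auto
  ultimately show ?thesis
    by simp
qed

text \<open>With polynomial representatives, each defining relation is represented by the defect of
  additivity, by that of the Leibniz rule, or by the gradient of a constant, and all of these are
  \<open>0\<close> already in \<open>P\<close>.\<close>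

lemma rels_gradsum:
  assumes "f \<in> kaehler_rels \<phi> A"
  shows "gradsum f \<in> U"
proof -
  have *: "gradsum f \<in> U" if "represents f g" "g = (\<lambda>j. 0)" for g
    using that by (simp add: represents_def)
  have lifts: "\<exists>p\<in>P. a = \<pi> p" if "a \<in> carrier A" for a
    using that surj by blast
  consider
    a b where "a \<in> carrier A" "b \<in> carrier A" "f = \<delta> (a \<oplus> b) \<ominus>\<^bsub>F\<^esub> (\<delta> a \<oplus>\<^bsub>F\<^esub> \<delta> b)"
    | a b where "a \<in> carrier A" "b \<in> carrier A"
      "f = \<delta> (a \<otimes> b) \<ominus>\<^bsub>F\<^esub> (a \<odot>\<^bsub>F\<^esub> \<delta> b \<oplus>\<^bsub>F\<^esub> b \<odot>\<^bsub>F\<^esub> \<delta> a)"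
    | c where "f = \<delta> (\<phi> c)"
    using assms unfolding kaehler_rels_def Let_def by blast
  then show ?thesis
  proof cases
    case 1
    then obtain p q where p: "p \<in> P" "a = \<pi> p" and q: "q \<in> P" "b = \<pi> q"
      using lifts by metis
    have f: "f = \<delta> (\<pi> (p + q)) \<ominus>\<^bsub>F\<^esub> (\<delta> (\<pi> p) \<oplus>\<^bsub>F\<^esub> \<delta> (\<pi> q))"
      using 1 p q by (simp only: pi_add)
    have "represents f (\<lambda>j. pdiff j (p + q) - (pdiff j p + pdiff j q))"
      unfolding f using p q
      by (intro represents_minus represents_add represents_gen gen_closed pi_closed
          F.M.add.m_closed poly_ring_closed)
    then show ?thesis
      by (rule *) (simp add: pdiff_add)
  next
    case 2
    then obtain p q where p: "p \<in> P" "a = \<pi> p" and q: "q \<in> P" "b = \<pi> q"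
      using lifts by metis
    have f: "f = \<delta> (\<pi> (p * q)) \<ominus>\<^bsub>F\<^esub> (\<pi> p \<odot>\<^bsub>F\<^esub> \<delta> (\<pi> q) \<oplus>\<^bsub>F\<^esub> \<pi> q \<odot>\<^bsub>F\<^esub> \<delta> (\<pi> p))"
      using 2 p q by (simp only: pi_mult)
    have "represents f (\<lambda>j. pdiff j (p * q) - (p * pdiff j q + q * pdiff j p))"
      unfolding f using p q
      by (intro represents_minus represents_add represents_smult represents_gen gen_closed pi_closed
          F.M.add.m_closed F.smult_closed poly_ring_closed)
    then show ?thesis
      by (rule *) (simp add: pdiff_mult)
  next
    case 3
    have "represents f (\<lambda>j. pdiff j (const c))"
      unfolding 3 by (intro represents_gen poly_ring_closed)
    then show ?thesis
      by (rule *) simp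
  qed
qed

text \<open>The functions whose gradient sum lies in \<open>U\<close> form a submodule containing
  the defining relations, hence it contains their span.\<close>

lemma N_gradsum:
  assumes "f \<in> N"
  shows "gradsum f \<in> U"
proof -
  let ?N = "{f \<in> carrier F. gradsum f \<in> U}"
  have rep: "represents f (\<lambda>j. 0) \<longleftrightarrow> gradsum f \<in> U" for f
    by (simp add: represents_def)
  have "LinearCombinations.submodule A ?N F"
  proof (rule LinearCombinations.submodule.intro[OF F_module])
    show "f \<oplus>\<^bsub>F\<^esub> g \<in> ?N" if "f \<in> ?N" "g \<in> ?N" for f g
      using that represents_add[of f g "\<lambda>j. 0" "\<lambda>j. 0"] F.M.add.m_closed[of f g]
      by (simp add: rep del: free_module_simps)
    show "a \<odot>\<^bsub>F\<^esub> f \<in> ?N" if "a \<in> carrier A" "f \<in> ?N" for a f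
      using that represents_smult[of "lift a" f "\<lambda>j. 0"] F.smult_closed[of a f]
      by (simp add: rep lift del: free_module_simps)
    show "\<zero>\<^bsub>F\<^esub> \<in> ?N"
      using J_0 F.M.zero_closed by (auto simp: gradsum_def intro!: J_U)
  qed auto
  moreover have "kaehler_rels \<phi> A \<subseteq> ?N"
    using rels_gradsum rels_closed by blast
  ultimately have "N \<subseteq> ?N"
    unfolding kaehler_sub_def by (intro F.span_is_subset)
  then show ?thesis
    using assms by blast
qed

text \<open>The relation is carried over to differentials through some preimage in the free module.
  That another preimage changes \<open>g\<close> only by \<open>U\<close> rests on
  \<open>N_gradsum\<close>.\<close>

definition "Represents w g \<longleftrightarrow> (\<exists>f\<in>carrier F. w = cls f \<and> represents f g)"

lemma RepresentsI: "f \<in> carrier F \<Longrightarrow> represents f g \<Longrightarrow> Represents (cls f) g"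
  unfolding Represents_def by blast

lemma RepresentsE:
  assumes "Represents w g"
  obtains f where "f \<in> carrier F" "w = cls f" "represents f g"
  using assms unfolding Represents_def by blast

lemma Represents_add:
  assumes "Represents v g" "Represents w h"
  shows "Represents (v \<oplus>\<^bsub>\<Omega>\<^esub> w) (\<lambda>j. g j + h j)"
proof -
  obtain f where f: "f \<in> carrier F" "v = cls f" "represents f g"
    by (rule RepresentsE[OF assms(1)])
  obtain f' where f': "f' \<in> carrier F" "w = cls f'" "represents f' h"
    by (rule RepresentsE[OF assms(2)])
  show ?thesis
    unfolding f(2) f'(2) cls_add[OF f(1) f'(1), symmetric]
    by (rule RepresentsI[OF F.M.add.m_closed[OF f(1) f'(1)] represents_add[OF f(1) f'(1) f(3) f'(3)]])
qed

lemma Represents_smult: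
  assumes "p \<in> P" "Represents w g"
  shows "Represents (\<pi> p \<odot>\<^bsub>\<Omega>\<^esub> w) (\<lambda>j. p * g j)"
proof -
  obtain f where f: "f \<in> carrier F" "w = cls f" "represents f g"
    by (rule RepresentsE[OF assms(2)])
  show ?thesis
    unfolding f(2) cls_smult[OF pi_closed[OF assms(1)] f(1), symmetric]
    by (rule RepresentsI[OF F.smult_closed[OF pi_closed[OF assms(1)] f(1)]
          represents_smult[OF assms(1) f(1) f(3)]])
qed

lemma Represents_d: "p \<in> P \<Longrightarrow> Represents (d (\<pi> p)) (\<lambda>j. pdiff j p)"
  unfolding d_cls by (rule RepresentsI[OF gen_closed[OF pi_closed] represents_gen])

lemma Represents_zero:
  assumes "Represents \<zero>\<^bsub>\<Omega>\<^esub> g"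
  shows "g \<in> U"
proof -
  obtain f where f: "f \<in> carrier F" "\<zero>\<^bsub>\<Omega>\<^esub> = cls f" and r: "represents f g"
    by (rule RepresentsE[OF assms])
  then have "gradsum f \<in> U"
    using cls_eq_zero_iff[OF f(1)] N_gradsum by simp
  then have "(\<lambda>j. gradsum f j - (gradsum f j - g j)) \<in> U"
    by (rule U_minus[OF _ r[unfolded represents_def]])
  then show ?thesis
    by simp
qed

text \<open>Summed up from the single terms \<open>g_j dx_j\<close>. The entries beyond
  \<open>n\<close> come out as \<open>0\<close>, since the gradients of \<open>X_0, ..., X_n\<close>
  vanish there.\<close>

lemma Represents_theta:
  assumes "g \<in> Pvec"
  shows "Represents (\<theta> g) (\<lambda>j. if j \<le> n then g j else 0)"
proof -
  have "Represents (\<Oplus>\<^bsub>\<Omega>\<^esub> j\<in>S. \<pi> (g j) \<odot>\<^bsub>\<Omega>\<^esub> d (\<pi> (var j))) (\<lambda>i. \<Sum>j\<in>S. g j * pdiff i (var j))"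
    if "finite S" "S \<subseteq> {..n}" for S
    using that
  proof (induction S rule: finite_induct)
    case empty
    have "Represents (\<pi> 0 \<odot>\<^bsub>\<Omega>\<^esub> d (\<pi> 0)) (\<lambda>j. 0 * pdiff j 0)"
      by (intro Represents_smult Represents_d poly_ring_closed)
    then show ?case
      by simp
  next
    case (insert j S)
    have "(\<Oplus>\<^bsub>\<Omega>\<^esub> j\<in>insert j S. \<pi> (g j) \<odot>\<^bsub>\<Omega>\<^esub> d (\<pi> (var j))) =
        \<pi> (g j) \<odot>\<^bsub>\<Omega>\<^esub> d (\<pi> (var j)) \<oplus>\<^bsub>\<Omega>\<^esub> (\<Oplus>\<^bsub>\<Omega>\<^esub> j\<in>S. \<pi> (g j) \<odot>\<^bsub>\<Omega>\<^esub> d (\<pi> (var j)))"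
      using insert.hyps insert.prems theta_term_closed[OF assms]
      by (intro Omega.M.finsum_insert) (auto simp: Pi_iff)
    moreover have "Represents \<dots> (\<lambda>i. g j * pdiff i (var j) + (\<Sum>j\<in>S. g j * pdiff i (var j)))"
      using insert PvecD[OF assms] by (intro Represents_add Represents_smult Represents_d) auto
    ultimately show ?case
      using insert.hyps by simp
  qed
  from this[of "{..n}"] have "Represents (\<theta> g) (\<lambda>i. \<Sum>j\<le>n. g j * pdiff i (var j))"
    by (simp add: \<theta>_def)
  moreover have "(\<Sum>j\<le>n. g j * pdiff i (var j)) = (if i \<le> n then g i else 0)" for i
    by (simp add: pdiff_var if_distrib cong: if_cong)
  ultimately show ?thesis
    by simp
qed

text \<open>If the differential is zero, then \<open>g\<close> itself, cut off beyond
  \<open>n\<close>, is a vector representing zero and so lies in \<open>U\<close>.\<close>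

lemma theta_eq_zero_iff:
  assumes "g \<in> Pvec"
  shows "\<theta> g = \<zero>\<^bsub>\<Omega>\<^esub> \<longleftrightarrow> g \<in> U"
proof
  assume "\<theta> g = \<zero>\<^bsub>\<Omega>\<^esub>"
  then have "(\<lambda>j. if j \<le> n then g j else 0) \<in> U"
    using Represents_theta[OF assms] Represents_zero by simp
  then obtain f where "f \<in> J" "f \<in> P" "\<And>j. j \<le> n \<Longrightarrow> (if j \<le> n then g j else 0) - pdiff j f \<in> J"
    by (rule UE) (rule that)
  then show "g \<in> U"
    using assms by (intro UI[of f]) simp_all
qed (rule theta_U)

lemma theta_eq_iff:
  assumes "g \<in> Pvec" "h \<in> Pvec"
  shows "\<theta> g = \<theta> h \<longleftrightarrow> (\<lambda>j. g j - h j) \<in> U"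
proof -
  have eq: "\<theta> g = \<theta> (\<lambda>j. g j - h j) \<oplus>\<^bsub>\<Omega>\<^esub> \<theta> h"
    using theta_add[OF Pvec_minus[OF assms] assms(2)] by simp
  have "\<theta> g = \<theta> h \<longleftrightarrow> \<theta> (\<lambda>j. g j - h j) = \<zero>\<^bsub>\<Omega>\<^esub>"
    using Omega.M.add.right_cancel[OF theta_closed[OF assms(2)]
        theta_closed[OF Pvec_minus[OF assms]] Omega.M.zero_closed]
    by (simp add: eq[symmetric] theta_closed[OF assms(2)])
  then show ?thesis
    using theta_eq_zero_iff[OF Pvec_minus[OF assms]] by simp
qed

end

section \<open>Homogeneous ideals\<close>

lemma poly_ideal_iff:
  "ideal L (poly_ring n) \<longleftrightarrow> L \<subseteq> carrier (poly_ring n) \<and> 0 \<in> L \<and> (\<forall>p\<in>L. \<forall>q\<in>L. p + q \<in> L) \<and>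
    (\<forall>p\<in>carrier (poly_ring n). \<forall>q\<in>L. p * q \<in> L)" (is "_ \<longleftrightarrow> ?R")
proof
  assume "ideal L (poly_ring n)"
  then interpret ideal L "poly_ring n" .
  show ?R
    using a_subset a_closed I_l_closed zero_closed by auto
next
  assume R: ?R
  have m: "- p \<in> L" if "p \<in> L" for p
  proof -
    have "(- 1) * p \<in> L"
      using R that poly_ring_closed(7)[OF poly_ring_closed(2)] by blast
    then show ?thesis
      by simp
  qed
  show "ideal L (poly_ring n)"
  proof (rule idealI)
    show "ring (poly_ring n)"
      by (rule P.ring_axioms)
    show "subgroup L (add_monoid (poly_ring n))"
    proof (rule subgroup.intro)
      show "inv\<^bsub>add_monoid (poly_ring n)\<^esub> x \<in> L" if "x \<in> L" for x
      proof -
        have "x \<in> carrier (poly_ring n)"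
          using R that by blast
        then show ?thesis
          using m[OF that] poly_ring_a_inv[of x n] by (simp add: a_inv_def)
      qed
    qed (use R in auto)
    show "x \<otimes>\<^bsub>poly_ring n\<^esub> a \<in> L" if "a \<in> L" "x \<in> carrier (poly_ring n)" for a x
      using that R by simp
    show "a \<otimes>\<^bsub>poly_ring n\<^esub> x \<in> L" if "a \<in> L" "x \<in> carrier (poly_ring n)" for a x
    proof -
      have "x * a \<in> L"
        using that R by blast
      then show ?thesis
        by (simp add: mult.commute[of a x])
    qed
  qed
qed

lemma homogeneous_ideal_iff:
  "homogeneous_ideal n L \<longleftrightarrow> L \<subseteq> carrier (poly_ring n) \<and> 0 \<in> L \<and> (\<forall>p\<in>L. \<forall>q\<in>L. p + q \<in> L) \<and>
    (\<forall>p\<in>carrier (poly_ring n). \<forall>q\<in>L. p * q \<in> L) \<and> (\<forall>f\<in>L. \<forall>d. hom_comp d f \<in> L)"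
  by (simp add: homogeneous_ideal_def poly_ideal_iff)

lemma hom_comp_beyond:
  assumes "\<forall>m\<in>Poly_Mapping.keys p. mon_deg m \<le> N" "k > N"
  shows "hom_comp k p = 0"
proof -
  have "Poly_Mapping.keys (hom_comp k p) = {}"
    unfolding keys_hom_comp using assms by fastforce
  then show ?thesis
    by (metis poly_mapping_eqI in_keys_iff lookup_zero empty_iff)
qed

lemma hom_comp_mult_homog:
  assumes "a \<in> homog_polys n e" "p \<in> carrier (poly_ring n)"
  shows "hom_comp d (a * p) = (if e \<le> d then a * hom_comp (d - e) p else 0)"
proof -
  obtain N where N: "\<forall>m\<in>Poly_Mapping.keys p. mon_deg m \<le> N"
    using deg_bound by blast
  \<comment> \<open>The range must contain the index \<open>d - e\<close> even where it exceeds the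
    degree of \<open>p\<close>.\<close>
  let ?N = "N + d"
  have "(\<Sum>k\<le>?N. hom_comp k p) = p"
    using N by (intro sum_hom_comp) auto
  then have "hom_comp d (a * p) = hom_comp d (a * (\<Sum>k\<le>?N. hom_comp k p))"
    by simp
  also have "\<dots> = (\<Sum>k\<le>?N. hom_comp d (a * hom_comp k p))"
    by (simp only: hom_comp_sum sum_distrib_left)
  also have "\<dots> = (\<Sum>k\<le>?N. if d = e + k then a * hom_comp k p else 0)"
    using assms by (intro sum.cong refl hom_comp_homog homog_mult hom_comp_in_homog)
  also have "\<dots> = (\<Sum>k\<le>?N. if k = d - e then (if e \<le> d then a * hom_comp (d - e) p else 0) else 0)"
    by (intro sum.cong refl) auto
  also have "\<dots> = (if e \<le> d then a * hom_comp (d - e) p else 0)"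
    using le_trans[OF diff_le_self le_add2, of d e N] by simp
  finally show ?thesis .
qed

text \<open>Kept free of saturation and of conditions on the support, because it is also
  instantiated with \<open>I + (X0)\<close> and with an ideal produced by Zorn's lemma.\<close>

locale homog_ideal =
  fixes n :: nat and I :: "'k::field mpol set"
  assumes homogeneous: "homogeneous_ideal n I"
begin

abbreviation "P \<equiv> carrier (poly_ring n) :: 'k mpol set"
abbreviation "H d \<equiv> homog_polys n d :: 'k mpol set"

lemma I_P: "f \<in> I \<Longrightarrow> f \<in> P"
  using homogeneous unfolding homogeneous_ideal_iff by blast

lemma I_0: "0 \<in> I"
  using homogeneous unfolding homogeneous_ideal_iff by blast

lemma I_add: "f \<in> I \<Longrightarrow> g \<in> I \<Longrightarrow> f + g \<in> I"
  using homogeneous unfolding homogeneous_ideal_iff by blast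

lemma I_mult: "p \<in> P \<Longrightarrow> f \<in> I \<Longrightarrow> p * f \<in> I"
  using homogeneous unfolding homogeneous_ideal_iff by blast

lemma I_mult': "p \<in> P \<Longrightarrow> f \<in> I \<Longrightarrow> f * p \<in> I"
  using I_mult[of p f] by (simp add: mult.commute)

lemma I_uminus: "f \<in> I \<Longrightarrow> - f \<in> I"
  using I_mult[of "- 1" f] by simp

lemma I_minus: "f \<in> I \<Longrightarrow> g \<in> I \<Longrightarrow> f - g \<in> I"
  using I_add[of f "- g"] I_uminus[of g] by simp

lemma I_sum: "(\<And>i. i \<in> S \<Longrightarrow> f i \<in> I) \<Longrightarrow> sum f S \<in> I"
  by (induction S rule: infinite_finite_induct) (simp_all add: I_0 I_add)

lemma I_hom_comp: "f \<in> I \<Longrightarrow> hom_comp d f \<in> I"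
  using homogeneous unfolding homogeneous_ideal_iff by blast

lemma hom_comps_in_I:
  assumes "\<And>d. hom_comp d f \<in> I"
  shows "f \<in> I"
proof -
  obtain N where "\<forall>m\<in>Poly_Mapping.keys f. mon_deg m \<le> N"
    using deg_bound by blast
  then have "(\<Sum>d\<le>N. hom_comp d f) = f"
    by (rule sum_hom_comp)
  then show ?thesis
    using I_sum[of "{..N}" "\<lambda>d. hom_comp d f"] assms by simp
qed

text \<open>The component of degree \<open>d\<close> of \<open>q + a * p\<close> is that of
  \<open>q\<close> plus \<open>a\<close> times the component of \<open>p\<close> of degree
  \<open>d - e\<close>, again of this form. Serves to form \<open>I + (X0)\<close> and to enlarge a
  maximal ideal by a homogeneous element.\<close>

lemma homogeneous_ideal_adjoin:
  assumes a: "a \<in> H e"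
  shows "homogeneous_ideal n {q + a * p | q p. q \<in> I \<and> p \<in> P}" (is "homogeneous_ideal n ?L")
  unfolding homogeneous_ideal_iff
proof (intro conjI ballI allI)
  have aP: "a \<in> P"
    by (rule homog_closed[OF a])
  have mem: "q + a * p \<in> ?L" if "q \<in> I" "p \<in> P" for q p
    using that by blast
  show "?L \<subseteq> P"
    using I_P aP by auto
  show "0 \<in> ?L"
    using I_0 by (intro CollectI exI[of _ 0]) simp
  fix f assume "f \<in> ?L"
  then obtain q p where f: "f = q + a * p" "q \<in> I" "p \<in> P"
    by blast
  show "f + g \<in> ?L" if g': "g \<in> ?L" for g
  proof -
    obtain q' p' where g: "g = q' + a * p'" "q' \<in> I" "p' \<in> P"
      using g' by blast
    have "f + g = (q + q') + a * (p + p')"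
      by (simp add: f g algebra_simps)
    also have "\<dots> \<in> ?L"
      using f(2,3) g(2,3) by (intro mem I_add poly_ring_closed)
    finally show ?thesis .
  qed
  show "h * f \<in> ?L" if "h \<in> P" for h
  proof -
    have "h * f = h * q + a * (h * p)"
      by (simp add: f algebra_simps)
    also have "\<dots> \<in> ?L"
      using f(2,3) that by (intro mem I_mult poly_ring_closed)
    finally show ?thesis .
  qed
  show "hom_comp d f \<in> ?L" for d
  proof -
    have "hom_comp d f = hom_comp d q + a * (if e \<le> d then hom_comp (d - e) p else 0)"
      by (simp add: f hom_comp_add hom_comp_mult_homog[OF a f(3)])
    also have "\<dots> \<in> ?L"
      using homog_closed[OF hom_comp_in_homog[OF f(3)]]
      by (intro mem I_hom_comp[OF f(2)]) simp
    finally show ?thesis .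
  qed
qed

text \<open>If \<open>f\<close> and \<open>g\<close> are outside \<open>I\<close> but their product
  is not, then the product of their highest components outside \<open>I\<close> lies in
  \<open>I\<close> as well, against the assumption on homogeneous elements.\<close>

lemma prime_from_homogeneous:
  assumes one: "1 \<notin> I"
    and prime: "\<And>a b d e. a \<in> H d \<Longrightarrow> b \<in> H e \<Longrightarrow> a * b \<in> I \<Longrightarrow> a \<in> I \<or> b \<in> I"
  shows "primeideal I (poly_ring n)"
proof (rule primeidealI)
  show "ideal I (poly_ring n)"
    using homogeneous by (simp add: homogeneous_ideal_def)
  show "cring (poly_ring n)"
    by (rule cring_poly_ring)
  show "carrier (poly_ring n) \<noteq> I"
    using one by auto
  fix f g assume f: "f \<in> P" and g: "g \<in> P" and "f \<otimes>\<^bsub>poly_ring n\<^esub> g \<in> I"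
  then have fg: "f * g \<in> I"
    by simp
  show "f \<in> I \<or> g \<in> I"
  proof (rule ccontr)
    assume "\<not> (f \<in> I \<or> g \<in> I)"
    then obtain d0 e0 where d0: "hom_comp d0 f \<notin> I" and e0: "hom_comp e0 g \<notin> I"
      using hom_comps_in_I by blast
    obtain N where N: "\<forall>m\<in>Poly_Mapping.keys f. mon_deg m \<le> N"
      using deg_bound by blast
    obtain M where M: "\<forall>m\<in>Poly_Mapping.keys g. mon_deg m \<le> M"
      using deg_bound by blast
    \<comment> \<open>The highest degree with component outside \<open>I\<close>, not the degree of
      \<open>f\<close>; it exists because the components beyond \<open>N\<close> are zero.\<close>
    define d where "d = (GREATEST k. hom_comp k f \<notin> I)"
    define e where "e = (GREATEST k. hom_comp k g \<notin> I)"
    have bf: "k \<le> N" if "hom_comp k f \<notin> I" for k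
      using that hom_comp_beyond[OF N, of k] I_0 by (metis not_le)
    have bg: "k \<le> M" if "hom_comp k g \<notin> I" for k
      using that hom_comp_beyond[OF M, of k] I_0 by (metis not_le)
    have d: "hom_comp d f \<notin> I"
      unfolding d_def using d0 bf by (rule GreatestI_nat)
    have e: "hom_comp e g \<notin> I"
      unfolding e_def using e0 bg by (rule GreatestI_nat)
    have df: "hom_comp k f \<in> I" if "k > d" for k
      using that Greatest_le_nat[of "\<lambda>k. hom_comp k f \<notin> I" k N] bf unfolding d_def by (metis not_le)
    have eg: "hom_comp k g \<in> I" if "k > e" for k
      using that Greatest_le_nat[of "\<lambda>k. hom_comp k g \<notin> I" k M] bg unfolding e_def by (metis not_le)
    \<comment> \<open>Cutting off the components above \<open>d\<close> and \<open>e\<close>, which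
      lie in \<open>I\<close>, leaves factors whose product has a single term in degree
      \<open>d + e\<close>.\<close>
    define f' where "f' = (\<Sum>k\<le>d. hom_comp k f)"
    define g' where "g' = (\<Sum>k\<le>e. hom_comp k g)"
    have "f = (\<Sum>k\<le>N. hom_comp k f)"
      by (rule sum_hom_comp[OF N, symmetric])
    also have "\<dots> = f' + (\<Sum>k\<in>{..N} - {..d}. hom_comp k f)"
      using bf[OF d] sum.subset_diff[of "{..d}" "{..N}" "\<lambda>k. hom_comp k f"]
      unfolding f'_def by (simp add: add.commute)
    finally have "f - f' = (\<Sum>k\<in>{..N} - {..d}. hom_comp k f)"
      by (metis add_diff_cancel_left')
    moreover have "(\<Sum>k\<in>{..N} - {..d}. hom_comp k f) \<in> I"
      by (rule I_sum) (simp add: df)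
    ultimately have ff: "f - f' \<in> I"
      by simp
    have "g = (\<Sum>k\<le>M. hom_comp k g)"
      by (rule sum_hom_comp[OF M, symmetric])
    also have "\<dots> = g' + (\<Sum>k\<in>{..M} - {..e}. hom_comp k g)"
      using bg[OF e] sum.subset_diff[of "{..e}" "{..M}" "\<lambda>k. hom_comp k g"]
      unfolding g'_def by (simp add: add.commute)
    finally have "g - g' = (\<Sum>k\<in>{..M} - {..e}. hom_comp k g)"
      by (metis add_diff_cancel_left')
    moreover have "(\<Sum>k\<in>{..M} - {..e}. hom_comp k g) \<in> I"
      by (rule I_sum) (simp add: eg)
    ultimately have gg: "g - g' \<in> I"
      by simp
    have f'P: "f' \<in> P"
      unfolding f'_def by (rule poly_ring_sum_closed) (rule homog_closed[OF hom_comp_in_homog[OF f]])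
    have "f' * g' = f * g - (g * (f - f') + f' * (g - g'))"
      by (simp add: algebra_simps)
    then have "f' * g' \<in> I"
      using I_minus[OF fg I_add[OF I_mult[OF g ff] I_mult[OF f'P gg]]] by simp
    then have "hom_comp (d + e) (f' * g') \<in> I"
      by (rule I_hom_comp)
    also have "hom_comp (d + e) (f' * g') =
        (\<Sum>k\<le>d. \<Sum>l\<le>e. hom_comp (d + e) (hom_comp k f * hom_comp l g))"
      unfolding f'_def g'_def sum_product by (simp add: hom_comp_sum)
    also have "\<dots> = (\<Sum>k\<le>d. \<Sum>l\<le>e. if l = e then (if k = d then hom_comp d f * hom_comp e g else 0) else 0)"
    proof (intro sum.cong refl)
      fix k l assume "k \<in> {..d}" "l \<in> {..e}"
      moreover have "hom_comp k f * hom_comp l g \<in> H (k + l)"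
        using f g by (intro homog_mult hom_comp_in_homog)
      ultimately show "hom_comp (d + e) (hom_comp k f * hom_comp l g) =
          (if l = e then (if k = d then hom_comp d f * hom_comp e g else 0) else 0)"
        by (auto simp: hom_comp_homog)
    qed
    also have "\<dots> = hom_comp d f * hom_comp e g"
      by simp
    finally show False
      using prime[of "hom_comp d f" d "hom_comp e g" e] d e f g by (simp add: hom_comp_in_homog)
  qed
qed

text \<open>Maximality is taken among homogeneous ideals only, so it speaks about adjoining
  homogeneous elements; this is enough by \<open>prime_from_homogeneous\<close>.\<close>

lemma exists_homogeneous_prime:
  assumes j: "j \<le> n" and pow: "\<And>N. var j ^ N \<notin> I"
  shows "\<exists>p. primeideal p (poly_ring n) \<and> homogeneous_ideal n p \<and> I \<subseteq> p \<and> var j \<notin> p"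
proof -
  define S where "S = {L. homogeneous_ideal n L \<and> I \<subseteq> L \<and> (\<forall>N. var j ^ N \<notin> L)}"
  have "\<exists>M\<in>S. \<forall>Y\<in>S. M \<subseteq> Y \<longrightarrow> Y = M"
  proof (rule subset_Zorn_nonempty)
    show "S \<noteq> {}"
      using homogeneous pow by (auto simp: S_def)
    fix C assume C: "C \<noteq> {}" "subset.chain S C"
    then have CS: "L \<in> S" if "L \<in> C" for L
      using that by (auto simp: subset_chain_def)
    then have hom: "homogeneous_ideal n L" if "L \<in> C" for L
      using that by (auto simp: S_def)
    have "homogeneous_ideal n (\<Union>C)"
      unfolding homogeneous_ideal_iff
    proof (intro conjI ballI allI)
      show "\<Union>C \<subseteq> P"
        using hom unfolding homogeneous_ideal_iff by blast
      show "0 \<in> \<Union>C"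
        using hom C(1) unfolding homogeneous_ideal_iff by blast
      fix f assume "f \<in> \<Union>C"
      then obtain L where L: "L \<in> C" "f \<in> L"
        by blast
      show "p * f \<in> \<Union>C" if "p \<in> P" for p
        using L hom[OF L(1)] that unfolding homogeneous_ideal_iff by blast
      show "hom_comp d f \<in> \<Union>C" for d
        using L hom[OF L(1)] unfolding homogeneous_ideal_iff by blast
      show "f + g \<in> \<Union>C" if g: "g \<in> \<Union>C" for g
      proof -
        obtain L' where L': "L' \<in> C" "g \<in> L'"
          using g by blast
        have "L \<subseteq> L' \<or> L' \<subseteq> L"
          using C(2) L(1) L'(1) by (auto simp: subset_chain_def)
        then obtain L'' where "L'' \<in> C" "f \<in> L''" "g \<in> L''"
          using L L' by blast
        then show ?thesis
          using hom[of L''] unfolding homogeneous_ideal_iff by blast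
      qed
    qed
    moreover have "I \<subseteq> \<Union>C"
      using C(1) CS unfolding S_def by blast
    ultimately show "\<Union>C \<in> S"
      using CS unfolding S_def by blast
  qed
  then obtain M where MS: "M \<in> S" and max: "\<forall>Y\<in>S. M \<subseteq> Y \<longrightarrow> Y = M"
    by (rule bexE)
  have M: "homogeneous_ideal n M" "I \<subseteq> M" "\<And>N. var j ^ N \<notin> M"
    using MS by (simp_all add: S_def)
  interpret M: homog_ideal n M
    by unfold_locales (rule M(1))
  \<comment> \<open>By maximality, \<open>M\<close> enlarged by \<open>a\<close> contains a power of
    \<open>X_j\<close>.\<close>
  have adjoin: "\<exists>N q p. var j ^ N = q + a * p \<and> q \<in> M \<and> p \<in> P" if a: "a \<in> H d" "a \<notin> M" for a d
  proof (rule ccontr)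
    assume *: "\<nexists>N q p. var j ^ N = q + a * p \<and> q \<in> M \<and> p \<in> P"
    let ?L = "{q + a * p | q p. q \<in> M \<and> p \<in> P}"
    have sub: "M \<subseteq> ?L"
    proof
      fix q assume "q \<in> M"
      then show "q \<in> ?L"
        by (intro CollectI exI[of _ q] exI[of _ 0]) simp
    qed
    have "?L \<in> S"
      unfolding S_def using M.homogeneous_ideal_adjoin[OF a(1)] sub M(2) * by blast
    then have "?L = M"
      using sub max by simp
    moreover have "a \<in> ?L"
      using M.I_0 by (intro CollectI exI[of _ 0] exI[of _ 1]) simp
    ultimately show False
      using a by simp
  qed
  have "primeideal M (poly_ring n)"
  proof (rule M.prime_from_homogeneous)
    \<comment> \<open>The power with exponent \<open>0\<close> is avoided too, which keeps
      \<open>M\<close> proper.\<close>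
    show "1 \<notin> M"
      using M(3)[of 0] by simp
    fix a b d e assume a: "a \<in> H d" and b: "b \<in> H e" and ab: "a * b \<in> M"
    show "a \<in> M \<or> b \<in> M"
    proof (rule ccontr)
      assume *: "\<not> (a \<in> M \<or> b \<in> M)"
      obtain N q p where 1: "var j ^ N = q + a * p" "q \<in> M" "p \<in> P"
        using adjoin[OF a] * by blast
      obtain N' q' p' where 2: "var j ^ N' = q' + b * p'" "q' \<in> M" "p' \<in> P"
        using adjoin[OF b] * by blast
      \<comment> \<open>Every term of the product of the two expressions contains \<open>q\<close>,
        \<open>q'\<close> or \<open>a * b\<close>, so a power of \<open>X_j\<close> would lie in
        \<open>M\<close>.\<close>
      have "var j ^ (N + N') = q * (q' + b * p') + (a * p) * q' + (p * p') * (a * b)"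
        by (simp add: power_add 1(1) 2(1) algebra_simps)
      also have "\<dots> \<in> M"
      proof -
        have cl: "a \<in> P" "b \<in> P" "q' \<in> P"
          using homog_closed[OF a] homog_closed[OF b] M.I_P[OF 2(2)] by auto
        show ?thesis
          by (intro M.I_add M.I_mult'[OF _ 1(2)] M.I_mult[OF _ 2(2)] M.I_mult[OF _ ab]
              poly_ring_closed cl 1(3) 2(3))
      qed
      finally show False
        using M(3) by blast
    qed
  qed
  then show ?thesis
    using M(1,2) M(3)[of 1] by auto
qed

end

section \<open>The hyperplane section\<close>

locale affine_scheme = homog_ideal n I for n :: nat and I :: "'k::field mpol set" +
  assumes saturated: "saturated n I"
    and off_hyperplane: "\<forall>p\<in>proj_support n I. var 0 \<notin> p"
begin

abbreviation "X0 \<equiv> var 0 :: 'k mpol"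

lemma X0_closed [simp, intro]: "X0 \<in> P"
  by simp

lemma var_power_reduce:
  assumes j: "j \<le> n"
  shows "\<exists>N q p. var j ^ N = q + X0 * p \<and> q \<in> I \<and> p \<in> P"
proof (rule ccontr)
  assume *: "\<nexists>N q p. var j ^ N = q + X0 * p \<and> q \<in> I \<and> p \<in> P"
  let ?L = "{q + X0 * p | q p. q \<in> I \<and> p \<in> P}"
  interpret L: homog_ideal n ?L
    by unfold_locales (rule homogeneous_ideal_adjoin[OF homog_var[of 0 n]], simp)
  have "var j ^ N \<notin> ?L" for N
    using * by blast
  then obtain p where p: "primeideal p (poly_ring n)" "homogeneous_ideal n p" "?L \<subseteq> p" "var j \<notin> p"
    using L.exists_homogeneous_prime[OF j] by blast
  have "I \<subseteq> ?L"
  proof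
    fix q assume "q \<in> I"
    then show "q \<in> ?L"
      by (intro CollectI exI[of _ q] exI[of _ 0]) simp
  qed
  moreover have "X0 \<in> ?L"
    using I_0 by (intro CollectI exI[of _ 0] exI[of _ 1]) simp
  \<comment> \<open>As \<open>X_j\<close> is not in \<open>p\<close>, this makes \<open>p\<close> a
    relevant prime, hence a point of the scheme.\<close>
  moreover have "var j \<in> irrelevant_ideal n"
    unfolding irrelevant_ideal_def using j by (intro subsetD[OF P.genideal_self]) auto
  ultimately have "p \<in> proj_support n I" "X0 \<in> p"
    using p unfolding proj_support_def by blast+
  then show False
    using off_hyperplane by blast
qed

text \<open>Multiplying \<open>X_j^N = q + X0 p\<close> by \<open>f\<close> puts
  \<open>X_j^N f\<close> into \<open>I\<close> for every \<open>j\<close>; saturation then gives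
  \<open>f\<close> itself.\<close>

lemma X0_cancel:
  assumes f: "f \<in> P" and "X0 * f \<in> I"
  shows "f \<in> I"
proof -
  have "\<exists>N. var j ^ N * f \<in> I" if "j \<le> n" for j
  proof -
    obtain N q p where 1: "var j ^ N = q + X0 * p" "q \<in> I" "p \<in> P"
      using var_power_reduce[OF \<open>j \<le> n\<close>] by blast
    have "var j ^ N * f = q * f + p * (X0 * f)"
      by (simp add: 1(1) algebra_simps)
    also have "\<dots> \<in> I"
      using f 1 assms(2) by (intro I_add[OF I_mult'[of f q] I_mult[of p "X0 * f"]])
    finally show ?thesis
      by blast
  qed
  then show ?thesis
    using saturated f unfolding saturated_def by blast
qed

lemma X0_power_cancel: "f \<in> P \<Longrightarrow> X0 ^ k * f \<in> I \<Longrightarrow> f \<in> I"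
proof (induction k)
  case (Suc k)
  have "X0 * (X0 ^ k * f) \<in> I"
    using Suc.prems(2) by (simp add: mult.assoc)
  then have "X0 ^ k * f \<in> I"
    by (rule X0_cancel[rotated]) (rule poly_ring_closed(6)[OF poly_ring_power_closed[OF X0_closed] Suc.prems(1)])
  then show ?case
    using Suc.IH Suc.prems(1) by blast
qed simp

lemma var_power_single: "var j ^ N = Poly_Mapping.single (Poly_Mapping.single j N) (1 :: 'k)"
proof (induction N)
  case (Suc N)
  then show ?case
    by (simp add: var_def mult_single flip: single_add)
qed simp

text \<open>A monomial whose degree exceeds the sum of the exponents \<open>N j\<close> is divisible
  by \<open>X_j\<close> to the power \<open>N j\<close> for some \<open>j\<close>, and that power is
  a multiple of \<open>X0\<close> modulo \<open>I\<close>. The resulting bound is crude; it only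
  serves to show that the Hilbert function becomes constant.\<close>

lemma high_degree_reduce:
  "\<exists>D. \<forall>d\<ge>D. \<forall>f\<in>H (Suc d). \<exists>g\<in>H d. f - X0 * g \<in> I"
proof -
  have "\<forall>j\<in>{..n}. \<exists>N q p. var j ^ N = q + X0 * p \<and> q \<in> I \<and> p \<in> P"
    using var_power_reduce by simp
  then obtain N where N: "\<And>j. j \<le> n \<Longrightarrow> \<exists>q p. var j ^ N j = q + X0 * p \<and> q \<in> I \<and> p \<in> P"
    by (metis atMost_iff)
  have mono: "\<exists>g\<in>H d. Poly_Mapping.single m c - X0 * g \<in> I"
    if d: "d \<ge> (\<Sum>j\<le>n. N j)" and m: "Poly_Mapping.keys m \<subseteq> {..n}" "mon_deg m = Suc d"
    for d m and c :: 'k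
  proof -
    have "\<exists>j\<le>n. N j \<le> Poly_Mapping.lookup m j"
    proof (rule ccontr)
      assume "\<not> (\<exists>j\<le>n. N j \<le> Poly_Mapping.lookup m j)"
      then have "(\<Sum>j\<le>n. Poly_Mapping.lookup m j) \<le> (\<Sum>j\<le>n. N j)"
        by (intro sum_mono) (meson atMost_iff nat_le_linear)
      then show False
        using mon_deg_superset[of "{..n}" m] m d by simp
    qed
    then obtain j where j: "j \<le> n" "N j \<le> Poly_Mapping.lookup m j"
      by blast
    obtain q p where qp: "var j ^ N j = q + X0 * p" "q \<in> I" "p \<in> P"
      using N[OF j(1)] by blast
    let ?s = "Poly_Mapping.single m c :: 'k mpol"
    let ?t = "Poly_Mapping.single (m - Poly_Mapping.single j (N j)) c :: 'k mpol"
    have "Poly_Mapping.single j (N j) + (m - Poly_Mapping.single j (N j)) = m"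
      using j by (intro poly_mapping_eqI) (auto simp: lookup_add lookup_minus lookup_single when_def)
    then have st: "?s = var j ^ N j * ?t"
      by (simp add: var_power_single mult_single)
    have tP: "?t \<in> P"
    proof -
      have "Poly_Mapping.keys (m - Poly_Mapping.single j (N j)) \<subseteq> {..n}"
        using m(1) keys_minus_subset by (rule order_trans[rotated])
      then show ?thesis
        by (simp add: carrier_poly_ring)
    qed
    have sH: "?s \<in> H (Suc d)"
      using m by (intro single_homog)
    have eq: "?s = q * ?t + X0 * (p * ?t)"
      unfolding st qp(1) by (simp add: algebra_simps)
    \<comment> \<open>\<open>q\<close> and \<open>p\<close> need not be homogeneous, so the
      component of degree \<open>Suc d\<close> is extracted on both sides.\<close>
    have "?s = hom_comp (Suc d) ?s"
      using hom_comp_homog[OF sH, of "Suc d"] by simp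
    also have "\<dots> = hom_comp (Suc d) (q * ?t + X0 * (p * ?t))"
      by (rule arg_cong[OF eq])
    also have "\<dots> = hom_comp (Suc d) (q * ?t) + X0 * hom_comp d (p * ?t)"
      using hom_comp_mult_homog[OF homog_var[of 0 n] poly_ring_closed(6)[OF qp(3) tP], of "Suc d"]
      by (simp add: hom_comp_add)
    finally have "?s - X0 * hom_comp d (p * ?t) = hom_comp (Suc d) (q * ?t)"
      by simp
    also have "\<dots> \<in> I"
      using qp(2) tP by (intro I_hom_comp I_mult')
    finally show ?thesis
      using qp(3) tP by (intro bexI[of _ "hom_comp d (p * ?t)"] hom_comp_in_homog poly_ring_closed)
  qed
  have "\<exists>g\<in>H d. f - X0 * g \<in> I" if d: "d \<ge> (\<Sum>j\<le>n. N j)" and f: "f \<in> H (Suc d)" for d f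
    using f
  proof (induction f rule: homog_induct)
    case zero
    show ?case
      using I_0 by (intro bexI[of _ 0]) auto
  next
    case (single m c)
    then show ?case
      by (intro mono[OF d])
  next
    case (add p q)
    then obtain a b where "a \<in> H d" "p - X0 * a \<in> I" "b \<in> H d" "q - X0 * b \<in> I"
      by blast
    then have "a + b \<in> H d" "(p - X0 * a) + (q - X0 * b) \<in> I"
      by (simp_all add: homog_add I_add)
    then show ?case
      by (intro bexI[of _ "a + b"]) (simp_all add: algebra_simps)
  qed
  then show ?thesis
    by blast
qed

section \<open>Dehomogenisation\<close>

text \<open>\<open>Iaff\<close> is the kernel of \<open>P \<rightarrow> S\<close>.\<close>

definition "Iaff = {f \<in> P. \<exists>b\<in>P. f - (X0 - 1) * b \<in> I}"

text \<open>The target degree is prescribed instead of being read off from \<open>f\<close>, which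
  makes the operation linear. Components above \<open>N\<close> are dropped, so \<open>N\<close> has
  to be large where this matters.\<close>

definition "homogenise N f = (\<Sum>k\<le>N. X0 ^ (N - k) * hom_comp k f)"

lemma IaffI: "f \<in> P \<Longrightarrow> b \<in> P \<Longrightarrow> f - (X0 - 1) * b \<in> I \<Longrightarrow> f \<in> Iaff"
  unfolding Iaff_def by blast

lemma IaffE:
  assumes "f \<in> Iaff"
  obtains b where "f \<in> P" "b \<in> P" "f - (X0 - 1) * b \<in> I"
  using assms unfolding Iaff_def by blast

lemma I_Iaff: "f \<in> I \<Longrightarrow> f \<in> Iaff"
  by (rule IaffI[of _ 0]) (simp_all add: I_P)

lemma X0_minus_1_Iaff: "p \<in> P \<Longrightarrow> (X0 - 1) * p \<in> Iaff"
  by (rule IaffI[of _ p]) (auto simp: I_0 intro: poly_ring_closed)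

lemma Iaff_add: "f \<in> Iaff \<Longrightarrow> g \<in> Iaff \<Longrightarrow> f + g \<in> Iaff"
proof (elim IaffE)
  fix b c assume "f \<in> P" "b \<in> P" "g \<in> P" "c \<in> P" "f - (X0 - 1) * b \<in> I" "g - (X0 - 1) * c \<in> I"
  then have "f + g \<in> P" "b + c \<in> P" "(f - (X0 - 1) * b) + (g - (X0 - 1) * c) \<in> I"
    by (simp_all add: I_add)
  then show ?thesis
    by (intro IaffI[of "f + g" "b + c"]) (simp_all add: algebra_simps)
qed

lemma Iaff_mult: "p \<in> P \<Longrightarrow> f \<in> Iaff \<Longrightarrow> p * f \<in> Iaff"
proof (elim IaffE)
  fix b assume "p \<in> P" "f \<in> P" "b \<in> P" "f - (X0 - 1) * b \<in> I"
  then have "p * f \<in> P" "p * b \<in> P" "p * (f - (X0 - 1) * b) \<in> I"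
    by (simp_all add: I_mult)
  then show ?thesis
    by (intro IaffI[of "p * f" "p * b"]) (simp_all add: algebra_simps)
qed

lemma Iaff_minus: "f \<in> Iaff \<Longrightarrow> g \<in> Iaff \<Longrightarrow> f - g \<in> Iaff"
  using Iaff_add[of f "- 1 * g"] Iaff_mult[of "- 1" g] by simp

lemma Iaff_sum: "(\<And>i. i \<in> S \<Longrightarrow> f i \<in> Iaff) \<Longrightarrow> sum f S \<in> Iaff"
  by (induction S rule: infinite_finite_induct) (simp_all add: I_Iaff I_0 Iaff_add)

lemma X0_power_Iaff: "p \<in> P \<Longrightarrow> X0 ^ k * p - p \<in> Iaff"
proof (induction k)
  case 0
  show ?case
    by (simp add: I_Iaff I_0)
next
  case (Suc k)
  have "(X0 - 1) * (X0 ^ k * p) + (X0 ^ k * p - p) \<in> Iaff"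
    using Suc.prems Suc.IH[OF Suc.prems] by (intro Iaff_add X0_minus_1_Iaff poly_ring_closed poly_ring_power_closed) auto
  then show ?case
    by (simp add: algebra_simps)
qed

lemma homogenise_homog: "f \<in> P \<Longrightarrow> homogenise N f \<in> H N"
  unfolding homogenise_def
proof (rule homog_sum)
  fix k assume k: "k \<in> {..N}" and "f \<in> P"
  then have "X0 ^ (N - k) * hom_comp k f \<in> H (N - k + k)"
    by (intro homog_mult homog_var_power hom_comp_in_homog) simp_all
  moreover have "N - k + k = N"
    using k by simp
  ultimately show "X0 ^ (N - k) * hom_comp k f \<in> H N"
    by simp
qed

lemma homogenise_add: "homogenise N (f + g) = homogenise N f + homogenise N g"
  by (simp add: homogenise_def hom_comp_add algebra_simps sum.distrib)

lemma homogenise_minus: "homogenise N (f - g) = homogenise N f - homogenise N g"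
  by (simp add: homogenise_def hom_comp_minus algebra_simps sum_subtractf)

lemma homogenise_I: "f \<in> I \<Longrightarrow> homogenise N f \<in> I"
  unfolding homogenise_def by (intro I_sum I_mult I_hom_comp) auto

lemma homogenise_of_homog:
  assumes "f \<in> H d" "d \<le> N"
  shows "homogenise N f = X0 ^ (N - d) * f"
proof -
  have "homogenise N f = (\<Sum>k\<le>N. if k = d then X0 ^ (N - d) * f else 0)"
    unfolding homogenise_def using assms by (intro sum.cong refl) (auto simp: hom_comp_homog)
  then show ?thesis
    using assms by simp
qed

text \<open>Multiplication by \<open>X0\<close> shifts each component up by one degree, which the
  smaller power of \<open>X0\<close> in front compensates; only the component of degree
  \<open>Suc N\<close> is pushed out of range.\<close>

lemma homogenise_X0:
  assumes "f \<in> P"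
  shows "homogenise (Suc N) (X0 * f) = homogenise (Suc N) f - hom_comp (Suc N) f"
proof -
  have X: "X0 \<in> H 1"
    by (rule homog_var) simp
  have "homogenise (Suc N) (X0 * f) = (\<Sum>k\<le>N. X0 ^ (N - k) * (X0 * hom_comp k f))"
    unfolding homogenise_def using hom_comp_mult_homog[OF X assms] by (simp add: sum.atMost_Suc_shift del: sum.atMost_Suc)
  also have "\<dots> = (\<Sum>k\<le>N. X0 ^ (Suc N - k) * hom_comp k f)"
    by (intro sum.cong refl) (simp add: Suc_diff_le mult.assoc mult.left_commute)
  finally show ?thesis
    by (simp add: homogenise_def)
qed

text \<open>For \<open>N\<close> beyond the degree of \<open>b\<close>, the homogenisation of
  \<open>(X0 - 1) * b\<close> is \<open>0\<close>, and what remains comes from an element of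
  \<open>I\<close>.\<close>

lemma homogenise_Iaff:
  assumes "f \<in> Iaff"
  shows "\<exists>M. \<forall>N\<ge>M. homogenise N f \<in> I"
proof -
  obtain b where b: "f \<in> P" "b \<in> P" "f - (X0 - 1) * b \<in> I"
    using assms by (rule IaffE)
  obtain M where M: "\<forall>m\<in>Poly_Mapping.keys b. mon_deg m \<le> M"
    using deg_bound by blast
  have "homogenise N f \<in> I" if N: "N \<ge> Suc M" for N
  proof -
    obtain N' where N': "N = Suc N'"
      using N by (cases N) auto
    have zero: "hom_comp N b = 0"
      using N by (intro hom_comp_beyond[OF M]) simp
    have "homogenise N f = homogenise N ((f - (X0 - 1) * b) + (X0 * b - b))"
      by (simp add: algebra_simps)
    also have "\<dots> = homogenise N (f - (X0 - 1) * b) + (homogenise N (X0 * b) - homogenise N b)"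
      by (simp only: homogenise_add homogenise_minus)
    also have "homogenise N (X0 * b) - homogenise N b = 0"
      using homogenise_X0[OF b(2), of N'] zero by (simp add: N')
    finally show ?thesis
      using homogenise_I[OF b(3)] by simp
  qed
  then show ?thesis
    by blast
qed

text \<open>This is the injectivity of \<open>R_d \<rightarrow> S\<close>. Homogenising a form in a
  large degree only multiplies it by a power of \<open>X0\<close>, which cancels modulo
  \<open>I\<close>.\<close>

lemma homog_Iaff:
  assumes "f \<in> H d" "f \<in> Iaff"
  shows "f \<in> I"
proof -
  obtain M where "\<forall>N\<ge>M. homogenise N f \<in> I"
    using homogenise_Iaff[OF assms(2)] by blast
  then have "homogenise (M + d) f \<in> I"
    by simp
  then have "X0 ^ M * f \<in> I"
    using homogenise_of_homog[OF assms(1), of "M + d"] by simp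
  then show ?thesis
    using homog_closed[OF assms(1)] X0_power_cancel by blast
qed

lemma minus_homogenise_Iaff:
  assumes "f \<in> P" and N: "\<forall>m\<in>Poly_Mapping.keys f. mon_deg m \<le> N"
  shows "f - homogenise N f \<in> Iaff"
proof -
  have "homogenise N f - f = homogenise N f - (\<Sum>k\<le>N. hom_comp k f)"
    using sum_hom_comp[OF N] by simp
  also have "\<dots> = (\<Sum>k\<le>N. X0 ^ (N - k) * hom_comp k f - hom_comp k f)"
    by (simp add: homogenise_def sum_subtractf)
  also have "\<dots> \<in> Iaff"
    using assms(1) by (intro Iaff_sum X0_power_Iaff homog_closed[OF hom_comp_in_homog])
  finally show ?thesis
    using Iaff_mult[of "- 1" "homogenise N f - f"] by simp
qed

text \<open>Multiplication by \<open>x0\<close> from \<open>R_d\<close> to \<open>R_(d+1)\<close> is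
  onto for all \<open>d \<ge> r\<close>. Kept as a property of \<open>r\<close> because it is used
  twice: with a crude bound to show that the Hilbert function stabilises, and then with the
  regularity index.\<close>

definition "eventually_surj r \<longleftrightarrow> (\<forall>d\<ge>r. \<forall>f\<in>H (Suc d). \<exists>g\<in>H d. f - X0 * g \<in> I)"

lemma eventually_surjD: "eventually_surj r \<Longrightarrow> d \<ge> r \<Longrightarrow> f \<in> H (Suc d) \<Longrightarrow> \<exists>g\<in>H d. f - X0 * g \<in> I"
  unfolding eventually_surj_def by blast

section \<open>Representatives in high degree and generators of the ideal\<close>

lemma eventually_surj_power:
  assumes r: "eventually_surj r" and d: "d \<ge> r"
  shows "f \<in> H (k + d) \<Longrightarrow> \<exists>g\<in>H d. f - X0 ^ k * g \<in> I"
proof (induction k arbitrary: f)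
  case 0
  then show ?case
    by (intro bexI[of _ f]) (simp_all add: I_0)
next
  case (Suc k)
  then have "f \<in> H (Suc (k + d))"
    by simp
  then obtain g where g: "g \<in> H (k + d)" "f - X0 * g \<in> I"
    using eventually_surjD[OF r, of "k + d" f] d by auto
  obtain h where h: "h \<in> H d" "g - X0 ^ k * h \<in> I"
    using Suc.IH[OF g(1)] by blast
  have "(f - X0 * g) + X0 * (g - X0 ^ k * h) \<in> I"
    using g(2) h(2) by (intro I_add I_mult X0_closed)
  then have "f - X0 ^ Suc k * h \<in> I"
    by (simp add: algebra_simps)
  then show ?case
    using h(1) by blast
qed

text \<open>This is the surjectivity of \<open>R_d \<rightarrow> S\<close>: homogenise in a large
  degree, then divide by a power of \<open>X0\<close> modulo \<open>I\<close>.\<close>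

lemma eventually_surj_representative:
  assumes r: "eventually_surj r" and d: "d \<ge> r" and f: "f \<in> P"
  shows "\<exists>g\<in>H d. f - g \<in> Iaff"
proof -
  obtain M where M: "\<forall>m\<in>Poly_Mapping.keys f. mon_deg m \<le> M"
    using deg_bound by blast
  \<comment> \<open>\<open>M + d\<close> bounds the degree of \<open>f\<close> and is also at least
    \<open>d\<close>.\<close>
  let ?h = "homogenise (M + d) f"
  have "\<forall>m\<in>Poly_Mapping.keys f. mon_deg m \<le> M + d"
    using M by (simp add: trans_le_add1)
  then have 1: "f - ?h \<in> Iaff"
    by (rule minus_homogenise_Iaff[OF f])
  obtain g where g: "g \<in> H d" "?h - X0 ^ M * g \<in> I"
    using eventually_surj_power[OF r d homogenise_homog[OF f, of "M + d"]] by blast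
  have "(f - ?h) + ((?h - X0 ^ M * g) + (X0 ^ M * g - g)) \<in> Iaff"
    using 1 I_Iaff[OF g(2)] X0_power_Iaff[OF homog_closed[OF g(1)]] by (intro Iaff_add)
  then have "f - g \<in> Iaff"
    by simp
  then show ?thesis
    using g(1) by blast
qed

text \<open>This bounds the degrees of generators of \<open>I\<close> by \<open>r + 1\<close>.
  Writing \<open>f = \<Sum> X_j a_j\<close> and choosing \<open>b_j\<close> with
  \<open>a_j - X0 b_j\<close> in \<open>I\<close>, the terms \<open>X0 b_j\<close> with
  \<open>j \<noteq> 0\<close> are moved into the coefficient of \<open>X0\<close>. The other
  coefficients are then in \<open>I\<close>, hence so is \<open>X0\<close> times its coefficient,
  and \<open>X0\<close> cancels.\<close>

lemma ideal_decompose: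
  assumes r: "eventually_surj r" and d: "d \<ge> r" and f: "f \<in> I" "f \<in> H (Suc (Suc d))"
  shows "\<exists>q. (\<forall>j\<le>n. q j \<in> I \<and> q j \<in> H (Suc d)) \<and> f = (\<Sum>j\<le>n. var j * q j)"
proof -
  obtain a where a: "\<And>j. a j \<in> H (Suc d)" "f = (\<Sum>j\<le>n. var j * a j)"
    using homog_decompose[OF f(2)] by blast
  have "\<forall>j. \<exists>g\<in>H d. a j - X0 * g \<in> I"
    using eventually_surjD[OF r d a(1)] by blast
  then obtain b where b: "\<And>j. b j \<in> H d" "\<And>j. a j - X0 * b j \<in> I"
    by metis
  define q where "q j = (if j = 0 then a 0 + (\<Sum>i\<in>{..n} - {0}. var i * b i) else a j - X0 * b j)" for j
  have split: "(\<Sum>j\<le>n. u j) = u 0 + (\<Sum>j\<in>{..n} - {0}. u j)" for u :: "nat \<Rightarrow> 'k mpol"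
    by (rule sum.remove) auto
  have X: "var j * p \<in> H (Suc d)" if "j \<le> n" "p \<in> H d" for j p
    using homog_mult[OF homog_var[OF that(1)] that(2)] by simp
  have qH: "q j \<in> H (Suc d)" if "j \<le> n" for j
    unfolding q_def using a(1) b(1) X by (auto intro!: homog_add homog_minus homog_sum)
  have "f = X0 * a 0 + (\<Sum>j\<in>{..n} - {0}. var j * a j)"
    unfolding a(2) by (rule split)
  also have "\<dots> = X0 * q 0 + (\<Sum>j\<in>{..n} - {0}. var j * q j)"
  proof -
    have "(\<Sum>j\<in>{..n} - {0}. var j * q j) = (\<Sum>j\<in>{..n} - {0}. var j * a j - X0 * (var j * b j))"
      by (intro sum.cong refl) (simp add: q_def algebra_simps)
    then show ?thesis
      by (simp add: q_def sum_subtractf sum_distrib_left algebra_simps)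
  qed
  finally have eq: "f = X0 * q 0 + (\<Sum>j\<in>{..n} - {0}. var j * q j)" .
  have qI: "q j \<in> I" if "j \<noteq> 0" for j
    using b(2) that by (simp add: q_def)
  have "f - (\<Sum>j\<in>{..n} - {0}. var j * q j) \<in> I"
    using f(1) qI by (intro I_minus I_sum I_mult) auto
  then have "X0 * q 0 \<in> I"
    unfolding eq by simp
  then have "q 0 \<in> I"
    by (rule X0_cancel[OF homog_closed[OF qH[OF le0]]])
  then have "q j \<in> I" for j
    using qI[of j] by (cases "j = 0") auto
  moreover have "f = (\<Sum>j\<le>n. var j * q j)"
    unfolding eq by (rule split[symmetric])
  ultimately show ?thesis
    using qH by blast
qed

text \<open>Iterating \<open>ideal_decompose\<close>, an element of \<open>I\<close> of degree
  \<open>Suc r + k\<close> is a sum of products of forms of degree \<open>k\<close> with elements of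
  \<open>I\<close> of degree \<open>Suc r\<close>. \<open>Q\<close> is generalised because the
  induction hypothesis is applied to \<open>Q\<close> composed with multiplication by a
  variable.\<close>

lemma ideal_homog_induct:
  assumes r: "eventually_surj r"
  shows "f \<in> I \<Longrightarrow> f \<in> H (Suc r + k) \<Longrightarrow> (\<And>p q. Q p \<Longrightarrow> Q q \<Longrightarrow> Q (p + q)) \<Longrightarrow>
    (\<And>a g. a \<in> H k \<Longrightarrow> g \<in> I \<Longrightarrow> g \<in> H (Suc r) \<Longrightarrow> Q (a * g)) \<Longrightarrow> Q f"
proof (induction k arbitrary: f Q)
  case 0
  have "Q (const 1 * f)"
    using 0 by (intro 0(4) homog_const) auto
  then show ?case
    by (simp add: const_def)
next
  case (Suc k)
  have "f \<in> H (Suc (Suc (r + k)))"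
    using Suc.prems(2) by simp
  then obtain q where q: "\<And>j. j \<le> n \<Longrightarrow> q j \<in> I" "\<And>j. j \<le> n \<Longrightarrow> q j \<in> H (Suc (r + k))"
    "f = (\<Sum>j\<le>n. var j * q j)"
    using ideal_decompose[OF r _ Suc.prems(1), of "r + k"] by auto
  have Qj: "Q (var j * q j)" if j: "j \<le> n" for j
  proof (rule Suc.IH[of "q j" "\<lambda>h. Q (var j * h)"])
    show "q j \<in> I" "q j \<in> H (Suc r + k)"
      using q j by auto
    show "Q (var j * (p + q))" if "Q (var j * p)" "Q (var j * q)" for p q
      using Suc.prems(3)[OF that] by (simp add: algebra_simps)
    show "Q (var j * (a * g))" if "a \<in> H k" "g \<in> I" "g \<in> H (Suc r)" for a g
      using Suc.prems(4)[of "var j * a" g] homog_mult[OF homog_var[OF j] that(1)] that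
      by (simp add: mult.assoc)
  qed
  \<comment> \<open>Zero is itself a product \<open>a * g\<close>, so the rule needs no case for
    it.\<close>
  have "Q 0"
    using Suc.prems(4)[of 0 0] I_0 by simp
  moreover have "Q (\<Sum>j\<in>S. var j * q j)" if "finite S" "S \<subseteq> {..n}" "Q 0" for S
    using that by (induction S rule: finite_induct) (simp_all add: Suc.prems(3) Qj)
  ultimately show ?case
    unfolding q(3) by simp
qed

text \<open>For \<open>G = a * g\<close> the choice is \<open>G' = a' * g\<close> with
  \<open>a - X0 * a'\<close> in \<open>I\<close>. In the Leibniz rule the derivatives of
  \<open>a\<close> and \<open>a'\<close> carry the factor \<open>g\<close> from \<open>I\<close>,
  and the remaining terms combine to \<open>a - X0 * a'\<close> times the gradient of
  \<open>g\<close>.\<close>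

lemma ideal_gradient_lift:
  assumes r: "eventually_surj r" and N: "N \<ge> Suc (2 * r)" and G: "G \<in> I" "G \<in> H (Suc N)"
  shows "\<exists>G'. G' \<in> I \<and> G' \<in> H N \<and> (\<forall>j. pdiff j G - X0 * pdiff j G' \<in> I)"
proof -
  \<comment> \<open>\<open>Suc N\<close> splits into \<open>Suc r\<close>, the degree of the
    generator \<open>g\<close>, and \<open>Suc k\<close>, the degree of the cofactor
    \<open>a\<close>; \<open>k \<ge> r\<close> is what allows \<open>X0\<close> to be split off from
    \<open>a\<close>.\<close>
  obtain k where k: "N = r + Suc k" "k \<ge> r"
    using N by (intro that[of "N - r - 1"]) auto
  have GH: "G \<in> H (Suc r + Suc k)"
    using G(2) by (simp add: k)
  show ?thesis
    using r G(1) GH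
  proof (rule ideal_homog_induct)
    fix p q
    assume "\<exists>G'. G' \<in> I \<and> G' \<in> H N \<and> (\<forall>j. pdiff j p - X0 * pdiff j G' \<in> I)"
      "\<exists>G'. G' \<in> I \<and> G' \<in> H N \<and> (\<forall>j. pdiff j q - X0 * pdiff j G' \<in> I)"
    then obtain a b where a: "a \<in> I" "a \<in> H N" "\<And>j. pdiff j p - X0 * pdiff j a \<in> I"
      and b: "b \<in> I" "b \<in> H N" "\<And>j. pdiff j q - X0 * pdiff j b \<in> I"
      by blast
    have "pdiff j (p + q) - X0 * pdiff j (a + b) \<in> I" for j
      using I_add[OF a(3)[of j] b(3)[of j]] by (simp add: pdiff_add algebra_simps)
    then show "\<exists>G'. G' \<in> I \<and> G' \<in> H N \<and> (\<forall>j. pdiff j (p + q) - X0 * pdiff j G' \<in> I)"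
      using I_add[OF a(1) b(1)] homog_add[OF a(2) b(2)] by blast
  next
    fix a g assume a: "a \<in> H (Suc k)" and g: "g \<in> I" "g \<in> H (Suc r)"
    obtain a' where a': "a' \<in> H k" "a - X0 * a' \<in> I"
      using eventually_surjD[OF r k(2) a] by blast
    have cl: "a \<in> P" "a' \<in> P" "g \<in> P"
      using homog_closed a a' g by blast+
    have "pdiff j (a * g) - X0 * pdiff j (a' * g) \<in> I" for j
    proof -
      have "pdiff j (a * g) - X0 * pdiff j (a' * g) =
          pdiff j g * (a - X0 * a') + (pdiff j a - X0 * pdiff j a') * g"
        by (simp add: pdiff_mult algebra_simps)
      also have "\<dots> \<in> I"
        using a'(2) g(1) cl by (intro I_add I_mult poly_ring_closed pdiff_closed X0_closed)
      finally show ?thesis .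
    qed
    moreover have "a' * g \<in> H N"
      using homog_mult[OF a'(1) g(2)] by (simp add: k add.commute)
    moreover have "a' * g \<in> I"
      using cl g(1) by (intro I_mult)
    ultimately show "\<exists>G'. G' \<in> I \<and> G' \<in> H N \<and> (\<forall>j. pdiff j (a * g) - X0 * pdiff j G' \<in> I)"
      by blast
  qed
qed

text \<open>Each power of \<open>X0\<close> is removed by trading \<open>G\<close> for an element of
  \<open>I\<close> of degree one less. Entries of degree \<open>i\<close> belong to differentials of
  degree \<open>i + 1\<close>, so \<open>2 * r\<close> here is the bound \<open>2 r + 1\<close> of
  the statement.\<close>

lemma X0_power_gradient_cancel:
  assumes r: "eventually_surj r" and i: "i \<ge> 2 * r" and g: "\<And>j. j \<le> n \<Longrightarrow> g j \<in> H i"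
  shows "G \<in> I \<Longrightarrow> G \<in> H (Suc (k + i)) \<Longrightarrow> (\<And>j. j \<le> n \<Longrightarrow> X0 ^ k * g j - pdiff j G \<in> I) \<Longrightarrow>
    \<exists>F\<in>I. \<forall>j\<le>n. g j - pdiff j F \<in> I"
proof (induction k arbitrary: G)
  case 0
  then show ?case
    by (intro bexI[of _ G]) simp_all
next
  case (Suc k)
  obtain G' where G': "G' \<in> I" "G' \<in> H (Suc (k + i))" "\<And>j. pdiff j G - X0 * pdiff j G' \<in> I"
    using ideal_gradient_lift[OF r _ Suc.prems(1), of "Suc (k + i)"] Suc.prems(2) i by auto
  show ?case
  proof (rule Suc.IH[OF G'(1,2)])
    fix j assume j: "j \<le> n"
    have "(X0 ^ Suc k * g j - pdiff j G) + (pdiff j G - X0 * pdiff j G') \<in> I"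
      by (rule I_add[OF Suc.prems(3)[OF j] G'(3)])
    then have "X0 * (X0 ^ k * g j - pdiff j G') \<in> I"
      by (simp add: algebra_simps)
    then show "X0 ^ k * g j - pdiff j G' \<in> I"
      by (rule X0_cancel[rotated])
        (intro poly_ring_closed pdiff_closed poly_ring_power_closed X0_closed homog_closed[OF g[OF j]] I_P[OF G'(1)])
  qed
qed

text \<open>For \<open>j\<close> other than \<open>0\<close> the powers of \<open>X0\<close> behave
  as constants. Degrees drop by one, and the component of degree \<open>0\<close> has derivative
  \<open>0\<close>.\<close>

lemma homogenise_pdiff:
  assumes "f \<in> P" "j \<noteq> 0"
  shows "pdiff j (homogenise (Suc N) f) = homogenise N (pdiff j f)"
proof -
  have X: "pdiff j (X0 ^ k) = 0" for k
    using assms(2) by (induction k) (simp_all add: pdiff_mult pdiff_var)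
  have comp: "pdiff j (hom_comp (Suc k) f) = hom_comp k (pdiff j f)" for k
  proof -
    obtain M where M: "\<forall>m\<in>Poly_Mapping.keys f. mon_deg m \<le> M"
      using deg_bound by blast
    have "\<forall>m\<in>Poly_Mapping.keys f. mon_deg m \<le> Suc (M + k)"
      using M by (meson le_SucI trans_le_add1)
    then have "(\<Sum>l\<le>Suc (M + k). hom_comp l f) = f"
      by (rule sum_hom_comp)
    then have "hom_comp k (pdiff j f) = hom_comp k (pdiff j (\<Sum>l\<le>Suc (M + k). hom_comp l f))"
      by simp
    also have "\<dots> = (\<Sum>l\<le>Suc (M + k). hom_comp k (pdiff j (hom_comp l f)))"
      by (simp only: hom_comp_sum pdiff_sum)
    also have "\<dots> = (\<Sum>l\<le>M + k. hom_comp k (pdiff j (hom_comp (Suc l) f)))"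
      using pdiff_homog_0[OF hom_comp_in_homog[OF assms(1)]]
      by (simp add: sum.atMost_Suc_shift del: sum.atMost_Suc)
    also have "\<dots> = (\<Sum>l\<le>M + k. if l = k then pdiff j (hom_comp (Suc k) f) else 0)"
    proof (intro sum.cong refl)
      fix l
      have "pdiff j (hom_comp (Suc l) f) \<in> H l"
        by (rule homog_pdiff[OF hom_comp_in_homog[OF assms(1)]])
      then show "hom_comp k (pdiff j (hom_comp (Suc l) f)) =
          (if l = k then pdiff j (hom_comp (Suc k) f) else 0)"
        by (auto simp: hom_comp_homog)
    qed
    finally show ?thesis
      by simp
  qed
  have "pdiff j (homogenise (Suc N) f) = (\<Sum>k\<le>Suc N. X0 ^ (Suc N - k) * pdiff j (hom_comp k f))"
    unfolding homogenise_def pdiff_sum by (simp add: pdiff_mult X)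
  also have "\<dots> = (\<Sum>k\<le>N. X0 ^ (N - k) * hom_comp k (pdiff j f))"
    using pdiff_homog_0[OF hom_comp_in_homog[OF assms(1)]]
    by (simp add: sum.atMost_Suc_shift comp del: sum.atMost_Suc)
  finally show ?thesis
    by (simp add: homogenise_def)
qed

text \<open>
  Dehomogenising loses \<open>\<partial>/\<partial>X\<^sub>0\<close>; the component \<open>j = 0\<close> is recovered from the Euler relation.
\<close>

lemma gradient_dehomogenise_inj:
  assumes r: "eventually_surj r" and i: "i \<ge> 2 * r" and g: "\<And>j. j \<le> n \<Longrightarrow> g j \<in> H i"
    and euler: "(\<Sum>j\<le>n. var j * g j) \<in> I"
    and F: "F \<in> Iaff" "\<And>j. j \<le> n \<Longrightarrow> g j - pdiff j F \<in> Iaff"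
  shows "\<exists>F'\<in>I. \<forall>j\<le>n. g j - pdiff j F' \<in> I"
proof -
  have FP: "F \<in> P"
    using F(1) by (rule IaffE)
  obtain M where M: "\<And>N. N \<ge> M \<Longrightarrow> homogenise N F \<in> I"
    using homogenise_Iaff[OF F(1)] by blast
  have "\<forall>j\<in>{..n}. \<exists>M. \<forall>N\<ge>M. homogenise N (g j - pdiff j F) \<in> I"
    using homogenise_Iaff[OF F(2)] by blast
  then obtain M' where M': "\<And>j N. j \<le> n \<Longrightarrow> N \<ge> M' j \<Longrightarrow> homogenise N (g j - pdiff j F) \<in> I"
    by (metis atMost_iff)
  \<comment> \<open>One exponent that is large enough for \<open>F\<close> and for all entries; the
    sum serves as a common upper bound.\<close>
  define k where "k = M + (\<Sum>j\<le>n. M' j)"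
  have k: "k \<ge> M" "\<And>j. j \<le> n \<Longrightarrow> k \<ge> M' j"
    using member_le_sum[of _ "{..n}" M'] by (auto simp: k_def intro: trans_le_add2)
  define G where "G = homogenise (Suc (k + i)) F"
  have G: "G \<in> I" "G \<in> H (Suc (k + i))"
    unfolding G_def using M k(1) homogenise_homog[OF FP] by auto
  have pos: "X0 ^ k * g j - pdiff j G \<in> I" if j: "j \<le> n" "j \<noteq> 0" for j
  proof -
    have "homogenise (k + i) (g j - pdiff j F) \<in> I"
      using k(2)[OF j(1)] by (intro M'[OF j(1)]) simp
    moreover have "homogenise (k + i) (g j) = X0 ^ k * g j"
      using homogenise_of_homog[OF g[OF j(1)], of "k + i"] by simp
    ultimately show ?thesis
      unfolding G_def homogenise_pdiff[OF FP j(2)] by (simp add: homogenise_minus)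
  qed
  have split: "(\<Sum>j\<le>n. u j) = u 0 + (\<Sum>j\<in>{..n} - {0}. u j)" for u :: "nat \<Rightarrow> 'k mpol"
    by (rule sum.remove) auto
  \<comment> \<open>By Euler's identity this is the sum of \<open>X_j\<close> times the entries of
    \<open>X0 ^ k * g\<close> minus the gradient of \<open>G\<close>. It lies in \<open>I\<close>
    because the Euler sum of \<open>g\<close> and \<open>G\<close> do. Once the entries with
    \<open>j \<noteq> 0\<close> are known to be in \<open>I\<close>, only \<open>X0\<close> times
    the entry at \<open>0\<close> remains.\<close>
  have "X0 ^ k * (\<Sum>j\<le>n. var j * g j) - of_nat (Suc (k + i)) * G \<in> I"
    unfolding const_of_nat[symmetric] using euler G(1) by (intro I_minus I_mult poly_ring_closed poly_ring_power_closed X0_closed)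
  also have "X0 ^ k * (\<Sum>j\<le>n. var j * g j) - of_nat (Suc (k + i)) * G =
      (\<Sum>j\<le>n. var j * (X0 ^ k * g j - pdiff j G))"
    unfolding euler_identity[OF G(2), symmetric]
    by (simp add: sum_distrib_left sum_subtractf algebra_simps)
  also have "\<dots> = X0 * (X0 ^ k * g 0 - pdiff 0 G) + (\<Sum>j\<in>{..n} - {0}. var j * (X0 ^ k * g j - pdiff j G))"
    by (rule split)
  finally have "X0 * (X0 ^ k * g 0 - pdiff 0 G) + (\<Sum>j\<in>{..n} - {0}. var j * (X0 ^ k * g j - pdiff j G)) \<in> I" .
  moreover have "(\<Sum>j\<in>{..n} - {0}. var j * (X0 ^ k * g j - pdiff j G)) \<in> I"
    by (intro I_sum I_mult pos) auto
  ultimately have "X0 * (X0 ^ k * g 0 - pdiff 0 G) \<in> I"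
    using I_minus by fastforce
  then have "X0 ^ k * g 0 - pdiff 0 G \<in> I"
    by (rule X0_cancel[rotated])
      (intro poly_ring_closed pdiff_closed poly_ring_power_closed X0_closed homog_closed[OF g[OF le0]] I_P[OF G(1)])
  then have all: "X0 ^ k * g j - pdiff j G \<in> I" if "j \<le> n" for j
    using pos[OF that] by (cases "j = 0") auto
  show ?thesis
    by (rule X0_power_gradient_cancel[OF r i g G all])
qed

text \<open>The entry at \<open>0\<close> can be chosen at will because \<open>dx_0\<close> vanishes
  over \<open>S\<close>: modulo \<open>Iaff\<close>, the gradient of \<open>(X0 - 1) * p\<close> is
  \<open>p\<close> at \<open>0\<close> and \<open>0\<close> elsewhere. With
  \<open>p = g 0 - h 0\<close> this absorbs the difference at \<open>0\<close>.\<close>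

lemma gradient_dehomogenise_surj:
  assumes r: "eventually_surj r" and i: "i \<ge> r" and g: "\<And>j. j \<le> n \<Longrightarrow> g j \<in> P"
  shows "\<exists>h. (\<forall>j\<le>n. h j \<in> H i) \<and> (\<Sum>j\<le>n. var j * h j) \<in> I \<and>
    (\<exists>F\<in>Iaff. \<forall>j\<le>n. (g j - h j) - pdiff j F \<in> Iaff)"
proof -
  have "\<forall>j\<in>{..n}. \<exists>h\<in>H i. g j - h \<in> Iaff"
    using eventually_surj_representative[OF r i g] by blast
  then obtain a where a: "\<And>j. j \<le> n \<Longrightarrow> a j \<in> H i" "\<And>j. j \<le> n \<Longrightarrow> g j - a j \<in> Iaff"
    by (metis atMost_iff)
  let ?s = "\<Sum>j\<in>{..n} - {0}. var j * a j"
  have "var j * a j \<in> H (Suc i)" if "j \<le> n" for j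
    using homog_mult[OF homog_var[OF that] a(1)[OF that]] by simp
  then have "?s \<in> H (Suc i)"
    by (intro homog_sum) auto
  then obtain b where b: "b \<in> H i" "?s - X0 * b \<in> I"
    using eventually_surjD[OF r i] by blast
  \<comment> \<open>The entry \<open>- b\<close> solves the Euler relation modulo \<open>I\<close>
    for the given homogeneous representatives at \<open>j \<noteq> 0\<close>.\<close>
  define h where "h j = (if j = 0 then - b else a j)" for j
  have hH: "h j \<in> H i" if "j \<le> n" for j
    using a(1)[OF that] b(1) by (auto simp: h_def intro: homog_uminus)
  have "(\<Sum>j\<le>n. var j * h j) = X0 * h 0 + (\<Sum>j\<in>{..n} - {0}. var j * h j)"
    by (rule sum.remove) auto
  also have "(\<Sum>j\<in>{..n} - {0}. var j * h j) = ?s"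
    by (intro sum.cong refl) (auto simp: h_def)
  also have "X0 * h 0 + ?s = ?s - X0 * b"
    by (simp add: h_def)
  finally have euler: "(\<Sum>j\<le>n. var j * h j) \<in> I"
    using b(2) by simp
  have h0: "g 0 - h 0 \<in> P"
    using g[of 0] homog_closed[OF hH[of 0]] by (intro poly_ring_closed) auto
  let ?F = "(X0 - 1) * (g 0 - h 0)"
  have "(g j - h j) - pdiff j ?F \<in> Iaff" if j: "j \<le> n" for j
  proof -
    have *: "(X0 - 1) * pdiff j (g 0 - h 0) \<in> Iaff"
      by (intro X0_minus_1_Iaff pdiff_closed h0)
    have D: "pdiff j ?F = (X0 - 1) * pdiff j (g 0 - h 0) + (g 0 - h 0) * (if j = 0 then 1 else 0)"
      unfolding pdiff_mult[of j "X0 - 1"] by (simp only: pdiff_minus pdiff_var pdiff_1 diff_0_right eq_commute[of 0 j])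
    show ?thesis
    proof (cases "j = 0")
      case True
      have "(g j - h j) - pdiff j ?F = - 1 * ((X0 - 1) * pdiff j (g 0 - h 0))"
        unfolding D by (simp add: True)
      also have "\<dots> \<in> Iaff"
        by (rule Iaff_mult[OF _ *]) auto
      finally show ?thesis .
    next
      case False
      then have "(g j - h j) - pdiff j ?F = (g j - a j) - (X0 - 1) * pdiff j (g 0 - h 0)"
        unfolding D by (simp add: h_def)
      also have "\<dots> \<in> Iaff"
        by (rule Iaff_minus[OF a(2)[OF j] *])
      finally show ?thesis .
    qed
  qed
  moreover have "?F \<in> Iaff"
    by (rule X0_minus_1_Iaff[OF h0])
  ultimately show ?thesis
    using hH euler by blast
qed

end

section \<open>Dimensions\<close>

lemma type_ring_simps [simp]:
  "carrier (ring_of_type_algebra :: 'k::field ring) = UNIV"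
  "x \<oplus>\<^bsub>(ring_of_type_algebra :: 'k::field ring)\<^esub> y = x + y"
  "x \<otimes>\<^bsub>(ring_of_type_algebra :: 'k::field ring)\<^esub> y = x * y"
  "\<zero>\<^bsub>(ring_of_type_algebra :: 'k::field ring)\<^esub> = 0"
  "\<one>\<^bsub>(ring_of_type_algebra :: 'k::field ring)\<^esub> = 1"
  by (simp_all add: ring_of_type_algebra_def)

lemma restrict_scalars_ops [simp]:
  "x \<oplus>\<^bsub>restrict_scalars \<phi> M\<^esub> y = x \<oplus>\<^bsub>M\<^esub> y"
  "c \<odot>\<^bsub>restrict_scalars \<phi> M\<^esub> x = \<phi> c \<odot>\<^bsub>M\<^esub> x"
  "\<zero>\<^bsub>restrict_scalars \<phi> M\<^esub> = \<zero>\<^bsub>M\<^esub>"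
  by (simp_all add: restrict_scalars_def)

lemma restrict_scalars_simps:
  "carrier ((restrict_scalars \<phi> M)\<lparr>carrier := W\<rparr>) = W"
  "x \<oplus>\<^bsub>(restrict_scalars \<phi> M)\<lparr>carrier := W\<rparr>\<^esub> y = x \<oplus>\<^bsub>M\<^esub> y"
  "c \<odot>\<^bsub>(restrict_scalars \<phi> M)\<lparr>carrier := W\<rparr>\<^esub> x = \<phi> c \<odot>\<^bsub>M\<^esub> x"
  "\<zero>\<^bsub>(restrict_scalars \<phi> M)\<lparr>carrier := W\<rparr>\<^esub> = \<zero>\<^bsub>M\<^esub>"
  by simp_all

text \<open>Negatives are multiples by \<open>\<phi> (- 1)\<close>, so closure under addition and
  scalars, together with zero, suffices.\<close>

lemma subspace_vectorspace:
  fixes \<phi> :: "'k::field \<Rightarrow> 'a"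
  assumes "Module.module A M" and \<phi>: "\<phi> \<in> ring_hom ring_of_type_algebra A"
    and W: "W \<subseteq> carrier M" "\<zero>\<^bsub>M\<^esub> \<in> W" "\<And>x y. x \<in> W \<Longrightarrow> y \<in> W \<Longrightarrow> x \<oplus>\<^bsub>M\<^esub> y \<in> W"
      "\<And>c x. x \<in> W \<Longrightarrow> \<phi> c \<odot>\<^bsub>M\<^esub> x \<in> W"
  shows "vectorspace ring_of_type_algebra ((restrict_scalars \<phi> M)\<lparr>carrier := W\<rparr>)"
proof -
  interpret M: Module.module A M
    by fact
  have phi: "\<phi> c \<in> carrier A" "\<phi> (c + c') = \<phi> c \<oplus>\<^bsub>A\<^esub> \<phi> c'" "\<phi> (c * c') = \<phi> c \<otimes>\<^bsub>A\<^esub> \<phi> c'" "\<phi> 1 = \<one>\<^bsub>A\<^esub>"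
    for c c'
    using ring_hom_closed[OF \<phi>, of c] ring_hom_add[OF \<phi>, of c c'] ring_hom_mult[OF \<phi>, of c c']
      ring_hom_one[OF \<phi>] by simp_all
  have WM: "x \<in> carrier M" if "x \<in> W" for x
    using that W(1) by blast
  show ?thesis
  proof (rule vs_criteria)
    show "Ring.field (ring_of_type_algebra :: 'k ring)"
      by (rule field_from_type_algebra)
    show "\<forall>v\<in>carrier (restrict_scalars \<phi> M\<lparr>carrier := W\<rparr>).
        \<exists>w\<in>carrier (restrict_scalars \<phi> M\<lparr>carrier := W\<rparr>).
          v \<oplus>\<^bsub>restrict_scalars \<phi> M\<lparr>carrier := W\<rparr>\<^esub> w = \<zero>\<^bsub>restrict_scalars \<phi> M\<lparr>carrier := W\<rparr>\<^esub>"
    proof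
      fix v assume "v \<in> carrier (restrict_scalars \<phi> M\<lparr>carrier := W\<rparr>)"
      then have v: "v \<in> W" "v \<in> carrier M"
        using WM by simp_all
      have "\<phi> 1 \<odot>\<^bsub>M\<^esub> v \<oplus>\<^bsub>M\<^esub> \<phi> (- 1) \<odot>\<^bsub>M\<^esub> v = \<phi> (1 + - 1) \<odot>\<^bsub>M\<^esub> v"
        unfolding phi(2) using v phi(1) by (intro M.smult_l_distr[symmetric])
      moreover have "\<phi> 0 = \<zero>\<^bsub>A\<^esub>"
      proof -
        have "\<phi> 0 \<oplus>\<^bsub>A\<^esub> \<phi> 0 = \<phi> 0"
          using phi(2)[of 0 0] by simp
        then show ?thesis
          using phi(1)[of 0] M.R.add.r_cancel_one[of "\<phi> 0" "\<phi> 0"] by simp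
      qed
      ultimately have "v \<oplus>\<^bsub>M\<^esub> \<phi> (- 1) \<odot>\<^bsub>M\<^esub> v = \<zero>\<^bsub>M\<^esub>"
        using v by (simp add: phi(4))
      then show "\<exists>w\<in>carrier (restrict_scalars \<phi> M\<lparr>carrier := W\<rparr>).
          v \<oplus>\<^bsub>restrict_scalars \<phi> M\<lparr>carrier := W\<rparr>\<^esub> w = \<zero>\<^bsub>restrict_scalars \<phi> M\<lparr>carrier := W\<rparr>\<^esub>"
        using W(4)[OF v(1)] by (intro bexI[of _ "\<phi> (- 1) \<odot>\<^bsub>M\<^esub> v"]) simp_all
    qed
  qed (simp_all add: W WM phi M.M.a_ac M.smult_assoc1 M.smult_l_distr M.smult_r_distr)
qed

lemma module_homI:
  assumes "\<And>x. x \<in> carrier M \<Longrightarrow> f x \<in> carrier N"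
    and "\<And>x y. x \<in> carrier M \<Longrightarrow> y \<in> carrier M \<Longrightarrow> f (x \<oplus>\<^bsub>M\<^esub> y) = f x \<oplus>\<^bsub>N\<^esub> f y"
    and "\<And>r x. r \<in> carrier R \<Longrightarrow> x \<in> carrier M \<Longrightarrow> f (r \<odot>\<^bsub>M\<^esub> x) = r \<odot>\<^bsub>N\<^esub> f x"
  shows "f \<in> module_hom R M N"
  using assms by (simp add: module_hom_def)

lemma linear_mapI:
  assumes "vectorspace K V" "vectorspace K W" "f \<in> module_hom K V W"
  shows "linear_map K V W f"
proof -
  interpret V: vectorspace K V by fact
  interpret W: vectorspace K W by fact
  show ?thesis
    by unfold_locales fact
qed

lemma vectorspace_dim_bij:
  assumes V: "vectorspace K V" and W: "vectorspace K W" and f: "f \<in> module_hom K V W"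
    and bij: "bij_betw f (carrier V) (carrier W)"
  shows "vectorspace.dim K V = vectorspace.dim K W"
proof -
  interpret f: linear_map K V W f
    by (rule linear_mapI[OF V W f])
  let ?g = "inv_into (carrier V) f"
  have g: "?g y \<in> carrier V" "f (?g y) = y" if "y \<in> carrier W" for y
    using that bij inv_into_into[of y f "carrier V"] f_inv_into_f[of y f "carrier V"]
    by (simp_all add: bij_betw_def)
  have inj: "x = y" if "x \<in> carrier V" "y \<in> carrier V" "f x = f y" for x y
    using that bij by (auto simp: bij_betw_def inj_on_def)
  have "?g \<in> module_hom K W V"
  proof (rule module_homI)
    show "?g (x \<oplus>\<^bsub>W\<^esub> y) = ?g x \<oplus>\<^bsub>V\<^esub> ?g y" if "x \<in> carrier W" "y \<in> carrier W" for x y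
      using that g by (intro inj) simp_all
    show "?g (r \<odot>\<^bsub>W\<^esub> x) = r \<odot>\<^bsub>V\<^esub> ?g x" if "r \<in> carrier K" "x \<in> carrier W" for r x
      using that g by (intro inj) simp_all
  qed (rule g)
  then interpret g: linear_map K W V ?g
    by (rule linear_mapI[OF W V])
  have img: "f ` carrier V = carrier W"
    using bij by (simp add: bij_betw_def)
  have img': "?g ` carrier W = carrier V"
    using bij_betw_inv_into[OF bij] by (simp add: bij_betw_def)
  show ?thesis
  proof (cases "vectorspace.fin_dim K V")
    case True
    then show ?thesis
      using bij by (intro f.dim_eq) (simp_all add: bij_betw_def)
  next
    \<comment> \<open>Neither space has a finite spanning set, so both dimensions are defined by the
      same predicate, satisfied by no number.\<close>
    case False
    then have "\<not> vectorspace.fin_dim K W"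
      using g.surj_fin_dim img' by blast
    with False have "(\<exists>A. finite A \<and> card A = k \<and> A \<subseteq> carrier V \<and> LinearCombinations.module.span K V A = carrier V)
        = (\<exists>A. finite A \<and> card A = k \<and> A \<subseteq> carrier W \<and> LinearCombinations.module.span K W A = carrier W)" for k
      unfolding f.V.fin_dim_def f.W.fin_dim_def by blast
    then show ?thesis
      by (simp only: f.V.dim_def f.W.dim_def)
  qed
qed

text \<open>The image of a basis of \<open>V\<close> is independent and has as many elements as the
  dimension of \<open>W\<close>, hence is a basis of \<open>W\<close>.\<close>

lemma linear_inj_surj:
  assumes V: "vectorspace K V" and W: "vectorspace K W" and f: "f \<in> module_hom K V W"
    and inj: "inj_on f (carrier V)" and fin: "vectorspace.fin_dim K V" "vectorspace.fin_dim K W"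
    and dim: "vectorspace.dim K V = vectorspace.dim K W"
  shows "f ` carrier V = carrier W"
proof -
  interpret f: linear_map K V W f
    by (rule linear_mapI[OF V W f])
  let ?N = "f ` carrier V"
  have im: "f.im = ?N"
    by (simp add: f.im_def)
  have sub: "LinearCombinations.submodule K ?N W"
    using f.im_is_submodule by (simp add: im)
  have N: "vectorspace K (W\<lparr>carrier := ?N\<rparr>)"
    using f.W.subspace_is_vs[OF f.imT_is_subspace] by (simp add: im)
  have "f \<in> module_hom K V (W\<lparr>carrier := ?N\<rparr>)"
    by (rule module_homI) simp_all
  then interpret h: linear_map K V "W\<lparr>carrier := ?N\<rparr>" f
    by (rule linear_mapI[OF V N])
  obtain B where B: "finite B" "f.V.basis B"
    using f.V.finite_basis_exists[OF fin(1)] by blast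
  have basis: "h.W.basis (f ` B)"
    using inj B fin(1) by (intro h.linear_inj_image_is_basis) simp_all
  have subN: "f ` B \<subseteq> ?N"
    using B(2) unfolding f.V.basis_def by blast
  have NW: "?N \<subseteq> carrier W"
    using f.f_im by blast
  have injB: "inj_on f B"
    using inj B(2) unfolding f.V.basis_def by (blast intro: inj_on_subset)
  have "f.W.basis (f ` B)"
  proof (rule f.W.dim_li_is_basis[OF fin(2)])
    show "finite (f ` B)"
      using B by simp
    show "f ` B \<subseteq> carrier W"
      using subN NW by blast
    \<comment> \<open>Independence is known inside the image \<open>?N\<close> and is the same in
      the ambient space.\<close>
    show "\<not> LinearCombinations.module.lin_dep K W (f ` B)"
      using basis f.W.module.span_li_not_depend(2)[OF subN sub] unfolding h.W.basis_def by simp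
    show "vectorspace.dim K W \<le> card (f ` B)"
      using f.V.dim_basis[OF B] dim card_image[OF injB] by simp
  qed
  then have "carrier W = LinearCombinations.module.span K W (f ` B)"
    unfolding f.W.basis_def by simp
  also have "\<dots> = LinearCombinations.module.span K (W\<lparr>carrier := ?N\<rparr>) (f ` B)"
    using f.W.module.span_li_not_depend(1)[OF subN sub] by simp
  also have "\<dots> = ?N"
    using basis unfolding h.W.basis_def by simp
  finally show ?thesis
    by simp
qed

lemma ring_module_simps [simp]:
  "carrier (ring_module A) = carrier A" "x \<oplus>\<^bsub>ring_module A\<^esub> y = x \<oplus>\<^bsub>A\<^esub> y"
  "a \<odot>\<^bsub>ring_module A\<^esub> x = a \<otimes>\<^bsub>A\<^esub> x" "\<zero>\<^bsub>ring_module A\<^esub> = \<zero>\<^bsub>A\<^esub>"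
  by (simp_all add: ring_module_def)

lemma ring_module_is_module:
  fixes A :: "'a ring"
  assumes "cring A"
  shows "Module.module A (ring_module A)"
proof -
  interpret cring A by fact
  show ?thesis
  proof (rule module_criteria)
    show "\<forall>v\<in>carrier (ring_module A). \<exists>w\<in>carrier (ring_module A). v \<oplus>\<^bsub>ring_module A\<^esub> w = \<zero>\<^bsub>ring_module A\<^esub>"
      using r_neg by auto
  qed (simp_all add: is_cring a_ac m_assoc l_distr r_distr)
qed

lemma const_hom: "const c + const c' = const (c + c')" "const c * const c' = const (c * c')" "const 1 = 1"
  by (simp_all add: const_def single_add mult_single)

context poly_quotient
begin

lemma scalar_hom: "\<phi> \<in> ring_hom ring_of_type_algebra A"
  by (rule ring_hom_memI) (simp_all add: const_hom(3) const_hom(1,2)[symmetric])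

lemma const_theta: "g \<in> Pvec \<Longrightarrow> \<phi> c \<odot>\<^bsub>\<Omega>\<^esub> \<theta> g = \<theta> (\<lambda>j. const c * g j)"
  by (simp add: theta_smult)

end

text \<open>A monomial is determined by its exponents up to \<open>n\<close>, each at most
  \<open>d\<close>; restricting the exponent function to these indices lands in a finite
  product.\<close>

lemma finite_monomials: "finite {m. Poly_Mapping.keys m \<subseteq> {..n} \<and> mon_deg m = d}" (is "finite ?M")
proof (rule finite_imageD)
  let ?f = "\<lambda>m. restrict (Poly_Mapping.lookup m) {..n}"
  have "?f m \<in> {..n} \<rightarrow>\<^sub>E {..d}" if "m \<in> ?M" for m
  proof (rule restrict_PiE_iff[THEN iffD2], rule ballI)
    fix j assume "j \<in> {..n}"
    then have "Poly_Mapping.lookup m j \<le> (\<Sum>j\<le>n. Poly_Mapping.lookup m j)"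
      by (intro member_le_sum) auto
    then show "Poly_Mapping.lookup m j \<in> {..d}"
      using that mon_deg_superset[of "{..n}" m] by simp
  qed
  then have "?f ` ?M \<subseteq> {..n} \<rightarrow>\<^sub>E {..d}"
    by blast
  then show "finite (?f ` ?M)"
    by (rule finite_subset) (intro finite_PiE finite_atMost)
  show "inj_on ?f ?M"
  proof (rule inj_onI)
    fix a b assume a: "a \<in> ?M" and b: "b \<in> ?M" and eq: "?f a = ?f b"
    show "a = b"
    proof (rule poly_mapping_eqI)
      fix j
      show "Poly_Mapping.lookup a j = Poly_Mapping.lookup b j"
      proof (cases "j \<le> n")
        case True
        then show ?thesis
          using fun_cong[OF eq, of j] by simp
      next
        case False
        then have "j \<notin> Poly_Mapping.keys a" "j \<notin> Poly_Mapping.keys b"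
          using a b by auto
        then show ?thesis
          by (simp add: in_keys_iff)
      qed
    qed
  qed
qed

section \<open>The rings \<open>R\<close> and \<open>S\<close> as quotients of the polynomial
  ring\<close>

context affine_scheme
begin

lemma I_ideal: "ideal I (poly_ring n)"
  using homogeneous by (simp add: homogeneous_ideal_def)

sublocale R: poly_quotient "coord_ring n I" n "coord_class n I"
proof -
  interpret I: ideal I "poly_ring n"
    by (rule I_ideal)
  interpret cring "coord_ring n I"
    unfolding coord_ring_def by (rule I.quotient_is_cring[OF cring_poly_ring])
  show "poly_quotient (coord_ring n I) n (coord_class n I)"
  proof unfold_locales
    show "coord_class n I \<in> ring_hom (poly_ring n) (coord_ring n I)"
      using I.rcos_ring_hom unfolding coord_ring_def coord_class_def .
    show "coord_class n I ` carrier (poly_ring n) = carrier (coord_ring n I)"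
      by (auto simp: coord_ring_def coord_class_def FactRing_def A_RCOSETS_def')
  qed
qed

lemma R_zero: "\<zero>\<^bsub>coord_ring n I\<^esub> = I"
  by (simp add: coord_ring_def FactRing_def)

lemma R_J: "R.J = I"
proof -
  interpret I: ideal I "poly_ring n"
    by (rule I_ideal)
  have "f \<in> I" if "f \<in> P" "coord_class n I f = I" for f
    using I.a_rcos_self[OF that(1)] that(2) by (simp add: coord_class_def)
  moreover have "coord_class n I f = I" if "f \<in> I" for f
    unfolding coord_class_def using that by (rule I.a_rcos_const)
  ultimately show ?thesis
    using I_P unfolding R.J_def R_zero by blast
qed

lemma R_carrier: "r \<in> carrier (coord_ring n I) \<Longrightarrow> \<exists>p\<in>P. r = coord_class n I p"
  using R.surj by blast

abbreviation affine_class :: "'k mpol \<Rightarrow> 'k mpol set set"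
  where "affine_class f \<equiv> affine_ideal n I +>\<^bsub>coord_ring n I\<^esub> coord_class n I f"

text \<open>The ideal is principal, and each multiple of \<open>x0 - 1\<close> in \<open>R\<close>
  lifts to a multiple of \<open>X0 - 1\<close> in \<open>P\<close>.\<close>

lemma affine_ideal_iff:
  assumes f: "f \<in> P"
  shows "coord_class n I f \<in> affine_ideal n I \<longleftrightarrow> f \<in> Iaff"
proof -
  let ?x = "coord_var n I 0 \<ominus>\<^bsub>coord_ring n I\<^esub> \<one>\<^bsub>coord_ring n I\<^esub>"
  have x: "?x = coord_class n I (X0 - 1)"
    by simp
  have xc: "?x \<in> carrier (coord_ring n I)"
    unfolding x by (intro R.pi_closed poly_ring_closed X0_closed)
  have "affine_ideal n I = {r \<otimes>\<^bsub>coord_ring n I\<^esub> ?x | r. r \<in> carrier (coord_ring n I)}"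
    unfolding affine_ideal_def R.cgenideal_eq_genideal[OF xc, symmetric] cgenideal_def ..
  also have "\<dots> = {coord_class n I ((X0 - 1) * b) | b. b \<in> P}"
  proof (intro equalityI subsetI)
    fix y assume "y \<in> {r \<otimes>\<^bsub>coord_ring n I\<^esub> ?x | r. r \<in> carrier (coord_ring n I)}"
    then obtain r where "r \<in> carrier (coord_ring n I)" "y = r \<otimes>\<^bsub>coord_ring n I\<^esub> ?x"
      by blast
    moreover then obtain b where "b \<in> P" "r = coord_class n I b"
      using R_carrier by blast
    ultimately have "b \<in> P" "y = coord_class n I ((X0 - 1) * b)"
      unfolding x by (simp_all add: mult.commute[of _ b] del: R.pi_minus)
    then show "y \<in> {coord_class n I ((X0 - 1) * b) | b. b \<in> P}"
      by blast
  next
    fix y assume "y \<in> {coord_class n I ((X0 - 1) * b) | b. b \<in> P}"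
    then obtain b where b: "b \<in> P" "y = coord_class n I ((X0 - 1) * b)"
      by blast
    then have "y = coord_class n I b \<otimes>\<^bsub>coord_ring n I\<^esub> ?x"
      unfolding x by (simp add: mult.commute[of _ b] del: R.pi_minus)
    then show "y \<in> {r \<otimes>\<^bsub>coord_ring n I\<^esub> ?x | r. r \<in> carrier (coord_ring n I)}"
      using R.pi_closed[OF b(1)] by blast
  qed
  finally have "coord_class n I f \<in> affine_ideal n I \<longleftrightarrow>
      (\<exists>b\<in>P. coord_class n I f = coord_class n I ((X0 - 1) * b))"
    by blast
  also have "\<dots> \<longleftrightarrow> (\<exists>b\<in>P. f - (X0 - 1) * b \<in> I)"
  proof (intro bex_cong refl)
    fix b assume "b \<in> P"
    then have "(X0 - 1) * b \<in> P"
      by (intro poly_ring_closed X0_closed)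
    then show "coord_class n I f = coord_class n I ((X0 - 1) * b) \<longleftrightarrow> f - (X0 - 1) * b \<in> I"
      using R.pi_eq_iff[OF f] by (simp only: R_J)
  qed
  also have "\<dots> \<longleftrightarrow> f \<in> Iaff"
    using f by (simp add: Iaff_def)
  finally show ?thesis .
qed

lemma affine_ideal_ideal: "ideal (affine_ideal n I) (coord_ring n I)"
  unfolding affine_ideal_def
proof (rule R.genideal_ideal)
  show "{coord_var n I 0 \<ominus>\<^bsub>coord_ring n I\<^esub> \<one>\<^bsub>coord_ring n I\<^esub>} \<subseteq> carrier (coord_ring n I)"
    using R.pi_closed[OF X0_closed] R.minus_closed[OF _ R.one_closed] by blast
qed

text \<open>\<open>S\<close> is presented directly by \<open>P\<close>, through the composite
  \<open>P \<rightarrow> R \<rightarrow> S\<close>, so that its differentials are given by the same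
  vectors as those of \<open>R\<close>.\<close>

sublocale S: poly_quotient "affine_ring n I" n affine_class
proof -
  interpret I: ideal "affine_ideal n I" "coord_ring n I"
    by (rule affine_ideal_ideal)
  interpret cring "affine_ring n I"
    unfolding affine_ring_def by (rule I.quotient_is_cring[OF R.is_cring])
  show "poly_quotient (affine_ring n I) n affine_class"
  proof unfold_locales
    have "(+>\<^bsub>coord_ring n I\<^esub>) (affine_ideal n I) \<circ> coord_class n I \<in> ring_hom (poly_ring n) (affine_ring n I)"
      unfolding affine_ring_def by (rule ring_hom_trans[OF R.hom I.rcos_ring_hom])
    then show "affine_class \<in> ring_hom (poly_ring n) (affine_ring n I)"
      by (simp add: comp_def)
    have "affine_class ` P = (+>\<^bsub>coord_ring n I\<^esub>) (affine_ideal n I) ` carrier (coord_ring n I)"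
      unfolding R.surj[symmetric] by (simp add: image_image)
    also have "\<dots> = carrier (affine_ring n I)"
      by (auto simp: affine_ring_def FactRing_def A_RCOSETS_def')
    finally show "affine_class ` P = carrier (affine_ring n I)" .
  qed
qed

lemma S_J: "S.J = Iaff"
proof -
  interpret I: ideal "affine_ideal n I" "coord_ring n I"
    by (rule affine_ideal_ideal)
  have zero: "\<zero>\<^bsub>affine_ring n I\<^esub> = affine_ideal n I"
    by (simp add: affine_ring_def FactRing_def)
  have "affine_class f = affine_ideal n I \<longleftrightarrow> f \<in> Iaff" if "f \<in> P" for f
    using I.a_rcos_self[OF R.pi_closed[OF that]] I.a_rcos_const[of "coord_class n I f"]
      affine_ideal_iff[OF that] by auto
  moreover have "f \<in> P" if "f \<in> Iaff" for f
    using that by (rule IaffE)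
  ultimately show ?thesis
    unfolding S.J_def zero by blast
qed

lemma affine_const_eq: "affine_const n I = (\<lambda>c. affine_class (const c))"
  by (simp add: affine_const_def fun_eq_iff)

end

context affine_scheme
begin

section \<open>Hilbert function and regularity index\<close>

abbreviation "degree_space d \<equiv>
  (restrict_scalars (coord_const n I) (ring_module (coord_ring n I)))\<lparr>carrier := coord_piece n I d\<rparr>"

abbreviation "affine_space \<equiv>
  (restrict_scalars (affine_const n I) (ring_module (affine_ring n I)))\<lparr>carrier := carrier (affine_ring n I)\<rparr>"

lemma coord_pieceE:
  assumes "r \<in> coord_piece n I d"
  obtains f where "f \<in> H d" "f \<in> P" "r = coord_class n I f"
  using assms homog_closed unfolding coord_piece_def by blast

lemma coord_pieceI: "f \<in> H d \<Longrightarrow> coord_class n I f \<in> coord_piece n I d"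
  unfolding coord_piece_def by blast

lemma coord_class_eq_iff: "f \<in> P \<Longrightarrow> g \<in> P \<Longrightarrow> coord_class n I f = coord_class n I g \<longleftrightarrow> f - g \<in> I"
  using R.pi_eq_iff R_J by simp

lemma coord_class_add:
  "f \<in> P \<Longrightarrow> g \<in> P \<Longrightarrow> coord_class n I f \<oplus>\<^bsub>coord_ring n I\<^esub> coord_class n I g = coord_class n I (f + g)"
  by simp

lemma coord_class_mult:
  "f \<in> P \<Longrightarrow> g \<in> P \<Longrightarrow> coord_class n I f \<otimes>\<^bsub>coord_ring n I\<^esub> coord_class n I g = coord_class n I (f * g)"
  by simp

lemma affine_class_eq_iff: "f \<in> P \<Longrightarrow> g \<in> P \<Longrightarrow> affine_class f = affine_class g \<longleftrightarrow> f - g \<in> Iaff"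
  using S.pi_eq_iff S_J by simp

lemma degree_space_vectorspace: "vectorspace ring_of_type_algebra (degree_space d)"
proof (rule subspace_vectorspace[OF ring_module_is_module[OF R.is_cring] R.scalar_hom])
  show "coord_piece n I d \<subseteq> carrier (ring_module (coord_ring n I))"
    using R.pi_closed by (auto elim!: coord_pieceE)
  show "\<zero>\<^bsub>ring_module (coord_ring n I)\<^esub> \<in> coord_piece n I d"
    using coord_pieceI[of 0 d] by simp
  show "x \<oplus>\<^bsub>ring_module (coord_ring n I)\<^esub> y \<in> coord_piece n I d"
    if "x \<in> coord_piece n I d" "y \<in> coord_piece n I d" for x y
    using that by (auto elim!: coord_pieceE simp: coord_class_add simp del: R.pi_add intro!: coord_pieceI homog_add)
  show "coord_const n I c \<odot>\<^bsub>ring_module (coord_ring n I)\<^esub> x \<in> coord_piece n I d"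
    if "x \<in> coord_piece n I d" for c x
    using that by (auto elim!: coord_pieceE simp: coord_class_mult simp del: R.pi_mult
        intro!: coord_pieceI homog_const_mult)
qed

lemma affine_space_vectorspace: "vectorspace ring_of_type_algebra affine_space"
  unfolding affine_const_eq
  by (rule subspace_vectorspace[OF ring_module_is_module[OF S.is_cring] S.scalar_hom]) simp_all

text \<open>The classes of the finitely many monomials of degree \<open>d\<close> span. Finite
  dimension later turns injectivity of multiplication by \<open>x0\<close> into
  surjectivity.\<close>

lemma degree_space_fin_dim: "vectorspace.fin_dim ring_of_type_algebra (degree_space d)"
proof -
  interpret V: vectorspace "ring_of_type_algebra :: 'k ring" "degree_space d"
    by (rule degree_space_vectorspace)
  let ?M = "{m. Poly_Mapping.keys m \<subseteq> {..n} \<and> mon_deg m = d}"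
  let ?B = "(\<lambda>m. coord_class n I (Poly_Mapping.single m 1)) ` ?M"
  have fin: "finite ?B"
    using finite_monomials by (rule finite_imageI)
  have B: "?B \<subseteq> carrier (degree_space d)"
    by (auto intro!: coord_pieceI single_homog)
  interpret span: LinearCombinations.submodule "ring_of_type_algebra :: 'k ring" "V.span ?B" "degree_space d"
    by (rule V.span_is_submodule[OF B])
  have "coord_class n I f \<in> V.span ?B" if "f \<in> H d" for f
  proof -
    have "f \<in> P \<and> coord_class n I f \<in> V.span ?B"
      using that
    proof (induction f rule: homog_induct)
      case zero
      show ?case
        using span.zero_closed by simp
    next
      case (single m c)
      have s: "Poly_Mapping.single m 1 \<in> P"
        using single by (auto simp: carrier_poly_ring)
      have "coord_class n I (Poly_Mapping.single m 1) \<in> V.span ?B"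
        using single V.in_own_span[OF B] by blast
      then have "c \<odot>\<^bsub>degree_space d\<^esub> coord_class n I (Poly_Mapping.single m 1) \<in> V.span ?B"
        by (intro span.smult_closed) simp_all
      moreover have "c \<odot>\<^bsub>degree_space d\<^esub> coord_class n I (Poly_Mapping.single m 1)
          = coord_class n I (Poly_Mapping.single m c)"
      proof -
        have "const c * Poly_Mapping.single m 1 = Poly_Mapping.single m c"
          by (simp add: const_def mult_single)
        then show ?thesis
          using coord_class_mult[OF poly_ring_closed(3) s, of c] by (simp del: R.pi_mult)
      qed
      ultimately show ?case
        using single by (auto simp: carrier_poly_ring)
    next
      case (add p q)
      then have "coord_class n I p \<oplus>\<^bsub>degree_space d\<^esub> coord_class n I q \<in> V.span ?B"
        by (intro span.m_closed) simp_all
      then show ?case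
        using add by simp
    qed
    then show ?thesis ..
  qed
  then have "carrier (degree_space d) \<subseteq> V.span ?B"
    by (auto elim!: coord_pieceE)
  then have "V.span ?B = carrier (degree_space d)"
    using V.span_is_subset2[OF B] by blast
  then show ?thesis
    unfolding V.fin_dim_def using fin B by blast
qed

text \<open>In high degrees \<open>R_d \<rightarrow> S\<close> is an isomorphism. This gives a
  meaning to the \<open>LEAST\<close> in the definition of the regularity index.\<close>

lemma hilbert_fun_eventually: "\<exists>r. \<forall>i\<ge>r. hilbert_fun n I i = scheme_deg n I"
proof -
  obtain D where "\<forall>d\<ge>D. \<forall>f\<in>H (Suc d). \<exists>g\<in>H d. f - X0 * g \<in> I"
    using high_degree_reduce by blast
  then have D: "eventually_surj D"
    by (simp add: eventually_surj_def)
  have "hilbert_fun n I d = scheme_deg n I" if d: "d \<ge> D" for d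
    unfolding hilbert_fun_def scheme_deg_def subspace_dim_def
  proof (rule vectorspace_dim_bij[OF degree_space_vectorspace affine_space_vectorspace])
    let ?f = "(+>\<^bsub>coord_ring n I\<^esub>) (affine_ideal n I)"
    show "?f \<in> module_hom ring_of_type_algebra (degree_space d) affine_space"
    proof (rule module_homI)
      fix x assume "x \<in> carrier (degree_space d)"
      then obtain f where f: "f \<in> H d" "f \<in> P" "x = coord_class n I f"
        by (auto elim: coord_pieceE)
      show "?f x \<in> carrier affine_space"
        using S.pi_closed[OF f(2)] by (simp add: f(3))
      show "?f (x \<oplus>\<^bsub>degree_space d\<^esub> y) = ?f x \<oplus>\<^bsub>affine_space\<^esub> ?f y" if y: "y \<in> carrier (degree_space d)" for y
      proof -
        obtain g where g: "g \<in> H d" "g \<in> P" "y = coord_class n I g"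
          using y by (auto elim: coord_pieceE)
        show ?thesis
          using S.pi_add[OF f(2) g(2)] coord_class_add[OF f(2) g(2)] by (simp add: f(3) g(3) del: S.pi_add R.pi_add)
      qed
      show "?f (c \<odot>\<^bsub>degree_space d\<^esub> x) = c \<odot>\<^bsub>affine_space\<^esub> ?f x" for c
        using S.pi_mult[OF poly_ring_closed(3) f(2), of c] coord_class_mult[OF poly_ring_closed(3) f(2), of c]
        by (simp add: f(3) affine_const_eq del: S.pi_mult R.pi_mult)
    qed
    show "bij_betw ?f (carrier (degree_space d)) (carrier affine_space)"
    proof (rule bij_betw_imageI)
      show "inj_on ?f (carrier (degree_space d))"
      proof (rule inj_onI)
        fix x y assume "x \<in> carrier (degree_space d)" "y \<in> carrier (degree_space d)" and eq: "?f x = ?f y"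
        then obtain f g where f: "f \<in> H d" "f \<in> P" "x = coord_class n I f"
          and g: "g \<in> H d" "g \<in> P" "y = coord_class n I g"
          by (auto elim!: coord_pieceE)
        have "f - g \<in> Iaff"
          using eq affine_class_eq_iff[OF f(2) g(2)] by (simp add: f(3) g(3))
        then have "f - g \<in> I"
          by (rule homog_Iaff[OF homog_minus[OF f(1) g(1)]])
        then show "x = y"
          using coord_class_eq_iff[OF f(2) g(2)] by (simp add: f(3) g(3))
      qed
      have "y \<in> ?f ` coord_piece n I d" if y: "y \<in> carrier (affine_ring n I)" for y
      proof -
        obtain f where f: "y = affine_class f" "f \<in> P"
          using y unfolding S.surj[symmetric] by (rule imageE)
        obtain g where g: "g \<in> H d" "f - g \<in> Iaff"
          using eventually_surj_representative[OF D d f(2)] by (rule bexE)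
        have "y = affine_class g"
          using affine_class_eq_iff[OF f(2) homog_closed[OF g(1)]] g(2) f(1) by simp
        then show ?thesis
          by (rule image_eqI[OF _ coord_pieceI[OF g(1)]])
      qed
      moreover have "?f x \<in> carrier (affine_ring n I)" if "x \<in> coord_piece n I d" for x
        using that S.pi_closed by (auto elim!: coord_pieceE)
      ultimately show "?f ` carrier (degree_space d) = carrier affine_space"
        by auto
    qed
  qed
  then show ?thesis
    by blast
qed

text \<open>From the regularity index on, consecutive pieces of \<open>R\<close> have the same
  finite dimension, and multiplication by \<open>x0\<close> is injective, hence onto. This replaces
  the crude bound by the one in the statement.\<close>

lemma regularity_surj: "eventually_surj (regularity_index n I)"
proof -
  have r: "\<forall>i\<ge>regularity_index n I. hilbert_fun n I i = scheme_deg n I"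
    unfolding regularity_index_def using hilbert_fun_eventually by (rule LeastI_ex)
  have "\<exists>g\<in>H d. f - X0 * g \<in> I" if d: "d \<ge> regularity_index n I" and f: "f \<in> H (Suc d)" for d f
  proof -
    let ?m = "\<lambda>x. coord_var n I 0 \<otimes>\<^bsub>coord_ring n I\<^esub> x"
    have X: "X0 * g \<in> H (Suc d)" if "g \<in> H d" for g
      using homog_mult[OF homog_var[of 0 n] that] by simp
    have "?m ` carrier (degree_space d) = carrier (degree_space (Suc d))"
    proof (rule linear_inj_surj[OF degree_space_vectorspace degree_space_vectorspace])
      show "?m \<in> module_hom ring_of_type_algebra (degree_space d) (degree_space (Suc d))"
      proof (rule module_homI)
        fix x assume "x \<in> carrier (degree_space d)"
        then obtain f where f: "f \<in> H d" "f \<in> P" "x = coord_class n I f"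
          by (auto elim: coord_pieceE)
        have xc: "x \<in> carrier (coord_ring n I)" "coord_var n I 0 \<in> carrier (coord_ring n I)"
          using f by auto
        show "?m x \<in> carrier (degree_space (Suc d))"
          using coord_pieceI[OF X[OF f(1)]] coord_class_mult[OF X0_closed f(2)]
          by (simp add: f(3) del: R.pi_mult)
        show "?m (x \<oplus>\<^bsub>degree_space d\<^esub> y) = ?m x \<oplus>\<^bsub>degree_space (Suc d)\<^esub> ?m y"
          if y: "y \<in> carrier (degree_space d)" for y
        proof -
          obtain g where g: "g \<in> H d" "g \<in> P" "y = coord_class n I g"
            using y by (auto elim: coord_pieceE)
          then have "y \<in> carrier (coord_ring n I)"
            by auto
          then show ?thesis
            using xc by (simp add: R.r_distr)
        qed
        show "?m (c \<odot>\<^bsub>degree_space d\<^esub> x) = c \<odot>\<^bsub>degree_space (Suc d)\<^esub> ?m x" for c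
          using xc R.pi_closed[OF poly_ring_closed(3), of c] by (simp add: R.m_lcomm)
      qed
      show "inj_on ?m (carrier (degree_space d))"
      proof (rule inj_onI)
        fix x y assume "x \<in> carrier (degree_space d)" "y \<in> carrier (degree_space d)" and eq: "?m x = ?m y"
        then obtain f g where f: "f \<in> H d" "f \<in> P" "x = coord_class n I f"
          and g: "g \<in> H d" "g \<in> P" "y = coord_class n I g"
          by (auto elim!: coord_pieceE)
        have "X0 * f - X0 * g \<in> I"
          using eq coord_class_eq_iff[of "X0 * f" "X0 * g"] f g by simp
        then have "X0 * (f - g) \<in> I"
          by (simp add: algebra_simps)
        then have "f - g \<in> I"
          by (rule X0_cancel[OF poly_ring_closed(8)[OF f(2) g(2)]])
        then show "x = y"
          using coord_class_eq_iff[OF f(2) g(2)] by (simp add: f(3) g(3))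
      qed
      show "vectorspace.dim ring_of_type_algebra (degree_space d) =
          vectorspace.dim ring_of_type_algebra (degree_space (Suc d))"
        using r d by (simp add: hilbert_fun_def subspace_dim_def)
    qed (rule degree_space_fin_dim)+
    then have "coord_class n I f \<in> ?m ` coord_piece n I d"
      using coord_pieceI[OF f] by simp
    then obtain x where x: "x \<in> coord_piece n I d" "coord_class n I f = ?m x"
      by blast
    obtain g where g: "g \<in> H d" "g \<in> P" "x = coord_class n I g"
      using x(1) by (rule coord_pieceE)
    have "coord_class n I f = coord_class n I (X0 * g)"
      using x(2) g by simp
    then have "f - X0 * g \<in> I"
      using coord_class_eq_iff[OF homog_closed[OF f] poly_ring_closed(6)[OF X0_closed g(2)]] by simp
    then show ?thesis
      using g(1) by blast
  qed
  then show ?thesis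
    by (simp add: eventually_surj_def)
qed

section \<open>The Euler form\<close>

lemma Omega_coord_eq: "Omega_coord n I = R.\<Omega>"
  by (simp add: Omega_coord_def)

lemma d_coord_eq: "d_coord n I = R.d"
  by (simp add: d_coord_def)

lemma Omega_affine_eq: "Omega_affine n I = S.\<Omega>"
  unfolding Omega_affine_def affine_const_eq ..

text \<open>By homogeneity each component of \<open>f\<close> is in \<open>I\<close>, and Euler's
  identity turns it into an integer multiple of itself. Hence the Euler form respects the relations
  that come from gradients.\<close>

lemma euler_sum_I:
  assumes "f \<in> I"
  shows "(\<Sum>j\<le>n. var j * pdiff j f) \<in> I"
proof -
  obtain N where N: "\<forall>m\<in>Poly_Mapping.keys f. mon_deg m \<le> N"
    using deg_bound by blast
  have "(\<Sum>j\<le>n. var j * pdiff j (\<Sum>d\<le>N. hom_comp d f)) = (\<Sum>d\<le>N. \<Sum>j\<le>n. var j * pdiff j (hom_comp d f))"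
    by (simp only: pdiff_sum sum_distrib_left) (rule sum.swap)
  also have "\<dots> = (\<Sum>d\<le>N. of_nat d * hom_comp d f)"
    using I_P[OF assms] by (intro sum.cong refl euler_identity hom_comp_in_homog)
  also have "\<dots> \<in> I"
    unfolding const_of_nat[symmetric] using assms by (intro I_sum I_mult I_hom_comp poly_ring_closed)
  finally show ?thesis
    unfolding sum_hom_comp[OF N] .
qed

definition "euler_sum g = coord_class n I (\<Sum>j\<le>n. var j * g j)"

lemma euler_sum_closed: "g \<in> R.Pvec \<Longrightarrow> (\<Sum>j\<le>n. var j * g j) \<in> P"
  by (intro poly_ring_sum_closed poly_ring_closed R.PvecD) auto

lemma euler_sum_cong:
  assumes "g \<in> R.Pvec" "h \<in> R.Pvec" "R.\<theta> g = R.\<theta> h"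
  shows "euler_sum g = euler_sum h"
proof -
  have "(\<lambda>j. g j - h j) \<in> R.U"
    using assms R.theta_eq_iff by simp
  then obtain f where f: "f \<in> I" "\<And>j. j \<le> n \<Longrightarrow> (g j - h j) - pdiff j f \<in> I"
    by (rule R.UE[unfolded R_J]) (rule that)
  have "(\<Sum>j\<le>n. var j * ((g j - h j) - pdiff j f)) + (\<Sum>j\<le>n. var j * pdiff j f) \<in> I"
    using f(1) by (intro I_add I_sum I_mult euler_sum_I f(2)) auto
  then have "(\<Sum>j\<le>n. var j * g j) - (\<Sum>j\<le>n. var j * h j) \<in> I"
    by (simp add: algebra_simps sum_subtractf sum.distrib)
  then show ?thesis
    unfolding euler_sum_def
    using coord_class_eq_iff[OF euler_sum_closed[OF assms(1)] euler_sum_closed[OF assms(2)]] by simp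
qed

text \<open>The choice of \<open>g\<close> is harmless by \<open>euler_sum_cong\<close>; the
  restriction is there because \<open>euler_form\<close> is described as an extensional map.\<close>

definition "euler_map = restrict (\<lambda>w. euler_sum (SOME g. g \<in> R.Pvec \<and> R.\<theta> g = w)) (carrier R.\<Omega>)"

lemma euler_map_theta:
  assumes "g \<in> R.Pvec"
  shows "euler_map (R.\<theta> g) = euler_sum g"
proof -
  let ?h = "SOME h. h \<in> R.Pvec \<and> R.\<theta> h = R.\<theta> g"
  have "?h \<in> R.Pvec \<and> R.\<theta> ?h = R.\<theta> g"
    by (rule someI[of _ g]) (use assms in simp)
  then have "euler_sum ?h = euler_sum g"
    by (intro euler_sum_cong assms) simp_all
  then show ?thesis
    unfolding euler_map_def using R.theta_closed[OF assms] by simp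
qed

lemma R_thetaE:
  assumes "w \<in> carrier R.\<Omega>"
  obtains g where "g \<in> R.Pvec" "w = R.\<theta> g"
  using R.theta_surj[OF assms] by blast

lemma d_var_theta: "i \<le> n \<Longrightarrow> p \<in> P \<Longrightarrow> coord_class n I p \<odot>\<^bsub>R.\<Omega>\<^esub> R.d (coord_var n I i) = R.\<theta> (\<lambda>j. if j = i then p else 0)"
  by (rule R.theta_delta[symmetric])

lemma d_var_theta_1: "i \<le> n \<Longrightarrow> R.d (coord_var n I i) = R.\<theta> (\<lambda>j. if j = i then 1 else 0)"
  using d_var_theta[of i 1] R.dvar_closed by simp

lemma delta_Pvec: "p \<in> P \<Longrightarrow> (\<lambda>j. if j = i then p else 0) \<in> R.Pvec"
  by (simp add: R.Pvec_def)

lemma euler_sum_delta: "i \<le> n \<Longrightarrow> euler_sum (\<lambda>j. if j = i then p else 0) = coord_class n I (var i * p)"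
  by (simp add: euler_sum_def if_distrib cong: if_cong)

lemma coord_max_ideal: "ideal (coord_max n I) (coord_ring n I)"
  unfolding coord_max_def by (rule R.genideal_ideal) auto

text \<open>The description of \<open>euler_form\<close> asks for values in the ideal generated by
  the \<open>x_j\<close>, not just in \<open>R\<close>.\<close>

lemma euler_sum_max:
  assumes "g \<in> R.Pvec"
  shows "euler_sum g \<in> coord_max n I"
proof -
  interpret m: ideal "coord_max n I" "coord_ring n I"
    by (rule coord_max_ideal)
  have var: "coord_var n I j \<in> coord_max n I" if "j \<le> n" for j
    unfolding coord_max_def using that by (intro subsetD[OF R.genideal_self]) auto
  have "(\<Sum>j\<in>S. var j * g j) \<in> P \<and> coord_class n I (\<Sum>j\<in>S. var j * g j) \<in> coord_max n I"
    if "finite S" "S \<subseteq> {..n}" for S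
    using that
  proof (induction S rule: finite_induct)
    case empty
    show ?case
      using m.zero_closed by simp
  next
    case (insert j S)
    have j: "j \<le> n" "g j \<in> P" "var j \<in> P"
      using insert.prems R.PvecD[OF assms] by auto
    have "coord_class n I (var j * g j) \<in> coord_max n I"
      using m.I_r_closed[OF var[OF j(1)] R.pi_closed[OF j(2)]] coord_class_mult[OF j(3,2)] by simp
    then show ?case
      using insert j m.a_closed by simp
  qed
  then show ?thesis
    by (simp add: euler_sum_def)
qed

abbreviation "max_module \<equiv> (ring_module (coord_ring n I))\<lparr>carrier := coord_max n I\<rparr>"

lemma max_module_simps:
  "carrier max_module = coord_max n I" "x \<oplus>\<^bsub>max_module\<^esub> y = x \<oplus>\<^bsub>coord_ring n I\<^esub> y"
  "a \<odot>\<^bsub>max_module\<^esub> x = a \<otimes>\<^bsub>coord_ring n I\<^esub> x"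
  by (simp_all add: ring_module_def)

lemma euler_sum_add:
  assumes "g \<in> R.Pvec" "h \<in> R.Pvec"
  shows "euler_sum (\<lambda>j. g j + h j) = euler_sum g \<oplus>\<^bsub>coord_ring n I\<^esub> euler_sum h"
  unfolding euler_sum_def coord_class_add[OF euler_sum_closed[OF assms(1)] euler_sum_closed[OF assms(2)]]
  by (simp only: distrib_left sum.distrib)

lemma euler_sum_smult:
  assumes "p \<in> P" "g \<in> R.Pvec"
  shows "euler_sum (\<lambda>j. p * g j) = coord_class n I p \<otimes>\<^bsub>coord_ring n I\<^esub> euler_sum g"
  unfolding euler_sum_def coord_class_mult[OF assms(1) euler_sum_closed[OF assms(2)]]
  by (simp only: sum_distrib_left mult.left_commute)

lemma euler_map_hom: "euler_map \<in> module_hom (coord_ring n I) R.\<Omega> max_module"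
proof (rule module_homI, unfold max_module_simps)
  fix x assume "x \<in> carrier R.\<Omega>"
  then obtain g where g: "g \<in> R.Pvec" "x = R.\<theta> g"
    by (rule R_thetaE)
  show "euler_map x \<in> coord_max n I"
    using euler_sum_max[OF g(1)] euler_map_theta[OF g(1)] by (simp add: g(2))
  show "euler_map (x \<oplus>\<^bsub>R.\<Omega>\<^esub> y) = euler_map x \<oplus>\<^bsub>coord_ring n I\<^esub> euler_map y" if y: "y \<in> carrier R.\<Omega>" for y
  proof -
    obtain h where h: "h \<in> R.Pvec" "y = R.\<theta> h"
      using y by (rule R_thetaE)
    show ?thesis
      unfolding g(2) h(2) R.theta_add[OF g(1) h(1), symmetric] euler_map_theta[OF g(1)]
        euler_map_theta[OF h(1)] euler_map_theta[OF R.Pvec_add[OF g(1) h(1)]]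
      by (rule euler_sum_add[OF g(1) h(1)])
  qed
  show "euler_map (r \<odot>\<^bsub>R.\<Omega>\<^esub> x) = r \<otimes>\<^bsub>coord_ring n I\<^esub> euler_map x" if r: "r \<in> carrier (coord_ring n I)" for r
  proof -
    obtain p where p: "p \<in> P" "r = coord_class n I p"
      using R_carrier[OF r] by blast
    show ?thesis
      unfolding g(2) p(2) R.theta_smult[OF p(1) g(1), symmetric] euler_map_theta[OF g(1)]
        euler_map_theta[OF R.Pvec_smult[OF p(1) g(1)]]
      by (rule euler_sum_smult[OF p(1) g(1)])
  qed
qed

lemma euler_map_var:
  assumes "j \<le> n"
  shows "euler_map (R.d (coord_var n I j)) = coord_var n I j"
  unfolding d_var_theta_1[OF assms] euler_map_theta[OF delta_Pvec[OF poly_ring_closed(2)]]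
    euler_sum_delta[OF assms] by simp

text \<open>The \<open>dx_j\<close> generate, so their images determine a linear map. This is the
  uniqueness needed for the definite description of \<open>euler_form\<close>.\<close>

lemma euler_map_unique:
  assumes hom: "\<epsilon> \<in> module_hom (coord_ring n I) R.\<Omega> max_module"
    and var: "\<forall>j\<le>n. \<epsilon> (R.d (coord_var n I j)) = coord_var n I j" and g: "g \<in> R.Pvec"
  shows "\<epsilon> (R.\<theta> g) = euler_sum g"
proof -
  have add: "\<epsilon> (x \<oplus>\<^bsub>R.\<Omega>\<^esub> y) = \<epsilon> x \<oplus>\<^bsub>coord_ring n I\<^esub> \<epsilon> y" if "x \<in> carrier R.\<Omega>" "y \<in> carrier R.\<Omega>" for x y
    using module_hom_add[OF hom that] by (simp add: max_module_simps)
  have smult: "\<epsilon> (r \<odot>\<^bsub>R.\<Omega>\<^esub> x) = r \<otimes>\<^bsub>coord_ring n I\<^esub> \<epsilon> x"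
    if "r \<in> carrier (coord_ring n I)" "x \<in> carrier R.\<Omega>" for r x
    using module_hom_smult[OF hom that] by (simp add: max_module_simps)
  have single: "\<epsilon> (R.\<theta> (\<lambda>j. if j = i then p else 0)) = euler_sum (\<lambda>j. if j = i then p else 0)"
    if "i \<le> n" "p \<in> P" for i p
  proof -
    have "\<epsilon> (R.\<theta> (\<lambda>j. if j = i then p else 0)) = coord_class n I p \<otimes>\<^bsub>coord_ring n I\<^esub> coord_var n I i"
      unfolding d_var_theta[OF that, symmetric]
      using smult[OF R.pi_closed[OF that(2)] R.dvar_closed[OF that(1)]] var that(1) by simp
    then show ?thesis
      unfolding euler_sum_delta[OF that(1)] using that
      by (simp add: coord_class_mult mult.commute del: R.pi_mult)
  qed
  have "\<epsilon> (R.\<theta> (\<lambda>j. if j \<in> S then g j else 0)) = euler_sum (\<lambda>j. if j \<in> S then g j else 0)"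
    if "finite S" "S \<subseteq> {..n}" for S
    using that
  proof (induction S rule: finite_induct)
    case empty
    then show ?case
      using single[of 0 0] by simp
  next
    case (insert i S)
    have i: "i \<le> n" "g i \<in> P"
      using insert.prems R.PvecD[OF g] by auto
    have 1: "(\<lambda>j. if j = i then g i else 0) \<in> R.Pvec" "(\<lambda>j. if j \<in> S then g j else 0) \<in> R.Pvec"
      using i g by (auto simp: R.Pvec_def)
    have eq: "(\<lambda>j. if j \<in> insert i S then g j else 0) =
        (\<lambda>j. (if j = i then g i else 0) + (if j \<in> S then g j else 0))"
      using insert.hyps by (auto simp: fun_eq_iff)
    have IH: "\<epsilon> (R.\<theta> (\<lambda>j. if j \<in> S then g j else 0)) = euler_sum (\<lambda>j. if j \<in> S then g j else 0)"
      using insert.prems by (intro insert.IH) simp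
    show ?case
      unfolding eq R.theta_add[OF 1] euler_sum_add[OF 1] add[OF R.theta_closed[OF 1(1)] R.theta_closed[OF 1(2)]]
        single[OF i] IH ..
  qed
  from this[of "{..n}"] have *: "\<epsilon> (R.\<theta> (\<lambda>j. if j \<le> n then g j else 0)) = euler_sum (\<lambda>j. if j \<le> n then g j else 0)"
    by simp
  have "R.\<theta> (\<lambda>j. if j \<le> n then g j else 0) = R.\<theta> g"
    using g I_0 by (intro R.theta_cong) (simp_all add: R.Pvec_def R_J)
  moreover have "euler_sum (\<lambda>j. if j \<le> n then g j else 0) = euler_sum g"
    by (simp add: euler_sum_def)
  ultimately show ?thesis
    using * by simp
qed

lemma euler_form_eq: "euler_form n I = euler_map"
  unfolding euler_form_def Omega_coord_eq d_coord_eq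
proof (rule the_equality)
  show "euler_map \<in> extensional (carrier R.\<Omega>) \<and> euler_map \<in> module_hom (coord_ring n I) R.\<Omega> max_module \<and>
      (\<forall>j\<le>n. euler_map (R.d (coord_var n I j)) = coord_var n I j)"
    using euler_map_hom euler_map_var by (simp add: euler_map_def)
next
  fix \<epsilon>
  assume \<epsilon>: "\<epsilon> \<in> extensional (carrier R.\<Omega>) \<and> \<epsilon> \<in> module_hom (coord_ring n I) R.\<Omega> max_module \<and>
      (\<forall>j\<le>n. \<epsilon> (R.d (coord_var n I j)) = coord_var n I j)"
  show "\<epsilon> = euler_map"
  proof (rule extensionalityI)
    show "\<epsilon> \<in> extensional (carrier R.\<Omega>)" "euler_map \<in> extensional (carrier R.\<Omega>)"
      using \<epsilon> by (simp_all add: euler_map_def)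
    fix w assume "w \<in> carrier R.\<Omega>"
    then obtain g where g: "g \<in> R.Pvec" "w = R.\<theta> g"
      by (rule R_thetaE)
    show "\<epsilon> w = euler_map w"
      unfolding g(2) euler_map_theta[OF g(1)] using \<epsilon> g(1) by (intro euler_map_unique) simp_all
  qed
qed

lemma euler_ker_theta:
  assumes "g \<in> R.Pvec"
  shows "R.\<theta> g \<in> euler_ker n I \<longleftrightarrow> (\<Sum>j\<le>n. var j * g j) \<in> I"
proof -
  have "coord_class n I (\<Sum>j\<le>n. var j * g j) = coord_class n I 0 \<longleftrightarrow> (\<Sum>j\<le>n. var j * g j) - 0 \<in> I"
    by (rule coord_class_eq_iff[OF euler_sum_closed[OF assms]]) simp
  then show ?thesis
    unfolding euler_ker_def euler_form_eq Omega_coord_eq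
    using R.theta_closed[OF assms] euler_map_theta[OF assms] by (simp add: euler_sum_def)
qed

section \<open>Torsion and multiples of \<open>dx_0\<close>\<close>

lemma torsion_subset: "Omega_torsion n I \<subseteq> euler_ker n I"
proof
  fix w assume "w \<in> Omega_torsion n I"
  then obtain d r where w: "w \<in> carrier R.\<Omega>" and r: "r \<in> coord_piece n I d"
    and nzd: "non_zero_divisor (coord_ring n I) r" and rw: "r \<odot>\<^bsub>R.\<Omega>\<^esub> w = \<zero>\<^bsub>R.\<Omega>\<^esub>"
    unfolding Omega_torsion_def Omega_coord_eq by blast
  obtain g where g: "g \<in> R.Pvec" "w = R.\<theta> g"
    using w by (rule R_thetaE)
  obtain p where p: "p \<in> P" "r = coord_class n I p"
    using r by (rule coord_pieceE)
  have pg: "(\<lambda>j. p * g j) \<in> R.Pvec"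
    by (rule R.Pvec_smult[OF p(1) g(1)])
  have z: "(\<lambda>j. 0) \<in> R.Pvec"
    by (simp add: R.Pvec_def)
  have "R.\<theta> (\<lambda>j. p * g j) = R.\<theta> (\<lambda>j. 0)"
    using rw R.theta_smult[OF p(1) g(1)] R.theta_zero by (simp add: p(2) g(2))
  then have "euler_sum (\<lambda>j. p * g j) = euler_sum (\<lambda>j. 0)"
    by (rule euler_sum_cong[OF pg z])
  then have "r \<otimes>\<^bsub>coord_ring n I\<^esub> euler_sum g = \<zero>\<^bsub>coord_ring n I\<^esub>"
    unfolding euler_sum_smult[OF p(1) g(1)] p(2) by (simp add: euler_sum_def)
  moreover have "euler_sum g \<in> carrier (coord_ring n I)"
    unfolding euler_sum_def by (rule R.pi_closed[OF euler_sum_closed[OF g(1)]])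
  ultimately have "euler_sum g = \<zero>\<^bsub>coord_ring n I\<^esub>"
    using nzd unfolding non_zero_divisor_def by blast
  then show "w \<in> euler_ker n I"
    unfolding euler_ker_def euler_form_eq Omega_coord_eq g(2)
    using R.theta_closed[OF g(1)] euler_map_theta[OF g(1)] by simp
qed

text \<open>The Euler form maps \<open>r dx_0\<close> to \<open>r x0\<close>, and \<open>x0\<close>
  cancels. Both halves of (b) follow, since zero is in the kernel.\<close>

lemma d_X0_euler_ker:
  assumes r: "r \<in> carrier (coord_ring n I)" and ker: "r \<odot>\<^bsub>R.\<Omega>\<^esub> R.d (coord_var n I 0) \<in> euler_ker n I"
  shows "r = \<zero>\<^bsub>coord_ring n I\<^esub>"
proof -
  obtain p where p: "p \<in> P" "r = coord_class n I p"
    using R_carrier[OF r] by blast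
  have "R.\<theta> (\<lambda>j. if j = 0 then p else 0) \<in> euler_ker n I"
    using ker d_var_theta[of 0 p] p by simp
  then have "(\<Sum>j\<le>n. var j * (if j = 0 then p else 0)) \<in> I"
    by (simp only: euler_ker_theta[OF delta_Pvec[OF p(1)]])
  then have "X0 * p \<in> I"
    by (simp add: if_distrib cong: if_cong)
  then have "p \<in> I"
    by (rule X0_cancel[OF p(1)])
  then show ?thesis
    using coord_class_eq_iff[OF p(1) poly_ring_closed(1)] by (simp add: p(2))
qed

lemma zero_euler_ker: "\<zero>\<^bsub>R.\<Omega>\<^esub> \<in> euler_ker n I"
  using euler_ker_theta[of "\<lambda>j. 0"] R.theta_zero I_0 by (simp add: R.Pvec_def)

lemma annihilator_d_X0:
  "annihilator (coord_ring n I) (Omega_coord n I) (d_coord n I (coord_var n I 0)) = {\<zero>\<^bsub>coord_ring n I\<^esub>}"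
  unfolding annihilator_def Omega_coord_eq d_coord_eq
proof (intro equalityI subsetI)
  fix r assume "r \<in> {r \<in> carrier (coord_ring n I). r \<odot>\<^bsub>R.\<Omega>\<^esub> R.d (coord_var n I 0) = \<zero>\<^bsub>R.\<Omega>\<^esub>}"
  then show "r \<in> {\<zero>\<^bsub>coord_ring n I\<^esub>}"
    using d_X0_euler_ker[of r] zero_euler_ker by simp
next
  fix r assume "r \<in> {\<zero>\<^bsub>coord_ring n I\<^esub>}"
  then show "r \<in> {r \<in> carrier (coord_ring n I). r \<odot>\<^bsub>R.\<Omega>\<^esub> R.d (coord_var n I 0) = \<zero>\<^bsub>R.\<Omega>\<^esub>}"
    using R.dvar_closed[of 0] by simp
qed

lemma euler_ker_cyclic:
  "euler_ker n I \<inter> cyclic_submodule (coord_ring n I) (Omega_coord n I) (d_coord n I (coord_var n I 0))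
    = {\<zero>\<^bsub>Omega_coord n I\<^esub>}"
  unfolding cyclic_submodule_def Omega_coord_eq d_coord_eq
proof (intro equalityI subsetI)
  fix w assume "w \<in> euler_ker n I \<inter> {r \<odot>\<^bsub>R.\<Omega>\<^esub> R.d (coord_var n I 0) | r. r \<in> carrier (coord_ring n I)}"
  then obtain r where r: "r \<in> carrier (coord_ring n I)" "w = r \<odot>\<^bsub>R.\<Omega>\<^esub> R.d (coord_var n I 0)" "w \<in> euler_ker n I"
    by blast
  then have "r = \<zero>\<^bsub>coord_ring n I\<^esub>"
    using d_X0_euler_ker[of r] by simp
  then show "w \<in> {\<zero>\<^bsub>R.\<Omega>\<^esub>}"
    using R.dvar_closed[of 0] r(2) by simp
next
  fix w assume "w \<in> {\<zero>\<^bsub>R.\<Omega>\<^esub>}"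
  then have w: "w = \<zero>\<^bsub>R.\<Omega>\<^esub>"
    by simp
  have "w = coord_class n I 0 \<odot>\<^bsub>R.\<Omega>\<^esub> R.d (coord_var n I 0)"
    using R.dvar_closed[of 0] w by simp
  then have "\<exists>r. w = r \<odot>\<^bsub>R.\<Omega>\<^esub> R.d (coord_var n I 0) \<and> r \<in> carrier (coord_ring n I)"
    by (intro exI[of _ "coord_class n I 0"] conjI R.pi_closed poly_ring_closed)
  moreover have "w \<in> euler_ker n I"
    unfolding w by (rule zero_euler_ker)
  ultimately show "w \<in> euler_ker n I \<inter> {r \<odot>\<^bsub>R.\<Omega>\<^esub> R.d (coord_var n I 0) | r. r \<in> carrier (coord_ring n I)}"
    by (intro IntI CollectI)
qed

section \<open>Dehomogenising differentials\<close>

text \<open>Coefficients of degree \<open>i\<close> give differentials of degree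
  \<open>Suc i\<close>; from here on, degrees are those of the coefficients.\<close>

lemma Omega_piece_Suc: "Omega_piece n I (Suc i) = R.\<theta> ` {g. \<forall>j\<le>n. g j \<in> H i}"
proof (intro equalityI subsetI)
  fix w assume "w \<in> Omega_piece n I (Suc i)"
  then obtain r where r: "r \<in> {..n} \<rightarrow> coord_piece n I i"
    "w = (\<Oplus>\<^bsub>R.\<Omega>\<^esub> j\<in>{..n}. r j \<odot>\<^bsub>R.\<Omega>\<^esub> R.d (coord_var n I j))"
    by (auto simp: Omega_coord_eq d_coord_eq)
  have "\<forall>j\<in>{..n}. \<exists>f\<in>H i. r j = coord_class n I f"
    using r(1) unfolding coord_piece_def by blast
  then obtain g where g: "\<And>j. j \<le> n \<Longrightarrow> g j \<in> H i" "\<And>j. j \<le> n \<Longrightarrow> r j = coord_class n I (g j)"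
    by (metis atMost_iff)
  have "g \<in> R.Pvec"
    using homog_closed[OF g(1)] by (simp add: R.Pvec_def)
  then have "w = R.\<theta> g"
    unfolding r(2) R.\<theta>_def
    by (intro R.Omega.M.finsum_cong'[OF refl R.theta_term_closed]) (simp_all add: g(2))
  then show "w \<in> R.\<theta> ` {g. \<forall>j\<le>n. g j \<in> H i}"
    using g(1) by blast
next
  fix w assume "w \<in> R.\<theta> ` {g. \<forall>j\<le>n. g j \<in> H i}"
  then obtain g where g: "\<And>j. j \<le> n \<Longrightarrow> g j \<in> H i" "w = R.\<theta> g"
    by blast
  have "(\<lambda>j. coord_class n I (g j)) \<in> {..n} \<rightarrow> coord_piece n I i"
    using coord_pieceI[OF g(1)] by simp
  then show "w \<in> Omega_piece n I (Suc i)"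
    unfolding g(2) R.\<theta>_def Omega_piece.simps Omega_coord_eq d_coord_eq
    by (intro CollectI exI[of _ "\<lambda>j. coord_class n I (g j)"] conjI refl)
qed

definition "homog_ker i = {g. (\<forall>j\<le>n. g j \<in> H i) \<and> (\<Sum>j\<le>n. var j * g j) \<in> I}"

lemma homog_Pvec: "\<forall>j\<le>n. g j \<in> H i \<Longrightarrow> g \<in> R.Pvec"
  unfolding R.Pvec_def using homog_closed by blast

lemma homog_ker_Pvec: "g \<in> homog_ker i \<Longrightarrow> g \<in> R.Pvec"
  unfolding homog_ker_def by (blast intro: homog_Pvec)

lemma euler_ker_piece: "euler_ker n I \<inter> Omega_piece n I (Suc i) = R.\<theta> ` homog_ker i"
proof -
  have "R.\<theta> g \<in> euler_ker n I \<longleftrightarrow> (\<Sum>j\<le>n. var j * g j) \<in> I" if "\<forall>j\<le>n. g j \<in> H i" for g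
    by (rule euler_ker_theta[OF homog_Pvec[OF that]])
  then show ?thesis
    unfolding Omega_piece_Suc homog_ker_def by blast
qed

lemma homog_ker_add: "g \<in> homog_ker i \<Longrightarrow> h \<in> homog_ker i \<Longrightarrow> (\<lambda>j. g j + h j) \<in> homog_ker i"
  by (simp add: homog_ker_def homog_add distrib_left sum.distrib I_add)

lemma homog_ker_minus: "g \<in> homog_ker i \<Longrightarrow> h \<in> homog_ker i \<Longrightarrow> (\<lambda>j. g j - h j) \<in> homog_ker i"
  by (simp add: homog_ker_def homog_minus right_diff_distrib sum_subtractf I_minus)

lemma homog_ker_const: "g \<in> homog_ker i \<Longrightarrow> (\<lambda>j. const c * g j) \<in> homog_ker i"
proof -
  assume g: "g \<in> homog_ker i"
  have "(\<Sum>j\<le>n. var j * (const c * g j)) = const c * (\<Sum>j\<le>n. var j * g j)"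
    by (simp only: sum_distrib_left mult.left_commute)
  then show ?thesis
    using g by (simp add: homog_ker_def homog_const_mult I_mult)
qed

text \<open>This comes down to \<open>I \<subseteq> Iaff\<close>, and makes the map of differentials
  induced by \<open>R \<rightarrow> S\<close> well defined.\<close>

lemma R_U_S_U:
  assumes "g \<in> R.U"
  shows "g \<in> S.U"
proof -
  obtain f where f: "f \<in> I" "\<And>j. j \<le> n \<Longrightarrow> g j - pdiff j f \<in> I"
    using assms by (rule R.UE[unfolded R_J]) (rule that)
  show ?thesis
  proof (rule S.UI)
    show "f \<in> S.J"
      unfolding S_J by (rule I_Iaff[OF f(1)])
    show "g \<in> S.Pvec"
      by (rule R.U_Pvec[OF assms])
    show "g j - pdiff j f \<in> S.J" if "j \<le> n" for j
      unfolding S_J by (rule I_Iaff[OF f(2)[OF that]])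
  qed
qed

text \<open>The map of differentials induced by \<open>R \<rightarrow> S\<close>. On vectors of
  polynomials it is the identity; only the relations change.\<close>

definition "dehomogenise w = S.\<theta> (SOME g. g \<in> R.Pvec \<and> R.\<theta> g = w)"

lemma dehomogenise_theta:
  assumes "g \<in> R.Pvec"
  shows "dehomogenise (R.\<theta> g) = S.\<theta> g"
proof -
  let ?h = "SOME h. h \<in> R.Pvec \<and> R.\<theta> h = R.\<theta> g"
  have h: "?h \<in> R.Pvec \<and> R.\<theta> ?h = R.\<theta> g"
    by (rule someI[of _ g]) (use assms in simp)
  then have "(\<lambda>j. ?h j - g j) \<in> S.U"
    using R.theta_eq_iff[of ?h g] assms by (intro R_U_S_U) simp
  then show ?thesis
    unfolding dehomogenise_def using h assms S.theta_eq_iff[of ?h g] by simp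
qed

lemma euler_ker_dim:
  assumes i: "i \<ge> 2 * regularity_index n I"
  shows "subspace_dim (coord_const n I) (Omega_coord n I) (euler_ker n I \<inter> Omega_piece n I (Suc i))
    = subspace_dim (affine_const n I) (Omega_affine n I) (carrier (Omega_affine n I))"
  unfolding subspace_dim_def euler_ker_piece Omega_coord_eq Omega_affine_eq affine_const_eq
proof (rule vectorspace_dim_bij)
  let ?V = "restrict_scalars (coord_const n I) R.\<Omega>\<lparr>carrier := R.\<theta> ` homog_ker i\<rparr>"
  let ?W = "restrict_scalars (\<lambda>c. affine_class (const c)) S.\<Omega>\<lparr>carrier := carrier S.\<Omega>\<rparr>"
  show "vectorspace ring_of_type_algebra ?V"
  proof (rule subspace_vectorspace[OF R.Omega_module R.scalar_hom])
    show "R.\<theta> ` homog_ker i \<subseteq> carrier R.\<Omega>"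
      using R.theta_closed[OF homog_ker_Pvec] by blast
    have "(\<lambda>j. 0) \<in> homog_ker i"
      by (simp add: homog_ker_def I_0)
    then show "\<zero>\<^bsub>R.\<Omega>\<^esub> \<in> R.\<theta> ` homog_ker i"
      unfolding R.theta_zero[symmetric] by (rule imageI)
    fix x assume "x \<in> R.\<theta> ` homog_ker i"
    then obtain g where g: "g \<in> homog_ker i" "x = R.\<theta> g"
      by blast
    show "coord_const n I c \<odot>\<^bsub>R.\<Omega>\<^esub> x \<in> R.\<theta> ` homog_ker i" for c
      unfolding g(2) R.const_theta[OF homog_ker_Pvec[OF g(1)]] by (rule imageI[OF homog_ker_const[OF g(1)]])
    show "x \<oplus>\<^bsub>R.\<Omega>\<^esub> y \<in> R.\<theta> ` homog_ker i" if y: "y \<in> R.\<theta> ` homog_ker i" for y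
    proof -
      obtain h where h: "h \<in> homog_ker i" "y = R.\<theta> h"
        using y by blast
      show ?thesis
        unfolding g(2) h(2) R.theta_add[OF homog_ker_Pvec[OF g(1)] homog_ker_Pvec[OF h(1)], symmetric]
        by (rule imageI[OF homog_ker_add[OF g(1) h(1)]])
    qed
  qed
  show "vectorspace ring_of_type_algebra ?W"
    by (rule subspace_vectorspace[OF S.Omega_module S.scalar_hom]) simp_all
  show "dehomogenise \<in> module_hom ring_of_type_algebra ?V ?W"
  proof (rule module_homI, unfold restrict_scalars_simps)
    fix x assume "x \<in> R.\<theta> ` homog_ker i"
    then obtain g where g: "g \<in> homog_ker i" "x = R.\<theta> g"
      by blast
    note gP = homog_ker_Pvec[OF g(1)]
    show "dehomogenise x \<in> carrier S.\<Omega>"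
      unfolding g(2) dehomogenise_theta[OF gP] by (rule S.theta_closed[OF gP])
    show "dehomogenise (x \<oplus>\<^bsub>R.\<Omega>\<^esub> y) = dehomogenise x \<oplus>\<^bsub>S.\<Omega>\<^esub> dehomogenise y"
      if y: "y \<in> R.\<theta> ` homog_ker i" for y
    proof -
      obtain h where h: "h \<in> homog_ker i" "y = R.\<theta> h"
        using y by blast
      note hP = homog_ker_Pvec[OF h(1)]
      show ?thesis
        unfolding g(2) h(2) R.theta_add[OF gP hP, symmetric] dehomogenise_theta[OF gP]
          dehomogenise_theta[OF hP] dehomogenise_theta[OF R.Pvec_add[OF gP hP]]
        by (rule S.theta_add[OF gP hP])
    qed
    show "dehomogenise (coord_const n I c \<odot>\<^bsub>R.\<Omega>\<^esub> x) = affine_class (const c) \<odot>\<^bsub>S.\<Omega>\<^esub> dehomogenise x" for c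
      unfolding g(2) R.const_theta[OF gP] dehomogenise_theta[OF gP]
        dehomogenise_theta[OF R.Pvec_smult[OF poly_ring_closed(3) gP]]
      by (rule S.const_theta[OF gP, symmetric])
  qed
  show "bij_betw dehomogenise (carrier ?V) (carrier ?W)"
    unfolding restrict_scalars_simps
  proof (rule bij_betw_imageI)
    show "inj_on dehomogenise (R.\<theta> ` homog_ker i)"
    proof (rule inj_onI)
      fix x y assume "x \<in> R.\<theta> ` homog_ker i" "y \<in> R.\<theta> ` homog_ker i" and eq: "dehomogenise x = dehomogenise y"
      then obtain g h where g: "g \<in> homog_ker i" "x = R.\<theta> g" and h: "h \<in> homog_ker i" "y = R.\<theta> h"
        by blast
      note gP = homog_ker_Pvec[OF g(1)] and hP = homog_ker_Pvec[OF h(1)]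
      have "S.\<theta> g = S.\<theta> h"
        using eq by (simp only: g(2) h(2) dehomogenise_theta[OF gP] dehomogenise_theta[OF hP])
      then have "(\<lambda>j. g j - h j) \<in> S.U"
        using S.theta_eq_iff[OF gP hP] by simp
      then obtain F where F: "F \<in> Iaff" "\<And>j. j \<le> n \<Longrightarrow> (g j - h j) - pdiff j F \<in> Iaff"
        by (rule S.UE[unfolded S_J]) (rule that)
      have k: "j \<le> n \<Longrightarrow> g j - h j \<in> H i" "(\<Sum>j\<le>n. var j * (g j - h j)) \<in> I" for j
        using homog_ker_minus[OF g(1) h(1)] by (simp_all add: homog_ker_def)
      \<comment> \<open>The difference of the two vectors is again homogeneous and satisfies the
        Euler relation, which allows its relation over \<open>S\<close> to be lifted to one over
        \<open>R\<close>.\<close>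
      obtain F' where F': "F' \<in> I" "\<forall>j\<le>n. (g j - h j) - pdiff j F' \<in> I"
        using gradient_dehomogenise_inj[OF regularity_surj i k F] by blast
      have "(\<lambda>j. g j - h j) \<in> R.U"
        by (rule R.UI[unfolded R_J, OF F'(1) R.Pvec_minus[OF gP hP]]) (simp add: F'(2))
      then show "x = y"
        unfolding g(2) h(2) using R.theta_eq_iff[OF gP hP] by simp
    qed
    show "dehomogenise ` R.\<theta> ` homog_ker i = carrier S.\<Omega>"
    proof (intro equalityI subsetI)
      fix w assume "w \<in> dehomogenise ` R.\<theta> ` homog_ker i"
      then obtain g where g: "g \<in> homog_ker i" "w = dehomogenise (R.\<theta> g)"
        by blast
      show "w \<in> carrier S.\<Omega>"
        unfolding g(2) dehomogenise_theta[OF homog_ker_Pvec[OF g(1)]]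
        by (rule S.theta_closed[OF homog_ker_Pvec[OF g(1)]])
    next
      fix w assume "w \<in> carrier S.\<Omega>"
      then obtain g where g: "g \<in> S.Pvec" "w = S.\<theta> g"
        using S.theta_surj by blast
      have i': "i \<ge> regularity_index n I"
        using i by simp
      obtain h where h: "(\<forall>j\<le>n. h j \<in> H i) \<and> (\<Sum>j\<le>n. var j * h j) \<in> I \<and>
          (\<exists>F\<in>Iaff. \<forall>j\<le>n. (g j - h j) - pdiff j F \<in> Iaff)"
        using gradient_dehomogenise_surj[OF regularity_surj i' S.PvecD[OF g(1)]] by (rule exE)
      then obtain F where F: "F \<in> Iaff" "\<forall>j\<le>n. (g j - h j) - pdiff j F \<in> Iaff"
        by (elim conjE bexE)
      have hk: "h \<in> homog_ker i"
        using h by (simp add: homog_ker_def)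
      note hP = homog_ker_Pvec[OF hk]
      have "(\<lambda>j. g j - h j) \<in> S.U"
        by (rule S.UI[unfolded S_J, OF F(1) S.Pvec_minus[OF g(1) hP]]) (simp add: F(2))
      then have "w = dehomogenise (R.\<theta> h)"
        unfolding g(2) dehomogenise_theta[OF homog_ker_Pvec[OF hk]]
        using S.theta_eq_iff[OF g(1) hP] by simp
      then show "w \<in> dehomogenise ` R.\<theta> ` homog_ker i"
        using hk by blast
    qed
  qed
qed

end

theorem proposition4p2:
  fixes n :: nat and I :: "'k::field mpol set"
  assumes "perfect_field TYPE('k)"
    and "n \<ge> 1"
    and "homogeneous_ideal n I"
    and "saturated n I"
    and "zero_dimensional n I"
    and "\<forall>p\<in>proj_support n I. var 0 \<notin> p"
  shows "Omega_torsion n I \<subseteq> euler_ker n I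
    \<and> annihilator (coord_ring n I) (Omega_coord n I) (d_coord n I (coord_var n I 0))
        = {\<zero>\<^bsub>coord_ring n I\<^esub>}
    \<and> euler_ker n I
        \<inter> cyclic_submodule (coord_ring n I) (Omega_coord n I) (d_coord n I (coord_var n I 0))
        = {\<zero>\<^bsub>Omega_coord n I\<^esub>}
    \<and> (\<forall>i \<ge> 2 * regularity_index n I + 1.
        subspace_dim (coord_const n I) (Omega_coord n I) (euler_ker n I \<inter> Omega_piece n I i)
          = subspace_dim (affine_const n I) (Omega_affine n I) (carrier (Omega_affine n I)))"
proof -
  interpret affine_scheme n I
    by unfold_locales (fact assms)+
  \<comment> \<open>The bound makes \<open>i\<close> positive, so it is the successor of a
    coefficient degree that is at least \<open>2 * regularity_index n I\<close>.\<close>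
  have "subspace_dim (coord_const n I) (Omega_coord n I) (euler_ker n I \<inter> Omega_piece n I i)
      = subspace_dim (affine_const n I) (Omega_affine n I) (carrier (Omega_affine n I))"
    if "i \<ge> 2 * regularity_index n I + 1" for i
    using that euler_ker_dim[of "i - 1"] by (cases i) simp_all
  then show ?thesis
    using torsion_subset annihilator_d_X0 euler_ker_cyclic by blast
qed

end
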